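(* For each $n \geq 1$ let $\mathcal{A}_n$ be uniformly distributed on $\mathcal{M}(n,2)$ and let $L(\mathcal{A}_n) := \max\{j \geq 1 : \chi_j(\mathcal{A}_n) > 0\}$ be the size of the largest irreducible component of $\mathcal{A}_n$. Then, as $n \to \infty$, $L(\mathcal{A}_n)/n$ converges weakly to the probability measure $\mathcal{L}$ on $(0,1)$ characterized by its moments given as $$\int_{(0,1)} u^m \, d\mathcal{L}(u) := \dfrac{\sqrt{e}}{2\,\Gamma(m + 1/2)} \int_0^\infty \exp\left(-\dfrac{1}{2}\int_u^\infty \dfrac{e^{-v}}{v}\, dv - u\right) u^{m-1}\, du, \quad \text{for all } m \geq 1.$$
   Context: For $n \geq 1$, $\mathcal{M}(n,2)$ is the (finite) set of $n \times n$ matrices $A = (a_{ij})$ with non-negative integer entries all of whose row sums and column sums equal $2$. Each $A \in \mathcal{M}(n,2)$ is identified with the labelled $2$-regular bipartite graph (multiple edges allowed) $G_A$ on vertices $\{R_1,\ldots,R_n\} \cup \{C_1,\ldots,C_n\}$ having exactly $a_{ij}$ edges between $R_i$ and $C_j$. A $k$-component of $A$ is a pair $(S,T)$ of non-empty subsets of $\{1,\ldots,n\}$ with $|S| = |T| = k$ such that the submatrix $(a_{ij})_{i\in S, j \in T}$ has all row and column sums equal to $2$; its size is $k$. A component $(S,T)$ is irreducible if any component $(S',T')$ with $S' \subseteq S$ and $T' \subseteq T$ satisfies $S'=S$ and $T'=T$. $\chi_k(A)$ denotes the number of irreducible $k$-components of $A$, equivalently the number of connected components of $G_A$ having exactly $2k$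 vertices. $\Gamma$ denotes the Gamma function.
   Formalization: The prefactor √e/(2Γ(m+1/2)) in the moment formula is replaced by √π/(2Γ(m+1/2)); with √e the moments would force total mass √(e/π) ≠ 1 on (0,1), so no probability measure on (0,1) would have them. *)

theory Defs
  imports "HOL-Probability.Probability" "Jordan_Normal_Form.Matrix"
begin

text \<open>Rows and columns are indexed from 0, following the matrix library.\<close>

definition two_regular_mats :: "nat \<Rightarrow> nat mat set" where
  "two_regular_mats n = {A \<in> carrier_mat n n.
     (\<forall>i<n. (\<Sum>j<n. A $$ (i, j)) = 2) \<and> (\<forall>j<n. (\<Sum>i<n. A $$ (i, j)) = 2)}"

definition is_component :: "nat mat \<Rightarrow> nat set \<Rightarrow> nat set \<Rightarrow> bool" where
  "is_component A S T \<longleftrightarrow>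
     S \<noteq> {} \<and> S \<subseteq> {..<dim_row A} \<and> T \<noteq> {} \<and> T \<subseteq> {..<dim_col A} \<and> card S = card T \<and>
     (\<forall>i\<in>S. (\<Sum>j\<in>T. A $$ (i, j)) = 2) \<and> (\<forall>j\<in>T. (\<Sum>i\<in>S. A $$ (i, j)) = 2)"

definition irreducible_component :: "nat mat \<Rightarrow> nat set \<Rightarrow> nat set \<Rightarrow> bool" where
  "irreducible_component A S T \<longleftrightarrow> is_component A S T \<and>
     (\<forall>S' T'. is_component A S' T' \<and> S' \<subseteq> S \<and> T' \<subseteq> T \<longrightarrow> S' = S \<and> T' = T)"

definition num_irreducible :: "nat \<Rightarrow> nat mat \<Rightarrow> nat" where
  "num_irreducible k A = card {(S, T). irreducible_component A S T \<and> card S = k}"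

text \<open>For n = 0 the maximum below is over the empty set and hence unspecified; this does not
  affect limits as n tends to infinity.\<close>

definition largest_component :: "nat mat \<Rightarrow> nat" where
  "largest_component A = Max {j. 1 \<le> j \<and> num_irreducible j A > 0}"

lemma finite_two_regular_mats: "finite (two_regular_mats n)"
proof (rule finite_subset)
  show "two_regular_mats n \<subseteq>
    (\<lambda>f. mat n n f) ` (({..<n} \<times> {..<n}) \<rightarrow>\<^sub>E {..2})"
  proof
    fix A assume A: "A \<in> two_regular_mats n"
    have le: "A $$ (i, j) \<le> 2" if "i < n" "j < n" for i j
    proof -
      have "A $$ (i, j) \<le> (\<Sum>j<n. A $$ (i, j))"
        using that by (intro member_le_sum) auto
      then show ?thesis using A that by (simp add: two_regular_mats_def)
    qed
    have "A = mat n n (restrict (\<lambda>p. A $$ p) ({..<n} \<times> {..<n}))"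
      using A by (intro eq_matI) (auto simp: two_regular_mats_def)
    moreover have "restrict (\<lambda>p. A $$ p) ({..<n} \<times> {..<n}) \<in> ({..<n} \<times> {..<n}) \<rightarrow>\<^sub>E {..2}"
      using le by auto
    ultimately show "A \<in> (\<lambda>f. mat n n f) ` (({..<n} \<times> {..<n}) \<rightarrow>\<^sub>E {..2})"
      by blast
  qed
qed (auto intro!: finite_PiE)

lemma two_regular_mats_nonempty: "two_regular_mats n \<noteq> {}"
proof -
  have "mat n n (\<lambda>(i, j). if i = j then 2 else 0) \<in> two_regular_mats n"
    by (auto simp: two_regular_mats_def)
  then show ?thesis by blast
qed

definition largest_component_law :: "nat \<Rightarrow> real measure" where
  "largest_component_law n =
     distr (measure_pmf (pmf_of_set (two_regular_mats n))) borel
       (\<lambda>A. real (largest_component A) / real n)"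

definition exp_integral :: "real \<Rightarrow> real" where
  "exp_integral u = (LBINT v:{u..}. exp (- v) / v)"

text \<open>
  Erratum: the source prints \<open>sqrt e / (2 \<Gamma>(m + 1/2))\<close> as the prefactor. The correct one
  is \<open>\<Gamma>(3/2) / \<Gamma>(m + 1/2) = sqrt \<pi> / (2 \<Gamma>(m + 1/2))\<close>, which gives the moments of the
  largest coordinate of the Poisson-Dirichlet distribution with parameter 1/2. A finite
  measure on (0,1) is determined by its moments of order at least 1, so with the
  numerator \<open>sqrt e\<close> the total mass would be \<open>sqrt (e / \<pi>)\<close> instead of 1, and no
  probability measure on (0,1) would have these moments.
\<close>

definition limit_moment :: "nat \<Rightarrow> real" where
  "limit_moment m = sqrt pi / (2 * Gamma (real m + 1/2)) *
     (LBINT u:{0<..}. exp (- (1/2) * exp_integral u - u) * u ^ (m - 1))"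

definition is_limit_law :: "real measure \<Rightarrow> bool" where
  "is_limit_law \<mu> \<longleftrightarrow> real_distribution \<mu> \<and> measure \<mu> {0<..<1} = 1 \<and>
     (\<forall>m\<ge>1. (LINT u:{0<..<1}|\<mu>. u ^ m) = limit_moment m)"

end

theory Submission
  imports Defs "HOL-Real_Asymp.Real_Asymp"
begin

text \<open>
  A 2-regular matrix splits uniquely into connected blocks. A connected block of size \<open>k \<ge> 2\<close> is a
  cycle, and there are \<open>k! (k - 1)! / 2\<close> of them, whereas for \<open>k = 1\<close> there is one. Let \<open>b r n\<close> be the
  number of matrices of size \<open>n\<close> with all components of size at most \<open>r\<close>, divided by \<open>(n!)\<^sup>2\<close>, and
  let \<open>a n = b n n\<close>; these are \<open>small_density\<close> and \<open>mat_density\<close> below. The largest component is at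
  most \<open>r\<close> with probability \<open>b r n / a n\<close> (\<open>prob_largest_component_le\<close>). Splitting off the component
  of a fixed row gives \<open>n * b r n = (\<Sum>k = 1..min r n. w k * b r (n - k))\<close> with \<open>w 1 = 1\<close> and
  \<open>w k = 1/2\<close> otherwise. The number of cycles itself comes out of this decomposition
  (\<open>double_entry_connected_weight\<close>): it also holds for matrices whose rows carry an ordering of
  their two units, and those are counted by \<open>(2 * n)! / 2 ^ n\<close>.

  The generating function of \<open>b r\<close> is \<open>exp (z / 2 + (\<Sum>k = 1..r. z ^ k / k) / 2)\<close>. For
  \<open>z = exp (- s / r)\<close> the tail of the logarithmic series beyond \<open>r\<close> tends to the exponential
  integral of \<open>s\<close> as \<open>r\<close> grows (\<open>harmonic_tail_exp_integral\<close>). So the Laplace transform of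
  \<open>y \<mapsto> sqrt r * (a (r * y) - b r (r * y))\<close> converges to
  \<open>sqrt (exp 1 / s) * (1 - exp (- exp_integral s / 2))\<close>.
  The passage back to the functions themselves is Tauberian and rests on \<open>b r\<close> being decreasing
  (\<open>small_density_step\<close>). Helly's theorem provides limits along subsequences, their Laplace
  transform identifies them (\<open>small_limit_unique\<close>), and hence \<open>sqrt r * b r (r * y)\<close> converges at
  all but countably many \<open>y\<close> (\<open>scaled_small_tendsto\<close>). This amounts to convergence of the
  distribution functions of the normalised largest component.

  The moments of the limit need no explicit formula for it. The moment of order \<open>m\<close> is an integral
  of tail probabilities against \<open>m * y powr (- m - 1)\<close>, and after inserting the asymptotics of \<open>a\<close>
  the relevant power is \<open>y powr (- m - 1/2)\<close>, which is a Gamma integral over exponentials. So the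
  limiting moment is an integral of the known Laplace transform (\<open>nn_integral_limit_profile\<close>), and
  an integration by parts brings it into the stated form.

  Finally the laws live on the unit interval, where a distribution is determined by its moments, so
  they are tight and only the limits along subsequences have to be examined
  (\<open>subsequential_limit_is_limit_law\<close>). Their moments of positive order are the right ones; what
  the moments do not show is that no mass escapes to 0, and this follows from the uniform bound
  \<open>law_near_0\<close>. Mass at 1 is impossible because the moments tend to 0.
\<close>

section \<open>Blocks and components of 2-regular matrices\<close>

text \<open>
  Matrices are viewed as functions supported on \<open>X \<times> Y\<close>, so that their blocks, which live on
  arbitrary subsets of the indices, are objects of the same kind.
\<close>
definition tworeg :: "nat set \<Rightarrow> nat set \<Rightarrow> (nat \<times> nat \<Rightarrow> nat) set" where
  "tworeg X Y = {f. (\<forall>i j. f (i, j) \<noteq> 0 \<longrightarrow> i \<in> X \<and> j \<in> Y) \<and>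
     (\<forall>i\<in>X. (\<Sum>j\<in>Y. f (i, j)) = 2) \<and> (\<forall>j\<in>Y. (\<Sum>i\<in>X. f (i, j)) = 2)}"

text \<open>
  No nonzero entry joins \<open>S\<close> to the complement of \<open>T\<close> or \<open>T\<close> to the complement of \<open>S\<close>. For
  2-regular matrices this is equivalent to all line sums of the block being 2, but in this form
  differences and intersections of blocks are visibly blocks.
\<close>
definition splits :: "(nat \<times> nat \<Rightarrow> nat) \<Rightarrow> nat set \<Rightarrow> nat set \<Rightarrow> bool" where
  "splits f S T \<longleftrightarrow> (\<forall>i j. f (i, j) \<noteq> 0 \<longrightarrow> (i \<in> S \<longleftrightarrow> j \<in> T))"

definition connected_tworeg :: "nat set \<Rightarrow> nat set \<Rightarrow> (nat \<times> nat \<Rightarrow> nat) set" where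
  "connected_tworeg S T = {g \<in> tworeg S T. S \<noteq> {} \<and>
     (\<forall>S' T'. S' \<subseteq> S \<and> T' \<subseteq> T \<and> splits g S' T' \<longrightarrow> S' = {} \<or> S' = S)}"

text \<open>
  This says that every irreducible component has size at most \<open>r\<close>. The blocks are not required
  to be irreducible, since an irreducible component lies inside any block that it meets; this
  makes the property easy to transfer between a matrix and its blocks.
\<close>
definition blocks_le :: "nat \<Rightarrow> nat set \<Rightarrow> nat set \<Rightarrow> (nat \<times> nat \<Rightarrow> nat) \<Rightarrow> bool" where
  "blocks_le r X Y f \<longleftrightarrow> (\<forall>i\<in>X. \<exists>S T. S \<subseteq> X \<and> T \<subseteq> Y \<and> splits f S T \<and> i \<in> S \<and> card S \<le> r)"

definition cutout :: "(nat \<times> nat \<Rightarrow> nat) \<Rightarrow> nat set \<Rightarrow> nat set \<Rightarrow> (nat \<times> nat \<Rightarrow> nat)" where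
  "cutout f S T = (\<lambda>(i, j). if i \<in> S \<and> j \<in> T then f (i, j) else 0)"

definition splitting_pairs where
  "splitting_pairs f X Y i = {(S, T). S \<subseteq> X \<and> T \<subseteq> Y \<and> splits f S T \<and> i \<in> S}"

text \<open>
  The connected component of row \<open>i\<close>, obtained as the smallest block that contains it.
\<close>
definition row_part where "row_part f X Y i = \<Inter> (fst ` splitting_pairs f X Y i)"
definition col_part where "col_part f X Y i = \<Inter> (snd ` splitting_pairs f X Y i)"

lemma tworegD:
  assumes "f \<in> tworeg X Y"
  shows "f (i, j) \<noteq> 0 \<Longrightarrow> i \<in> X" "f (i, j) \<noteq> 0 \<Longrightarrow> j \<in> Y"
    "i \<in> X \<Longrightarrow> (\<Sum>j\<in>Y. f (i, j)) = 2" "j \<in> Y \<Longrightarrow> (\<Sum>i\<in>X. f (i, j)) = 2"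
  using assms by (auto simp: tworeg_def)

lemma connected_tworegD:
  "g \<in> connected_tworeg S T \<Longrightarrow> S' \<subseteq> S \<Longrightarrow> T' \<subseteq> T \<Longrightarrow> splits g S' T' \<Longrightarrow> S' = {} \<or> S' = S"
  by (auto simp: connected_tworeg_def)

lemma tworeg_zero:
  assumes "f \<in> tworeg X Y"
  shows "i \<notin> X \<Longrightarrow> f (i, j) = 0" "j \<notin> Y \<Longrightarrow> f (i, j) = 0"
  using assms unfolding tworeg_def by blast+

lemma tworeg_col_nonzero:
  assumes "f \<in> tworeg X Y" "j \<in> Y" shows "\<exists>i\<in>X. f (i, j) \<noteq> 0"
proof (rule ccontr)
  assume "\<not> ?thesis"
  then have "(\<Sum>i\<in>X. f (i, j)) = 0" by auto
  with tworegD(4)[OF assms] show False by simp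
qed

lemma splits_row_sum:
  assumes f: "f \<in> tworeg X Y" and "finite Y" "T \<subseteq> Y" "splits f S T" "i \<in> S" "S \<subseteq> X"
  shows "(\<Sum>j\<in>T. f (i, j)) = 2"
proof -
  have "(\<Sum>j\<in>T. f (i, j)) = (\<Sum>j\<in>Y. f (i, j))"
    using assms by (intro sum.mono_neutral_left) (auto simp: splits_def)
  also have "\<dots> = 2" using assms tworegD(3)[OF f] by auto
  finally show ?thesis .
qed

lemma splits_col_sum:
  assumes f: "f \<in> tworeg X Y" and "finite X" "S \<subseteq> X" "splits f S T" "j \<in> T" "T \<subseteq> Y"
  shows "(\<Sum>i\<in>S. f (i, j)) = 2"
proof -
  have "(\<Sum>i\<in>S. f (i, j)) = (\<Sum>i\<in>X. f (i, j))"
    using assms by (intro sum.mono_neutral_left) (auto simp: splits_def)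
  also have "\<dots> = 2" using assms tworegD(4)[OF f] by auto
  finally show ?thesis .
qed

lemma tworeg_card_eq:
  assumes f: "f \<in> tworeg X Y" and "finite X" "finite Y" shows "card X = card Y"
proof -
  have "2 * card X = (\<Sum>i\<in>X. \<Sum>j\<in>Y. f (i, j))" using tworegD(3)[OF f] by simp
  also have "\<dots> = (\<Sum>j\<in>Y. \<Sum>i\<in>X. f (i, j))" by (rule sum.swap)
  also have "\<dots> = 2 * card Y" using tworegD(4)[OF f] by simp
  finally show ?thesis by simp
qed

text \<open>
  A row of \<open>S\<close> already has its whole sum 2 inside \<open>T\<close>, so its remaining entries vanish; the
  same holds for the columns of \<open>T\<close>.
\<close>
lemma splits_if_line_sums:
  assumes f: "f \<in> tworeg X Y" and fin: "finite X" "finite Y" and sub: "S \<subseteq> X" "T \<subseteq> Y"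
    and r: "\<And>i. i \<in> S \<Longrightarrow> (\<Sum>j\<in>T. f (i, j)) = 2" and c: "\<And>j. j \<in> T \<Longrightarrow> (\<Sum>i\<in>S. f (i, j)) = 2"
  shows "splits f S T"
  unfolding splits_def
proof (intro allI impI)
  fix i j assume nz: "f (i, j) \<noteq> 0"
  then have ij: "i \<in> X" "j \<in> Y" using tworegD[OF f] by auto
  show "i \<in> S \<longleftrightarrow> j \<in> T"
  proof
    assume "i \<in> S"
    have "(\<Sum>j\<in>Y. f (i, j)) = (\<Sum>j\<in>T. f (i, j)) + (\<Sum>j\<in>Y - T. f (i, j))"
      using fin sub by (metis add.commute sum.subset_diff)
    then have "(\<Sum>j\<in>Y - T. f (i, j)) = 0" using r[OF \<open>i \<in> S\<close>] tworegD(3)[OF f ij(1)] by simp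
    then have "\<forall>j\<in>Y - T. f (i, j) = 0" using fin by simp
    then show "j \<in> T" using nz ij by (metis DiffI)
  next
    assume "j \<in> T"
    have "(\<Sum>i\<in>X. f (i, j)) = (\<Sum>i\<in>S. f (i, j)) + (\<Sum>i\<in>X - S. f (i, j))"
      using fin sub by (metis add.commute sum.subset_diff)
    then have "(\<Sum>i\<in>X - S. f (i, j)) = 0" using c[OF \<open>j \<in> T\<close>] tworegD(4)[OF f ij(2)] by simp
    then have "\<forall>i\<in>X - S. f (i, j) = 0" using fin by simp
    then show "i \<in> S" using nz ij by (metis DiffI)
  qed
qed

lemma cutout_tworeg:
  assumes f: "f \<in> tworeg X Y" and "finite X" "finite Y" "S \<subseteq> X" "T \<subseteq> Y" "splits f S T"
  shows "cutout f S T \<in> tworeg S T"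
  using splits_row_sum[OF f] splits_col_sum[OF f] assms
  by (auto simp: tworeg_def cutout_def split: if_splits)

lemma splits_Diff: "splits f S T \<Longrightarrow> splits f S' T' \<Longrightarrow> splits f (S - S') (T - T')"
  by (auto simp: splits_def)

lemma splits_whole: "f \<in> tworeg X Y \<Longrightarrow> splits f X Y"
  by (auto simp: splits_def tworeg_def)

lemma splits_part: "splits f (row_part f X Y i) (col_part f X Y i)"
proof -
  have "i' \<in> row_part f X Y i \<longleftrightarrow> j' \<in> col_part f X Y i" if "f (i', j') \<noteq> 0" for i' j'
  proof -
    have "i' \<in> fst p \<longleftrightarrow> j' \<in> snd p" if "p \<in> splitting_pairs f X Y i" for p
      using that \<open>f (i', j') \<noteq> 0\<close> by (auto simp: splitting_pairs_def splits_def)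
    then show ?thesis by (simp add: row_part_def col_part_def)
  qed
  then show ?thesis by (auto simp: splits_def)
qed

lemma part_subset:
  assumes "splits f S T" "S \<subseteq> X" "T \<subseteq> Y" "i \<in> S"
  shows "row_part f X Y i \<subseteq> S" "col_part f X Y i \<subseteq> T"
proof -
  have "(S, T) \<in> splitting_pairs f X Y i" using assms by (simp add: splitting_pairs_def)
  then show "row_part f X Y i \<subseteq> S" "col_part f X Y i \<subseteq> T"
    unfolding row_part_def col_part_def by force+
qed

lemma part_props:
  assumes f: "f \<in> tworeg X Y" and i: "i \<in> X"
  shows "row_part f X Y i \<subseteq> X" "col_part f X Y i \<subseteq> Y" "i \<in> row_part f X Y i"
proof -
  show "row_part f X Y i \<subseteq> X" "col_part f X Y i \<subseteq> Y"
    using part_subset[OF splits_whole[OF f] _ _ i] by blast+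
  have "i \<in> fst p" if "p \<in> splitting_pairs f X Y i" for p
    using that by (auto simp: splitting_pairs_def)
  then show "i \<in> row_part f X Y i" by (simp add: row_part_def)
qed

lemma splits_cutout:
  assumes "splits f S T" "S' \<subseteq> S" "T' \<subseteq> T"
  shows "splits (cutout f S T) S' T' \<longleftrightarrow> splits f S' T'"
proof -
  have "splits (cutout f S T) S' T'" if "splits f S' T'"
    using that by (auto simp: splits_def cutout_def)
  moreover have "splits f S' T'" if c: "splits (cutout f S T) S' T'"
    unfolding splits_def
  proof (intro allI impI)
    fix i j assume nz: "f (i, j) \<noteq> 0"
    then have eq: "i \<in> S \<longleftrightarrow> j \<in> T" using assms(1) unfolding splits_def by metis
    show "i \<in> S' \<longleftrightarrow> j \<in> T'"
    proof (cases "i \<in> S \<and> j \<in> T")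
      case True
      then have "cutout f S T (i, j) \<noteq> 0" using nz by (simp add: cutout_def)
      then show ?thesis using c unfolding splits_def by metis
    next
      case False
      then show ?thesis using eq assms(2,3) by fast
    qed
  qed
  ultimately show ?thesis by (rule iffI[rotated])
qed

text \<open>
  A block inside the component of row \<open>i\<close> either contains \<open>i\<close>, and then equals the component by
  minimality, or its complement in the component contains \<open>i\<close>, and then it is empty.
\<close>
lemma part_connected:
  assumes f: "f \<in> tworeg X Y" and i: "i \<in> X" and fin: "finite X" "finite Y"
  shows "cutout f (row_part f X Y i) (col_part f X Y i) \<in>
    connected_tworeg (row_part f X Y i) (col_part f X Y i)"
proof -
  let ?S = "row_part f X Y i" and ?T = "col_part f X Y i"
  note p = part_props[OF f i] splits_part[of f X Y i]
  have "S' = {} \<or> S' = ?S" if S': "S' \<subseteq> ?S" "T' \<subseteq> ?T" "splits (cutout f ?S ?T) S' T'" for S' T'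
  proof -
    have sp: "splits f S' T'" using splits_cutout[OF p(4)] S' by blast
    show ?thesis
    proof (cases "i \<in> S'")
      case True
      then show ?thesis using part_subset(1)[OF sp _ _ True, of X Y] S' p by blast
    next
      case False
      have "?S \<subseteq> ?S - S'"
        using part_subset(1)[OF splits_Diff[OF p(4) sp], of X Y i] p False by blast
      then show ?thesis using S' by blast
    qed
  qed
  moreover have "?S \<noteq> {}" using p(3) by blast
  ultimately show ?thesis
    using cutout_tworeg[OF f fin p(1,2,4)] unfolding connected_tworeg_def by blast
qed

text \<open>
  Conversely to cutting out the component of a row, a connected matrix \<open>g\<close> on \<open>S \<times> T\<close> and any
  matrix \<open>h\<close> on the complementary block are glued to \<open>f\<close>. The supports are disjoint, so \<open>g\<close> and
  \<open>h\<close> are recovered from \<open>f\<close>, and \<open>S\<close> is again a component.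
\<close>

context
  fixes X Y S T :: "nat set" and g h f :: "nat \<times> nat \<Rightarrow> nat"
  assumes fin: "finite X" "finite Y" and sub: "S \<subseteq> X" "T \<subseteq> Y"
    and g: "g \<in> connected_tworeg S T" and h: "h \<in> tworeg (X - S) (Y - T)"
    and f: "f = (\<lambda>p. g p + h p)"
begin

private lemma gt: "g \<in> tworeg S T" using g by (simp add: connected_tworeg_def)

lemma glue_in: "i \<in> S \<Longrightarrow> f (i, j) = g (i, j)" "j \<in> T \<Longrightarrow> f (i, j) = g (i, j)"
  "i \<notin> S \<Longrightarrow> f (i, j) = h (i, j)" "j \<notin> T \<Longrightarrow> f (i, j) = h (i, j)"
proof -
  have 1: "g (i, j) = 0 \<or> i \<in> S \<and> j \<in> T" using tworegD(1,2)[OF gt, of i j] by blast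
  have 2: "h (i, j) = 0 \<or> i \<notin> S \<and> j \<notin> T" using tworegD(1,2)[OF h, of i j] by blast
  show "i \<in> S \<Longrightarrow> f (i, j) = g (i, j)" "j \<in> T \<Longrightarrow> f (i, j) = g (i, j)"
    "i \<notin> S \<Longrightarrow> f (i, j) = h (i, j)" "j \<notin> T \<Longrightarrow> f (i, j) = h (i, j)"
    using 1 2 by (simp_all add: f)
qed

lemma glue_splits: "splits f S T"
  unfolding splits_def
proof (intro allI impI)
  fix i j assume "f (i, j) \<noteq> 0"
  then show "i \<in> S \<longleftrightarrow> j \<in> T"
    using tworegD(1,2)[OF gt, of i j] tworegD(1,2)[OF h, of i j] unfolding f by fastforce
qed

lemma glue_tworeg: "f \<in> tworeg X Y"
proof -
  have "(\<Sum>j\<in>Y. f (i, j)) = 2" if "i \<in> X" for i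
  proof (cases "i \<in> S")
    case True
    have "(\<Sum>j\<in>Y. f (i, j)) = (\<Sum>j\<in>T. g (i, j))"
      using fin sub True by (intro sum.mono_neutral_cong_right) (auto simp: glue_in tworeg_zero[OF gt] tworeg_zero[OF h])
    then show ?thesis using tworegD(3)[OF gt True] by simp
  next
    case False
    have "(\<Sum>j\<in>Y. f (i, j)) = (\<Sum>j\<in>Y - T. h (i, j))"
      using fin sub False by (intro sum.mono_neutral_cong_right) (auto simp: glue_in tworeg_zero[OF gt] tworeg_zero[OF h])
    then show ?thesis using tworegD(3)[OF h] False that by simp
  qed
  moreover have "(\<Sum>i\<in>X. f (i, j)) = 2" if "j \<in> Y" for j
  proof (cases "j \<in> T")
    case True
    have "(\<Sum>i\<in>X. f (i, j)) = (\<Sum>i\<in>S. g (i, j))"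
      using fin sub True by (intro sum.mono_neutral_cong_right) (auto simp: glue_in tworeg_zero[OF gt] tworeg_zero[OF h])
    then show ?thesis using tworegD(4)[OF gt True] by simp
  next
    case False
    have "(\<Sum>i\<in>X. f (i, j)) = (\<Sum>i\<in>X - S. h (i, j))"
      using fin sub False by (intro sum.mono_neutral_cong_right) (auto simp: glue_in tworeg_zero[OF gt] tworeg_zero[OF h])
    then show ?thesis using tworegD(4)[OF h] False that by simp
  qed
  moreover have "i \<in> X \<and> j \<in> Y" if "f (i, j) \<noteq> 0" for i j
    using that sub tworegD(1,2)[OF gt, of i j] tworegD(1,2)[OF h, of i j] glue_in[of i j]
    by (cases "i \<in> S") auto
  ultimately show ?thesis by (auto simp: tworeg_def)
qed

lemma glue_part:
  assumes i: "i \<in> S"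
  shows "row_part f X Y i = S" "col_part f X Y i = T"
proof -
  let ?S = "row_part f X Y i" and ?T = "col_part f X Y i"
  have le: "?S \<subseteq> S" "?T \<subseteq> T" using part_subset[OF glue_splits sub i] by auto
  have sp: "splits g ?S ?T" using splits_part[of f X Y i] by (auto simp: splits_def f)
  have "?S = {} \<or> ?S = S" by (rule connected_tworegD[OF g le sp])
  moreover have "i \<in> ?S" by (rule part_props(3)[OF glue_tworeg]) (use i sub in auto)
  ultimately show S: "?S = S" by auto
  have "j \<in> ?T" if "j \<in> T" for j
    using tworeg_col_nonzero[OF gt that] sp S by (auto simp: splits_def)
  then show "?T = T" using le by blast
qed

lemma glue_cutout: "cutout f S T = g" "cutout f (X - S) (Y - T) = h"
proof -
  have "cutout f S T (i, j) = g (i, j)" for i j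
    using tworegD(1,2)[OF gt, of i j] glue_in[of i j] by (auto simp: cutout_def)
  then show "cutout f S T = g" by auto
  have "cutout f (X - S) (Y - T) (i, j) = h (i, j)" for i j
    using tworegD(1,2)[OF h, of i j] glue_in[of i j] by (auto simp: cutout_def)
  then show "cutout f (X - S) (Y - T) = h" by auto
qed

text \<open>
  A block of \<open>f\<close> that contains a row outside \<open>S\<close> stays a block of at most the same size after
  removing \<open>(S, T)\<close> from it.
\<close>
lemma glue_small:
  assumes cr: "card S \<le> r"
  shows "blocks_le r X Y f \<longleftrightarrow> blocks_le r (X - S) (Y - T) h"
proof
  assume s: "blocks_le r X Y f"
  show "blocks_le r (X - S) (Y - T) h"
    unfolding blocks_le_def
  proof
    fix i assume i: "i \<in> X - S"
    then obtain S1 T1 where 1: "S1 \<subseteq> X" "T1 \<subseteq> Y" "splits f S1 T1" "i \<in> S1" "card S1 \<le> r"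
      using s by (auto simp: blocks_le_def)
    have "splits f (S1 - S) (T1 - T)" using splits_Diff[OF 1(3) glue_splits] .
    then have "splits h (S1 - S) (T1 - T)" by (auto simp: splits_def f)
    moreover have "card (S1 - S) \<le> r"
      using 1 fin by (meson Diff_subset card_mono finite_subset le_trans)
    ultimately show "\<exists>S' T'. S' \<subseteq> X - S \<and> T' \<subseteq> Y - T \<and> splits h S' T' \<and> i \<in> S' \<and> card S' \<le> r"
      using 1 i by (intro exI[of _ "S1 - S"] exI[of _ "T1 - T"]) auto
  qed
next
  assume s: "blocks_le r (X - S) (Y - T) h"
  show "blocks_le r X Y f"
    unfolding blocks_le_def
  proof
    fix i assume i: "i \<in> X"
    show "\<exists>S' T'. S' \<subseteq> X \<and> T' \<subseteq> Y \<and> splits f S' T' \<and> i \<in> S' \<and> card S' \<le> r"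
    proof (cases "i \<in> S")
      case True
      then show ?thesis using glue_splits cr sub by blast
    next
      case False
      then obtain S' T' where 1: "S' \<subseteq> X - S" "T' \<subseteq> Y - T" "splits h S' T'" "i \<in> S'" "card S' \<le> r"
        using bspec[OF s[unfolded blocks_le_def], of i] i False by blast
      have "splits f S' T'"
        unfolding splits_def
      proof (intro allI impI)
        fix i j assume nz: "f (i, j) \<noteq> 0"
        show "i \<in> S' \<longleftrightarrow> j \<in> T'"
        proof (cases "h (i, j) = 0")
          case True
          then have "g (i, j) \<noteq> 0" using nz f by simp
          then show ?thesis using tworegD(1,2)[OF gt, of i j] 1 by auto
        next
          case False then show ?thesis using 1(3) by (auto simp: splits_def)
        qed
      qed
      then show ?thesis using 1 by blast
    qed
  qed
qed

end

lemma cutout_add: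
  assumes f: "f \<in> tworeg X Y" and sp: "splits f S T"
  shows "(\<lambda>p. cutout f S T p + cutout f (X - S) (Y - T) p) = f"
proof
  fix p :: "nat \<times> nat" obtain i j where p: "p = (i, j)" by force
  show "cutout f S T p + cutout f (X - S) (Y - T) p = f p"
    unfolding p using tworegD(1,2)[OF f, of i j] sp
    by (cases "f (i, j) = 0") (auto simp: cutout_def splits_def)
qed

lemma card_row_part_le:
  assumes f: "f \<in> tworeg X Y" and i: "i \<in> X" and fin: "finite X" and s: "blocks_le r X Y f"
  shows "card (row_part f X Y i) \<le> r"
proof -
  obtain S T where 1: "S \<subseteq> X" "T \<subseteq> Y" "splits f S T" "i \<in> S" "card S \<le> r"
    using s i by (auto simp: blocks_le_def)
  then show ?thesis
    using part_subset(1)[OF 1(3,1,2,4)] fin by (meson card_mono finite_subset le_trans)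
qed

section \<open>Splitting off the component of a row\<close>

lemma tworeg_le_2:
  assumes f: "f \<in> tworeg X Y" and fin: "finite Y" shows "f (i, j) \<le> 2"
proof (cases "i \<in> X \<and> j \<in> Y")
  case True
  then have "f (i, j) \<le> (\<Sum>j\<in>Y. f (i, j))" using fin by (intro member_le_sum) auto
  then show ?thesis using tworegD(3)[OF f] True by simp
qed (use tworeg_zero[OF f] in auto)

lemma finite_tworeg:
  assumes "finite X" "finite Y" shows "finite (tworeg X Y)"
proof (rule finite_subset)
  show "tworeg X Y \<subseteq> (\<lambda>F p. if p \<in> X \<times> Y then F p else 0) ` ((X \<times> Y) \<rightarrow>\<^sub>E {..2})"
  proof
    fix f assume f: "f \<in> tworeg X Y"
    have "f = (\<lambda>p. if p \<in> X \<times> Y then restrict f (X \<times> Y) p else 0)"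
      using tworeg_zero[OF f] by (auto simp: fun_eq_iff)
    moreover have "restrict f (X \<times> Y) \<in> (X \<times> Y) \<rightarrow>\<^sub>E {..2}"
      using tworeg_le_2[OF f assms(2)] by auto
    ultimately show "f \<in> (\<lambda>F p. if p \<in> X \<times> Y then F p else 0) ` ((X \<times> Y) \<rightarrow>\<^sub>E {..2})"
      by blast
  qed
qed (use assms in \<open>auto intro!: finite_PiE\<close>)

definition row_weight :: "((nat \<Rightarrow> nat) \<Rightarrow> real) \<Rightarrow> nat set \<Rightarrow> (nat \<times> nat \<Rightarrow> nat) \<Rightarrow> real" where
  "row_weight v X f = (\<Prod>i\<in>X. v (\<lambda>j. f (i, j)))"

definition total_weight where
  "total_weight v r X Y = (\<Sum>f | f \<in> tworeg X Y \<and> blocks_le r X Y f. row_weight v X f)"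

definition connected_weight where
  "connected_weight v S T = (\<Sum>g\<in>connected_tworeg S T. row_weight v S g)"

text \<open>
  Sorting the matrices by the component \<open>(S, T)\<close> of a fixed row \<open>i0\<close> leaves a connected matrix on
  \<open>S \<times> T\<close> and an arbitrary one on the rest, and weights that are products over rows factor
  accordingly. The weight is kept general because two are used: the constant 1 counts matrices,
  and \<open>double_entry_weight\<close> has totals that are known in closed form.
\<close>
lemma total_weight_decomposition:
  assumes fin: "finite X" "finite Y" and i0: "i0 \<in> X"
  shows "total_weight v r X Y =
    (\<Sum>S | S \<subseteq> X \<and> i0 \<in> S \<and> card S \<le> r. \<Sum>T | T \<subseteq> Y \<and> card T = card S.
       connected_weight v S T * total_weight v r (X - S) (Y - T))"
proof -
  define A where "A = {S. S \<subseteq> X \<and> i0 \<in> S \<and> card S \<le> r}"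
  define B where "B S = {T. T \<subseteq> Y \<and> card T = card S}" for S :: "nat set"
  define K where "K = (\<lambda>(S, T). connected_tworeg S T)"
  define H where "H = (\<lambda>(S, T). {h. h \<in> tworeg (X - S) (Y - T) \<and> blocks_le r (X - S) (Y - T) h})"
  define Q where "Q = (SIGMA p:Sigma A B. K p \<times> H p)"
  have finA: "finite A" unfolding A_def using fin by (auto intro: finite_subset[OF _ finite_Pow_iff[THEN iffD2, of X]])
  have finB: "finite (B S)" for S unfolding B_def using fin by (auto intro: finite_subset[OF _ finite_Pow_iff[THEN iffD2, of Y]])
  have finK: "finite (K p)" if "p \<in> Sigma A B" for p
  proof -
    obtain S T where p: "p = (S, T)" "S \<subseteq> X" "T \<subseteq> Y" using \<open>p \<in> Sigma A B\<close> by (auto simp: A_def B_def)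
    then have "finite (tworeg S T)" using finite_tworeg fin finite_subset by metis
    then show ?thesis unfolding p K_def by (rule rev_finite_subset) (auto simp: connected_tworeg_def)
  qed
  have finH: "finite (H p)" for p
  proof -
    obtain S T where p: "p = (S, T)" by force
    show ?thesis unfolding p H_def using finite_tworeg[of "X - S" "Y - T"] fin by (auto intro: rev_finite_subset)
  qed
  have glue: "((\<lambda>q. g q + h q) \<in> tworeg X Y \<and> blocks_le r X Y (\<lambda>q. g q + h q)) \<and>
      row_part (\<lambda>q. g q + h q) X Y i0 = S \<and> col_part (\<lambda>q. g q + h q) X Y i0 = T \<and>
      cutout (\<lambda>q. g q + h q) S T = g \<and> cutout (\<lambda>q. g q + h q) (X - S) (Y - T) = h \<and>
      row_weight v X (\<lambda>q. g q + h q) = row_weight v S g * row_weight v (X - S) h"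
    if "((S, T), (g, h)) \<in> Q" for S T g h
  proof -
    have 1: "S \<subseteq> X" "T \<subseteq> Y" "g \<in> connected_tworeg S T" "h \<in> tworeg (X - S) (Y - T)" "card S \<le> r"
      "i0 \<in> S" "blocks_le r (X - S) (Y - T) h"
      using that by (auto simp: Q_def A_def B_def K_def H_def)
    note gl = fin 1(1-4) refl[of "\<lambda>q. g q + h q"]
    have "row_weight v X (\<lambda>q. g q + h q) =
        (\<Prod>i\<in>S. v (\<lambda>j. g (i, j) + h (i, j))) * (\<Prod>i\<in>X - S. v (\<lambda>j. g (i, j) + h (i, j)))"
      unfolding row_weight_def using fin 1 by (simp add: prod.subset_diff mult.commute)
    also have "(\<Prod>i\<in>S. v (\<lambda>j. g (i, j) + h (i, j))) = row_weight v S g"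
      unfolding row_weight_def by (intro prod.cong) (simp_all add: glue_in[OF gl])
    also have "(\<Prod>i\<in>X - S. v (\<lambda>j. g (i, j) + h (i, j))) = row_weight v (X - S) h"
      unfolding row_weight_def by (intro prod.cong) (simp_all add: glue_in[OF gl])
    finally show ?thesis
      using glue_tworeg[OF gl] glue_small[OF gl 1(5)] glue_part[OF gl 1(6)] glue_cutout[OF gl] 1 by simp
  qed
  have unglue: "((S, T), (cutout f S T, cutout f (X - S) (Y - T))) \<in> Q \<and>
       (\<lambda>q. cutout f S T q + cutout f (X - S) (Y - T) q) = f"
    if f: "f \<in> tworeg X Y" "blocks_le r X Y f" and ST: "S = row_part f X Y i0" "T = col_part f X Y i0" for f S T
  proof -
    note p = part_props[OF f(1) i0, folded ST] splits_part[of f X Y i0, folded ST]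
    have c: "cutout f S T \<in> connected_tworeg S T"
      using part_connected[OF f(1) i0 fin] by (simp add: ST)
    then have cc: "cutout f S T \<in> tworeg S T" by (simp add: connected_tworeg_def)
    have "card S = card T"
      using tworeg_card_eq[OF cc] p fin finite_subset by metis
    moreover have cr: "card S \<le> r" using card_row_part_le[OF f(1) i0 fin(1) f(2)] by (simp add: ST)
    moreover have h: "cutout f (X - S) (Y - T) \<in> tworeg (X - S) (Y - T)"
      using cutout_tworeg[OF f(1) fin _ _ splits_Diff[OF splits_whole[OF f(1)] p(4)]] by auto
    moreover have eq: "(\<lambda>q. cutout f S T q + cutout f (X - S) (Y - T) q) = f"
      by (rule cutout_add[OF f(1) p(4)])
    moreover have "blocks_le r (X - S) (Y - T) (cutout f (X - S) (Y - T))"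
      using glue_small[OF fin p(1,2) c h eq[symmetric] cr] f(2) by simp
    ultimately show ?thesis using p c by (auto simp: Q_def A_def B_def K_def H_def)
  qed
  have "total_weight v r X Y = (\<Sum>q\<in>Q. row_weight v X (\<lambda>p. fst (snd q) p + snd (snd q) p))"
    unfolding total_weight_def
  proof (rule sum.reindex_bij_witness[where j = "\<lambda>f. ((row_part f X Y i0, col_part f X Y i0),
        (cutout f (row_part f X Y i0) (col_part f X Y i0),
         cutout f (X - row_part f X Y i0) (Y - col_part f X Y i0)))"
        and i = "\<lambda>q p. fst (snd q) p + snd (snd q) p"])
    fix q assume q: "q \<in> Q"
    obtain S T g h where qq: "q = ((S, T), (g, h))" by (metis surj_pair)
    note g = glue[OF q[unfolded qq]]
    show "((row_part (\<lambda>p. fst (snd q) p + snd (snd q) p) X Y i0, col_part (\<lambda>p. fst (snd q) p + snd (snd q) p) X Y i0),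
        (cutout (\<lambda>p. fst (snd q) p + snd (snd q) p) (row_part (\<lambda>p. fst (snd q) p + snd (snd q) p) X Y i0) (col_part (\<lambda>p. fst (snd q) p + snd (snd q) p) X Y i0),
         cutout (\<lambda>p. fst (snd q) p + snd (snd q) p) (X - row_part (\<lambda>p. fst (snd q) p + snd (snd q) p) X Y i0) (Y - col_part (\<lambda>p. fst (snd q) p + snd (snd q) p) X Y i0))) = q"
      using g by (simp add: qq)
    show "(\<lambda>p. fst (snd q) p + snd (snd q) p) \<in> {f \<in> tworeg X Y. blocks_le r X Y f}"
      using g by (simp add: qq)
  next
    fix f assume "f \<in> {f \<in> tworeg X Y. blocks_le r X Y f}"
    then have u: "f \<in> tworeg X Y" "blocks_le r X Y f" by auto
    note un = unglue[OF u refl refl]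
    show "(\<lambda>p. fst (snd ((row_part f X Y i0, col_part f X Y i0),
            cutout f (row_part f X Y i0) (col_part f X Y i0),
            cutout f (X - row_part f X Y i0) (Y - col_part f X Y i0))) p +
          snd (snd ((row_part f X Y i0, col_part f X Y i0),
            cutout f (row_part f X Y i0) (col_part f X Y i0),
            cutout f (X - row_part f X Y i0) (Y - col_part f X Y i0))) p) = f"
      using un by simp
    show "((row_part f X Y i0, col_part f X Y i0), cutout f (row_part f X Y i0) (col_part f X Y i0),
           cutout f (X - row_part f X Y i0) (Y - col_part f X Y i0)) \<in> Q"
      using un by simp
    show "row_weight v X
          (\<lambda>p. fst (snd ((row_part f X Y i0, col_part f X Y i0),
            cutout f (row_part f X Y i0) (col_part f X Y i0),
            cutout f (X - row_part f X Y i0) (Y - col_part f X Y i0))) p +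
          snd (snd ((row_part f X Y i0, col_part f X Y i0),
            cutout f (row_part f X Y i0) (col_part f X Y i0),
            cutout f (X - row_part f X Y i0) (Y - col_part f X Y i0))) p) = row_weight v X f"
      using un by simp
  qed
  also have "\<dots> = (\<Sum>q\<in>Q. case q of ((S, T), (g, h)) \<Rightarrow> row_weight v S g * row_weight v (X - S) h)"
    using glue by (intro sum.cong) (auto split: prod.splits)
  also have "\<dots> = (\<Sum>p\<in>Sigma A B. \<Sum>(g, h)\<in>K p \<times> H p. row_weight v (fst p) g * row_weight v (X - fst p) h)"
    unfolding Q_def using finA finB finK finH
    by (subst sum.Sigma) (auto intro!: sum.cong split: prod.splits)
  also have "\<dots> = (\<Sum>p\<in>Sigma A B. (\<Sum>g\<in>K p. row_weight v (fst p) g) * (\<Sum>h\<in>H p. row_weight v (X - fst p) h))"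
    by (simp add: sum_product sum.cartesian_product)
  also have "\<dots> = (\<Sum>p\<in>Sigma A B. case p of (S, T) \<Rightarrow> connected_weight v S T * total_weight v r (X - S) (Y - T))"
    by (intro sum.cong) (auto simp: K_def H_def connected_weight_def total_weight_def)
  also have "\<dots> = (\<Sum>S\<in>A. \<Sum>T\<in>B S. connected_weight v S T * total_weight v r (X - S) (Y - T))"
    using finA finB by (subst sum.Sigma) auto
  finally show ?thesis unfolding A_def B_def .
qed

lemma blocks_le_trivial:
  assumes "f \<in> tworeg X Y" "card X \<le> r" shows "blocks_le r X Y f"
  using splits_whole[OF assms(1)] assms(2) by (auto simp: blocks_le_def)

lemma tworeg_empty: "tworeg {} {} = {\<lambda>_. 0}"
  by (auto simp: tworeg_def fun_eq_iff)

lemma total_weight_empty: "total_weight v r {} {} = 1"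
proof -
  have "{f. f \<in> tworeg {} {} \<and> blocks_le r {} {} f} = {\<lambda>_. 0}"
    by (auto simp: tworeg_empty blocks_le_def)
  then show ?thesis by (simp add: total_weight_def row_weight_def)
qed

lemma sum_subsets_containing:
  fixes \<phi> :: "nat \<Rightarrow> real"
  assumes fin: "finite X" and i0: "i0 \<in> X"
  shows "(\<Sum>S | S \<subseteq> X \<and> i0 \<in> S \<and> card S \<le> r. \<phi> (card S)) =
    (\<Sum>k = 1..min r (card X). real ((card X - 1) choose (k - 1)) * \<phi> k)"
proof -
  let ?A = "{S. S \<subseteq> X \<and> i0 \<in> S \<and> card S \<le> r}"
  have finA: "finite ?A" using fin by (auto intro: finite_subset[OF _ finite_Pow_iff[THEN iffD2, of X]])
  have card_pos: "card S \<in> {1..min r (card X)}" if "S \<in> ?A" for S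
  proof -
    have "finite S" using that finite_subset[of S X] fin by auto
    then have "card S \<noteq> 0" using that by auto
    then show ?thesis using that card_mono[OF fin, of S] by auto
  qed
  have "(\<Sum>S\<in>?A. \<phi> (card S)) = (\<Sum>k = 1..min r (card X). \<Sum>S\<in>{S\<in>?A. card S = k}. \<phi> (card S))"
    using finA card_pos by (intro sum.group[symmetric]) auto
  also have "\<dots> = (\<Sum>k = 1..min r (card X). real ((card X - 1) choose (k - 1)) * \<phi> k)"
  proof (intro sum.cong refl)
    fix k assume k: "k \<in> {1..min r (card X)}"
    have "bij_betw (insert i0) {D. D \<subseteq> X - {i0} \<and> card D = k - 1} {S\<in>?A. card S = k}"
    proof (rule bij_betwI[where g = "\<lambda>S. S - {i0}"])
      show "insert i0 \<in> {D. D \<subseteq> X - {i0} \<and> card D = k - 1} \<rightarrow> {S \<in> ?A. card S = k}"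
      proof
        fix D assume D: "D \<in> {D. D \<subseteq> X - {i0} \<and> card D = k - 1}"
        then have "finite D" using finite_subset[of D X] fin by auto
        moreover have "i0 \<notin> D" using D by auto
        ultimately have "card (insert i0 D) = Suc (k - 1)" using D by simp
        then have "card (insert i0 D) = k" using k by simp
        moreover have "insert i0 D \<subseteq> X" "k \<le> r" using D i0 k by auto
        ultimately show "insert i0 D \<in> {S \<in> ?A. card S = k}" by blast
      qed
      show "(\<lambda>S. S - {i0}) \<in> {S \<in> ?A. card S = k} \<rightarrow> {D. D \<subseteq> X - {i0} \<and> card D = k - 1}"
      proof
        fix S assume "S \<in> {S \<in> ?A. card S = k}"
        then have "i0 \<in> S" "S \<subseteq> X" "card S = k" by auto
        then show "S - {i0} \<in> {D. D \<subseteq> X - {i0} \<and> card D = k - 1}"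
          by (simp add: card_Diff_singleton Diff_mono)
      qed
      show "insert i0 D - {i0} = D" if "D \<in> {D. D \<subseteq> X - {i0} \<and> card D = k - 1}" for D
        using that by blast
      show "insert i0 (S - {i0}) = S" if "S \<in> {S \<in> ?A. card S = k}" for S
        using that by blast
    qed
    then have "card {S\<in>?A. card S = k} = card {D. D \<subseteq> X - {i0} \<and> card D = k - 1}"
      by (rule bij_betw_same_card[symmetric])
    also have "\<dots> = (card X - 1) choose (k - 1)" using fin i0 by (simp add: n_subsets)
    finally show "(\<Sum>S\<in>{S\<in>?A. card S = k}. \<phi> (card S)) = real ((card X - 1) choose (k - 1)) * \<phi> k"
      by simp
  qed
  finally show ?thesis .
qed

text \<open>
  The functions \<open>c\<close> and \<open>t\<close> have to be correct only on the blocks that occur. Hence the value at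
  the full size \<open>n\<close> can be an unknown, which is how the recursion is solved for the connected
  weights.
\<close>
lemma total_weight_recursion:
  assumes fin: "finite X" "finite Y" and n: "card X = n" "card Y = n" "n > 0"
    and c: "\<And>S T. S \<subseteq> X \<Longrightarrow> T \<subseteq> Y \<Longrightarrow> S \<noteq> {} \<Longrightarrow> card T = card S \<Longrightarrow> connected_weight v S T = c (card S)"
    and t: "\<And>S T. S \<subseteq> X \<Longrightarrow> T \<subseteq> Y \<Longrightarrow> S \<noteq> {} \<Longrightarrow> card T = card S \<Longrightarrow>
      total_weight v r (X - S) (Y - T) = t (n - card S)"
  shows "total_weight v r X Y =
    (\<Sum>k = 1..min r n. real ((n - 1) choose (k - 1)) * real (n choose k) * c k * t (n - k))"
proof -
  obtain i0 where i0: "i0 \<in> X" using n by fastforce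
  have "total_weight v r X Y = (\<Sum>S | S \<subseteq> X \<and> i0 \<in> S \<and> card S \<le> r. \<Sum>T | T \<subseteq> Y \<and> card T = card S.
       c (card S) * t (n - card S))"
    unfolding total_weight_decomposition[OF fin i0]
  proof (intro sum.cong refl)
    fix S T assume "S \<in> {S. S \<subseteq> X \<and> i0 \<in> S \<and> card S \<le> r}" "T \<in> {T. T \<subseteq> Y \<and> card T = card S}"
    then have "S \<subseteq> X" "T \<subseteq> Y" "S \<noteq> {}" "card T = card S" by auto
    from c[OF this] t[OF this]
    show "connected_weight v S T * total_weight v r (X - S) (Y - T) = c (card S) * t (n - card S)" by simp
  qed
  also have "\<dots> = (\<Sum>S | S \<subseteq> X \<and> i0 \<in> S \<and> card S \<le> r. real (n choose card S) * (c (card S) * t (n - card S)))"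
    using n_subsets[OF fin(2)] n by simp
  also have "\<dots> = (\<Sum>k = 1..min r n. real ((n - 1) choose (k - 1)) * (real (n choose k) * (c k * t (n - k))))"
    using sum_subsets_containing[OF fin(1) i0, where \<phi> = "\<lambda>k. real (n choose k) * (c k * t (n - k))" and r = r] n
    by simp
  finally show ?thesis by (simp add: mult.assoc)
qed

section \<open>Counting rows with ordered units\<close>

definition double_words :: "'e set \<Rightarrow> nat set \<Rightarrow> ('e \<Rightarrow> nat) set" where
  "double_words E Y = {\<phi> \<in> E \<rightarrow>\<^sub>E Y. \<forall>y\<in>Y. card {e\<in>E. \<phi> e = y} = 2}"

lemma finite_double_words: "finite E \<Longrightarrow> finite Y \<Longrightarrow> finite (double_words E Y)"
  unfolding double_words_def by (rule finite_subset[of _ "E \<rightarrow>\<^sub>E Y"]) (auto intro: finite_PiE)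

text \<open>
  The two positions of a letter \<open>y\<close> can be chosen in \<open>card E choose 2\<close> ways, and what remains is a
  word of the same kind in the other letters.
\<close>
lemma card_double_words:
  assumes "finite Y" "finite E" "card E = 2 * card Y"
  shows "real (card (double_words E Y)) = fact (card E) / 2 ^ card Y"
  using assms
proof (induction Y arbitrary: E rule: finite_induct)
  case empty
  then show ?case by (simp add: double_words_def)
next
  case (insert y Y)
  let ?D = "{D. D \<subseteq> E \<and> card D = 2}"
  let ?f = "\<lambda>\<phi>. ({e\<in>E. \<phi> e = y}, restrict \<phi> (E - {e\<in>E. \<phi> e = y}))"
  let ?g = "\<lambda>(D, \<psi>). \<lambda>e. if e \<in> D then y else \<psi> e"
  have "bij_betw ?f (double_words E (insert y Y)) (SIGMA D:?D. double_words (E - D) Y)"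
  proof (rule bij_betwI[where g = ?g])
    show "?f \<in> double_words E (insert y Y) \<rightarrow> (SIGMA D:?D. double_words (E - D) Y)"
    proof
      fix \<phi> assume p: "\<phi> \<in> double_words E (insert y Y)"
      let ?F = "{e\<in>E. \<phi> e = y}"
      have "card ?F = 2" using p by (simp add: double_words_def)
      moreover have "restrict \<phi> (E - ?F) \<in> double_words (E - ?F) Y"
      proof -
        have "{e \<in> E - ?F. restrict \<phi> (E - ?F) e = z} = {e\<in>E. \<phi> e = z}" if "z \<in> Y" for z
          using that insert.hyps by auto
        moreover have "restrict \<phi> (E - ?F) \<in> (E - ?F) \<rightarrow>\<^sub>E Y"
          using p by (auto simp: double_words_def PiE_def)
        ultimately show ?thesis using p unfolding double_words_def by simp
      qed
      ultimately show "?f \<phi> \<in> (SIGMA D:?D. double_words (E - D) Y)" by auto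
    qed
    show "?g \<in> (SIGMA D:?D. double_words (E - D) Y) \<rightarrow> double_words E (insert y Y)"
    proof
      fix q assume q: "q \<in> (SIGMA D:?D. double_words (E - D) Y)"
      obtain D \<psi> where qq: "q = (D, \<psi>)" by force
      have D: "D \<subseteq> E" "card D = 2" and p: "\<psi> \<in> double_words (E - D) Y" using q qq by auto
      have pY: "\<psi> e \<in> Y" if "e \<in> E - D" for e using p that by (auto simp: double_words_def)
      have 1: "{e\<in>E. ?g q e = y} = D" using D pY insert.hyps by (auto simp: qq split: if_splits)
      have 2: "{e\<in>E. ?g q e = z} = {e\<in>E - D. \<psi> e = z}" if "z \<in> Y" for z
        using that insert.hyps by (auto simp: qq)
      have "?g q \<in> E \<rightarrow>\<^sub>E insert y Y"
      proof (rule PiE_I)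
        show "?g q e \<in> insert y Y" if "e \<in> E" for e using pY[of e] that by (auto simp: qq)
        show "?g q e = undefined" if "e \<notin> E" for e
          using that D(1) p by (auto simp: qq double_words_def PiE_def extensional_def)
      qed
      then show "?g q \<in> double_words E (insert y Y)"
        using 1 2 D p unfolding double_words_def by simp
    qed
    show "?g (?f \<phi>) = \<phi>" if "\<phi> \<in> double_words E (insert y Y)" for \<phi>
    proof
      fix e show "?g (?f \<phi>) e = \<phi> e"
        using that by (cases "e \<in> E") (auto simp: double_words_def PiE_def extensional_def)
    qed
    show "?f (?g q) = q" if q: "q \<in> (SIGMA D:?D. double_words (E - D) Y)" for q
    proof -
      obtain D \<psi> where qq: "q = (D, \<psi>)" by force
      have D: "D \<subseteq> E" and p: "\<psi> \<in> (E - D) \<rightarrow>\<^sub>E Y" using q qq by (auto simp: double_words_def)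
      have pY: "\<psi> e \<noteq> y" if "e \<in> E - D" for e using p that insert.hyps by auto
      have 1: "{e\<in>E. ?g q e = y} = D" using D pY by (auto simp: qq split: if_splits)
      have "restrict (?g q) (E - D) e = \<psi> e" for e
        using p by (cases "e \<in> E - D") (auto simp: qq PiE_def extensional_def)
      then show ?thesis unfolding 1 by (simp add: qq fun_eq_iff)
    qed
  qed
  then have "card (double_words E (insert y Y)) = card (SIGMA D:?D. double_words (E - D) Y)"
    by (rule bij_betw_same_card)
  also have "\<dots> = (\<Sum>D\<in>?D. card (double_words (E - D) Y))"
  proof (rule card_SigmaI)
    show "finite ?D" using insert.prems by (intro finite_subset[OF _ finite_Pow_iff[THEN iffD2, of E]]) auto
    show "\<forall>D\<in>?D. finite (double_words (E - D) Y)"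
      using insert.hyps insert.prems by (intro ballI finite_double_words) auto
  qed
  finally have "real (card (double_words E (insert y Y))) = (\<Sum>D\<in>?D. real (card (double_words (E - D) Y)))"
    by simp
  also have "\<dots> = (\<Sum>D\<in>?D. fact (card E - 2) / 2 ^ card Y)"
  proof (intro sum.cong refl)
    fix D assume D: "D \<in> ?D"
    then have "finite D" using insert.prems finite_subset by auto
    then have c: "card (E - D) = card E - 2" using D by (simp add: card_Diff_subset)
    show "real (card (double_words (E - D) Y)) = fact (card E - 2) / 2 ^ card Y"
      using insert.IH[of "E - D"] insert.prems insert.hyps c by simp
  qed
  also have "\<dots> = real (card E choose 2) * fact (card E - 2) / 2 ^ card Y"
    using n_subsets[OF insert.prems(1), of 2] by simp
  also have "\<dots> = fact (card E) / 2 ^ card (insert y Y)"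
  proof -
    have "2 \<le> card E" using insert by simp
    from binomial_fact[OF this, where 'a = real]
    show ?thesis using insert.hyps by (simp add: field_simps)
  qed
  finally show ?case .
qed

text \<open>
  The number of orderings of the two units of a row (see \<open>card_orderings\<close>).
\<close>
definition double_entry_weight :: "(nat \<Rightarrow> nat) \<Rightarrow> real" where
  "double_entry_weight a = (if \<exists>j. a j = 2 then 1 else 2)"

definition orderings :: "(nat \<Rightarrow> nat) \<Rightarrow> (nat \<times> nat) set" where
  "orderings a = {(c, d). \<forall>j. of_bool (c = j) + of_bool (d = j) = a j}"

lemma orderings_iff: "(c, d) \<in> orderings a \<longleftrightarrow> (\<forall>j. of_bool (c = j) + of_bool (d = j) = a j)"
  by (simp add: orderings_def)

lemma card_orderings:
  assumes fin: "finite Y" and s: "(\<Sum>j\<in>Y. a j) = 2" and z: "\<And>j. j \<notin> Y \<Longrightarrow> a j = 0"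
  shows "real (card (orderings a)) = double_entry_weight a" "orderings a \<subseteq> Y \<times> Y" "finite (orderings a)"
proof -
  show sub: "orderings a \<subseteq> Y \<times> Y"
  proof
    fix p assume "p \<in> orderings a"
    then obtain c d where p: "p = (c, d)" "\<And>j. of_bool (c = j) + of_bool (d = j) = a j"
      by (auto simp: orderings_def)
    have "a c \<noteq> 0" unfolding p(2)[of c, symmetric] by simp
    moreover have "a d \<noteq> 0" unfolding p(2)[of d, symmetric] by simp
    ultimately have "c \<in> Y" "d \<in> Y" using z by metis+
    then show "p \<in> Y \<times> Y" using p(1) by simp
  qed
  show "finite (orderings a)" using finite_subset[OF sub] fin by simp
  show "real (card (orderings a)) = double_entry_weight a"
  proof (cases "\<exists>j. a j = 2")
    case True
    then obtain j where j: "a j = 2" by blast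
    then have jY: "j \<in> Y" using z[of j] by (cases "j \<in> Y") auto
    have "(\<Sum>k\<in>Y - {j}. a k) = 0" using s j jY fin by (simp add: sum.remove)
    then have k0: "a k = 0" if "k \<noteq> j" for k using that z[of k] fin by (cases "k \<in> Y") auto
    have "orderings a = {(j, j)}"
    proof -
      have "c = j \<and> d = j" if "(c, d) \<in> orderings a" for c d
        using that[unfolded orderings_iff, rule_format, of j] j by (auto split: if_splits simp: of_bool_def)
      moreover have "(j, j) \<in> orderings a"
        unfolding orderings_iff using j k0 by (auto simp: of_bool_def)
      ultimately show ?thesis by fast
    qed
    then show ?thesis using True by (simp add: double_entry_weight_def)
  next
    case False
    have le: "a k \<le> 2" for k
      using member_le_sum[of k Y a] fin s z[of k] by (cases "k \<in> Y") auto
    then have le1: "a k \<le> 1" for k using False le[of k] by (metis One_nat_def le_SucE numeral_2_eq_2)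
    have one: "\<exists>j\<in>B. a j = 1" if "(\<Sum>j\<in>B. a j) \<noteq> 0" for B
    proof (rule ccontr)
      assume "\<not> (\<exists>j\<in>B. a j = 1)"
      then have "\<forall>j\<in>B. a j = 0" using le1 by (metis One_nat_def le_SucE le_zero_eq)
      then show False using that by simp
    qed
    obtain j where j: "j \<in> Y" "a j = 1" using one[of Y] s by auto
    have s1: "(\<Sum>k\<in>Y - {j}. a k) = 1" using s j fin by (simp add: sum.remove)
    then obtain l where l: "l \<in> Y" "l \<noteq> j" "a l = 1" using one[of "Y - {j}"] by auto
    have "(\<Sum>k\<in>Y - {j} - {l}. a k) = 0" using s1 l fin by (simp add: sum.remove)
    then have "\<forall>k\<in>Y - {j} - {l}. a k = 0" using fin by (metis finite_Diff sum_eq_0_iff)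
    then have k0: "a k = 0" if "k \<noteq> j" "k \<noteq> l" for k
      using that z[of k] by (metis Diff_iff singletonD)
    have "orderings a = {(j, l), (l, j)}"
    proof -
      have "(c = j \<and> d = l) \<or> (c = l \<and> d = j)" if cd: "(c, d) \<in> orderings a" for c d
      proof -
        have eq: "of_bool (c = k) + of_bool (d = k) = a k" for k
          using cd unfolding orderings_iff by blast
        have 1: "of_bool (c = j) + of_bool (d = j) = (1::nat)" using eq[of j] j(2) by metis
        have 2: "of_bool (c = l) + of_bool (d = l) = (1::nat)" using eq[of l] l(3) by metis
        have 3: "c = j \<or> d = j" using 1 by (metis add_0 of_bool_eq(1) zero_neq_one)
        have 4: "c = l \<or> d = l" using 2 by (metis add_0 of_bool_eq(1) zero_neq_one)
        show ?thesis using 3 4 l(2) by metis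
      qed
      moreover have "of_bool (j = k) + of_bool (l = k) = a k" for k
        by (cases "k = j"; cases "k = l") (use j l k0 in simp_all)
      then have "(j, l) \<in> orderings a" "(l, j) \<in> orderings a"
        unfolding orderings_iff by (simp_all add: add.commute)
      ultimately show ?thesis by fast
    qed
    then show ?thesis using False l by (simp add: double_entry_weight_def)
  qed
qed

text \<open>
  A matrix together with an ordering of the two units of every row: row \<open>i\<close> has its units in
  the columns \<open>fst (\<psi> i)\<close> and \<open>snd (\<psi> i)\<close>.
\<close>
definition double_pairings :: "nat set \<Rightarrow> nat set \<Rightarrow> (nat \<Rightarrow> nat \<times> nat) set" where
  "double_pairings X Y = {\<psi> \<in> X \<rightarrow>\<^sub>E Y \<times> Y.
     \<forall>j\<in>Y. (\<Sum>i\<in>X. of_bool (fst (\<psi> i) = j) + of_bool (snd (\<psi> i) = j)) = (2::nat)}"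

text \<open>
  Reading off the columns of the ordered units row by row gives a word of length \<open>2 * card X\<close> in
  which every column occurs exactly twice.
\<close>
lemma card_double_pairings:
  assumes fin: "finite X" "finite Y" and "card X = card Y"
  shows "real (card (double_pairings X Y)) = fact (2 * card X) / 2 ^ card X"
proof -
  let ?E = "X \<times> (UNIV :: bool set)"
  let ?f = "\<lambda>\<psi>. \<lambda>e\<in>?E. if snd e then fst (\<psi> (fst e)) else snd (\<psi> (fst e))"
  let ?g = "\<lambda>\<phi>. \<lambda>i\<in>X. (\<phi> (i, True), \<phi> (i, False))"
  have bool_sum: "(\<Sum>b\<in>UNIV. F b) = F True + F False" for F :: "bool \<Rightarrow> nat"
    by (simp add: UNIV_bool add.commute)
  have fib: "card {e\<in>?E. \<phi> e = j} = (\<Sum>i\<in>X. of_bool (\<phi> (i, True) = j) + of_bool (\<phi> (i, False) = j))"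
    for \<phi> :: "nat \<times> bool \<Rightarrow> nat" and j
  proof -
    have "card {e\<in>?E. \<phi> e = j} = (\<Sum>e\<in>?E. of_bool (\<phi> e = j))"
      using fin by (simp add: of_bool_def sum.If_cases Int_def)
    also have "\<dots> = (\<Sum>i\<in>X. \<Sum>b\<in>UNIV. of_bool (\<phi> (i, b) = j))"
      by (subst sum.cartesian_product) (simp add: case_prod_beta)
    also have "\<dots> = (\<Sum>i\<in>X. of_bool (\<phi> (i, True) = j) + of_bool (\<phi> (i, False) = j))"
      unfolding bool_sum ..
    finally show ?thesis .
  qed
  have "bij_betw ?f (double_pairings X Y) (double_words ?E Y)"
  proof (rule bij_betwI[where g = ?g])
    show "?f \<in> double_pairings X Y \<rightarrow> double_words ?E Y"
    proof
      fix \<psi> assume p: "\<psi> \<in> double_pairings X Y"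
      have "?f \<psi> \<in> ?E \<rightarrow>\<^sub>E Y" using p by (auto simp: double_pairings_def PiE_def Pi_def mem_Times_iff)
      then show "?f \<psi> \<in> double_words ?E Y"
        using p unfolding double_words_def fib by (simp add: double_pairings_def)
    qed
    show "?g \<in> double_words ?E Y \<rightarrow> double_pairings X Y"
    proof
      fix \<phi> assume p: "\<phi> \<in> double_words ?E Y"
      have "?g \<phi> \<in> X \<rightarrow>\<^sub>E Y \<times> Y" using p by (auto simp: double_words_def PiE_def Pi_def)
      then show "?g \<phi> \<in> double_pairings X Y"
        using p unfolding double_words_def fib by (simp add: double_pairings_def)
    qed
    show "?g (?f \<psi>) = \<psi>" if "\<psi> \<in> double_pairings X Y" for \<psi>
      using that by (auto simp: double_pairings_def fun_eq_iff PiE_def extensional_def)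
    show "?f (?g \<phi>) = \<phi>" if "\<phi> \<in> double_words ?E Y" for \<phi>
    proof
      fix e show "?f (?g \<phi>) e = \<phi> e"
        using that by (cases e; cases "snd e") (auto simp: double_words_def PiE_def extensional_def)
    qed
  qed
  then have "card (double_pairings X Y) = card (double_words ?E Y)" by (rule bij_betw_same_card)
  moreover have "card ?E = 2 * card X" using fin by (simp add: card_cartesian_product)
  ultimately show ?thesis using card_double_words[OF fin(2), of ?E] fin assms(3) by (simp add: mult.commute)
qed

text \<open>
  The weight of a matrix is the number of ways to order the units in its rows, so the total
  weight counts the pairings.
\<close>
lemma double_entry_total_weight:
  assumes fin: "finite X" "finite Y" and n: "card X = card Y"
  shows "(\<Sum>f\<in>tworeg X Y. row_weight double_entry_weight X f) = fact (2 * card X) / 2 ^ card X"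
proof -
  let ?F = "\<lambda>f. PiE X (\<lambda>i. orderings (\<lambda>j. f (i, j)))"
  have row: "real (card (orderings (\<lambda>j. f (i, j)))) = double_entry_weight (\<lambda>j. f (i, j))"
    "orderings (\<lambda>j. f (i, j)) \<subseteq> Y \<times> Y" "finite (orderings (\<lambda>j. f (i, j)))"
    if "f \<in> tworeg X Y" "i \<in> X" for f i
    using card_orderings[OF fin(2), of "\<lambda>j. f (i, j)"] tworegD(3)[OF that] tworeg_zero[OF that(1)] by auto
  have "double_pairings X Y = (\<Union>f\<in>tworeg X Y. ?F f)"
  proof (intro equalityI subsetI)
    fix \<psi> assume p: "\<psi> \<in> double_pairings X Y"
    define f :: "nat \<times> nat \<Rightarrow> nat" where
      "f = (\<lambda>(i, j). if i \<in> X then of_bool (fst (\<psi> i) = j) + of_bool (snd (\<psi> i) = j) else 0)"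
    have pY: "fst (\<psi> i) \<in> Y" "snd (\<psi> i) \<in> Y" if "i \<in> X" for i
      using p that by (auto simp: double_pairings_def PiE_def Pi_def mem_Times_iff)
    have "(\<Sum>j\<in>Y. f (i, j)) = 2" if "i \<in> X" for i
    proof -
      have "(\<Sum>j\<in>Y. f (i, j)) = (\<Sum>j\<in>Y. of_bool (fst (\<psi> i) = j)) + (\<Sum>j\<in>Y. of_bool (snd (\<psi> i) = j))"
        using that by (simp add: f_def sum.distrib)
      also have "\<dots> = 2" using pY[OF that] fin by (simp add: of_bool_def)
      finally show ?thesis .
    qed
    moreover have "(\<Sum>i\<in>X. f (i, j)) = 2" if "j \<in> Y" for j
      using p that by (simp add: f_def double_pairings_def)
    moreover have "i \<in> X \<and> j \<in> Y" if "f (i, j) \<noteq> 0" for i j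
      using that pY by (auto simp: f_def split: if_splits)
    ultimately have "f \<in> tworeg X Y" by (auto simp: tworeg_def)
    moreover have "\<psi> \<in> ?F f"
      using p by (auto simp: double_pairings_def f_def orderings_def PiE_def Pi_def split: prod.splits)
    ultimately show "\<psi> \<in> (\<Union>f\<in>tworeg X Y. ?F f)" by blast
  next
    fix \<psi> assume "\<psi> \<in> (\<Union>f\<in>tworeg X Y. ?F f)"
    then obtain f where f: "f \<in> tworeg X Y" and p: "\<psi> \<in> ?F f" by blast
    have "\<psi> \<in> X \<rightarrow>\<^sub>E Y \<times> Y" using p row(2)[OF f] unfolding PiE_def Pi_def by blast
    moreover have "of_bool (fst (\<psi> i) = j) + of_bool (snd (\<psi> i) = j) = f (i, j)" if "i \<in> X" for i j
      using PiE_mem[OF p that] orderings_iff[of "fst (\<psi> i)" "snd (\<psi> i)"] by simp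
    ultimately show "\<psi> \<in> double_pairings X Y"
      using tworegD(4)[OF f] by (simp add: double_pairings_def)
  qed
  also have "card \<dots> = (\<Sum>f\<in>tworeg X Y. card (?F f))"
  proof (rule card_UN_disjoint)
    show "\<forall>f\<in>tworeg X Y. finite (?F f)" using row(3) fin by (auto intro: finite_PiE)
    show "\<forall>f\<in>tworeg X Y. \<forall>f'\<in>tworeg X Y. f \<noteq> f' \<longrightarrow> ?F f \<inter> ?F f' = {}"
    proof (intro ballI impI)
      fix f f' assume f: "f \<in> tworeg X Y" "f' \<in> tworeg X Y" "f \<noteq> f'"
      have "f = f'" if "\<psi> \<in> ?F f" "\<psi> \<in> ?F f'" for \<psi>
      proof
        fix p :: "nat \<times> nat" obtain i j where p: "p = (i, j)" by force
        show "f p = f' p"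
        proof (cases "i \<in> X")
          case True
          from PiE_mem[OF that(1) True] PiE_mem[OF that(2) True] show ?thesis
            unfolding p using orderings_iff[of "fst (\<psi> i)" "snd (\<psi> i)"] by (metis prod.collapse)
        qed (simp add: p tworeg_zero[OF f(1)] tworeg_zero[OF f(2)])
      qed
      then show "?F f \<inter> ?F f' = {}" using f(3) by blast
    qed
  qed (rule finite_tworeg[OF fin])
  finally have "real (card (double_pairings X Y)) = (\<Sum>f\<in>tworeg X Y. real (card (?F f)))" by simp
  also have "\<dots> = (\<Sum>f\<in>tworeg X Y. row_weight double_entry_weight X f)"
    using fin row(1) by (intro sum.cong refl) (simp add: card_PiE row_weight_def)
  finally show ?thesis using card_double_pairings[OF fin n] by simp
qed

section \<open>The number of connected matrices\<close>

text \<open>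
  The coefficients of \<open>(1 - z) powr (- 1/2)\<close>, that is \<open>(2 * n choose n) / 4 ^ n\<close>.
\<close>
definition central_ratio :: "nat \<Rightarrow> real" where
  "central_ratio n = fact (2 * n) / (4 ^ n * (fact n)\<^sup>2)"

lemma central_ratio_sum: "2 * real n * central_ratio n = (\<Sum>j<n. central_ratio j)"
proof (induction n)
  case 0 then show ?case by simp
next
  case (Suc n)
  define x A :: real where "x = real n + 1" and "A = 4 ^ n * (fact n)\<^sup>2"
  have pos: "x > 0" "A > 0" by (auto simp: x_def A_def)
  have num: "fact (2 * Suc n) = 2 * x * (2 * real n + 1) * (fact (2 * n) :: real)"
    by (simp add: x_def algebra_simps)
  have den: "4 ^ Suc n * (fact (Suc n))\<^sup>2 = 4 * x\<^sup>2 * A"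
    by (simp add: x_def A_def power_mult_distrib algebra_simps power2_eq_square)
  have "2 * x * central_ratio (Suc n) = 2 * x * (2 * x * (2 * real n + 1) * fact (2 * n)) / (4 * x\<^sup>2 * A)"
    unfolding central_ratio_def num den by (simp add: mult_ac)
  also have "\<dots> = (2 * real n + 1) * (fact (2 * n) / A)"
    using pos by (simp add: field_simps power2_eq_square)
  finally have "2 * real (Suc n) * central_ratio (Suc n) = (2 * real n + 1) * central_ratio n"
    by (simp add: central_ratio_def A_def x_def add.commute)
  then show ?case using Suc by (simp add: algebra_simps)
qed

lemma binomial_fact_pair:
  assumes "1 \<le> k" "k \<le> n"
  shows "real ((n - 1) choose (k - 1)) * real (n choose k) * (fact k * fact (k - 1)) * (fact (n - k))\<^sup>2 =
    fact n * fact (n - 1)"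
proof -
  have "k - 1 \<le> n - 1" "n - 1 - (k - 1) = n - k" using assms by auto
  then show ?thesis
    using binomial_fact[OF assms(2), where 'a = real] binomial_fact[of "k - 1" "n - 1", where 'a = real]
    by (simp add: power2_eq_square field_simps)
qed

lemma card_subsets_full:
  assumes "finite X" "S \<subseteq> X" "card S = card X" shows "S = X"
  using assms card_subset_eq by blast

text \<open>
  For this weight all totals are known, so the recursion determines the connected weights one
  after the other; the claimed values satisfy it because of \<open>central_ratio_sum\<close>.
\<close>
lemma double_entry_connected_weight:
  assumes "finite X" "finite Y" "card X = n" "card Y = n" "n > 0"
  shows "connected_weight double_entry_weight X Y = 2 ^ n * (fact n * fact (n - 1) / 2)"
  using assms
proof (induction n arbitrary: X Y rule: less_induct)
  case (less n)
  note fin = less.prems(1,2) and n = less.prems(3-5)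
  let ?J = "\<lambda>k. 2 ^ k * (fact k * fact (k - 1) / 2) :: real"
  \<comment> \<open>the full size carries the unknown, all smaller sizes the values from the induction hypothesis\<close>
  define c where "c = (\<lambda>k. if k = n then connected_weight double_entry_weight X Y else ?J k)"
  define t :: "nat \<Rightarrow> real" where "t m = fact (2 * m) / 2 ^ m" for m
  have tot: "total_weight double_entry_weight n S T = t (card S)"
    if "finite S" "finite T" "card S = card T" "card S \<le> n" for S T
    unfolding total_weight_def t_def double_entry_total_weight[OF that(1-3), symmetric]
    by (intro sum.cong) (use blocks_le_trivial[of _ S T n] that in auto)
  have t_central_ratio: "t m = (fact m)\<^sup>2 * 2 ^ m * central_ratio m" for m
  proof -
    have "(4::real) ^ m = 2 ^ m * 2 ^ m" by (simp flip: power_mult_distrib)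
    then show ?thesis by (simp add: t_def central_ratio_def)
  qed
  have "t n = total_weight double_entry_weight n X Y"
    using tot[OF fin] n by simp
  also have "\<dots> = (\<Sum>k = 1..min n n. real ((n - 1) choose (k - 1)) * real (n choose k) * c k * t (n - k))"
  proof (rule total_weight_recursion[OF fin n])
    fix S T assume st: "S \<subseteq> X" "T \<subseteq> Y" "S \<noteq> {}" "card T = card S"
    have finst: "finite S" "finite T" using st fin finite_subset by auto
    have le: "card S \<le> n" using st fin n card_mono by metis
    show "connected_weight double_entry_weight S T = c (card S)"
    proof (cases "card S = n")
      case True
      then have "S = X" "T = Y" using card_subsets_full fin st n by metis+
      then show ?thesis using True by (simp add: c_def)
    next
      case False
      then have "card S < n" using le by simp
      moreover have "card S > 0" using st finst by (simp add: card_gt_0_iff)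
      ultimately show ?thesis using less.IH[of "card S" S T] finst st False by (simp add: c_def)
    qed
    have "card (X - S) = n - card S" "card (Y - T) = n - card S"
      using st finst n by (simp_all add: card_Diff_subset)
    then show "total_weight double_entry_weight n (X - S) (Y - T) = t (n - card S)"
      using tot[of "X - S" "Y - T"] fin by simp
  qed
  also have "\<dots> = (\<Sum>k\<in>{1..n} - {n}. real ((n - 1) choose (k - 1)) * real (n choose k) * c k * t (n - k)) + c n"
    using n by (subst sum.remove[of _ n]) (auto simp: t_def)
  finally have 1: "t n = (\<Sum>k\<in>{1..n} - {n}. real ((n - 1) choose (k - 1)) * real (n choose k) * c k * t (n - k)) + c n" .
  have summand: "real ((n - 1) choose (k - 1)) * real (n choose k) * ?J k * t (n - k) =
      2 ^ n * fact n * fact (n - 1) / 2 * central_ratio (n - k)" if "k \<in> {1..n}" for k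
  proof -
    have "(2::real) ^ n = 2 ^ k * 2 ^ (n - k)" using that by (simp flip: power_add)
    then show ?thesis
      using binomial_fact_pair[of k n] that unfolding t_central_ratio by (simp add: algebra_simps)
  qed
  have "(\<Sum>k\<in>{1..n} - {n}. real ((n - 1) choose (k - 1)) * real (n choose k) * c k * t (n - k)) + ?J n
      = (\<Sum>k\<in>{1..n} - {n}. real ((n - 1) choose (k - 1)) * real (n choose k) * ?J k * t (n - k)) + ?J n"
    by (intro arg_cong2[where f = "(+)"] sum.cong refl) (auto simp: c_def)
  also have "\<dots> = (\<Sum>k\<in>{1..n}. real ((n - 1) choose (k - 1)) * real (n choose k) * ?J k * t (n - k))"
    using n by (subst sum.remove[of "{1..n}" n]) (auto simp: t_def)
  also have "\<dots> = (\<Sum>k\<in>{1..n}. 2 ^ n * fact n * fact (n - 1) / 2 * central_ratio (n - k))"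
    using summand by (intro sum.cong) auto
  also have "\<dots> = 2 ^ n * fact n * fact (n - 1) / 2 * (\<Sum>k\<in>{1..n}. central_ratio (n - k))"
    by (rule sum_distrib_left[symmetric])
  also have "(\<Sum>k\<in>{1..n}. central_ratio (n - k)) = (\<Sum>j<n. central_ratio j)"
    by (rule sum.reindex_bij_witness[where i = "\<lambda>j. n - j" and j = "\<lambda>k. n - k"]) auto
  also have "\<dots> = 2 * real n * central_ratio n" by (rule central_ratio_sum[symmetric])
  also have "2 ^ n * fact n * fact (n - 1) / 2 * (2 * real n * central_ratio n) = t n"
    using n fact_reduce[of n, where 'a = real] by (simp add: t_central_ratio power2_eq_square)
  finally have "c n = ?J n" using 1 by linarith
  then show ?case by (simp add: c_def)
qed

text \<open>
  The number of connected matrices of size \<open>k\<close> divided by \<open>k! (k - 1)!\<close>. A connected matrix of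
  size \<open>k \<ge> 2\<close> is a cycle, which has two orientations, whereas the double edge has none to
  choose; hence the exceptional value at 1.
\<close>
definition cycle_weight :: "nat \<Rightarrow> real" where
  "cycle_weight k = (if k = 1 then 1 else 1 / 2)"

text \<open>
  A double entry is a block of size 1, so a connected matrix of larger size has none.
\<close>
lemma connected_row_weight:
  assumes g: "g \<in> connected_tworeg X Y" and fin: "finite X" "finite Y"
  shows "row_weight double_entry_weight X g = (if card X = 1 then 1 else 2 ^ card X)"
proof (cases "card X = 1")
  case True
  then obtain i where X: "X = {i}" by (meson card_1_singletonE)
  have gt: "g \<in> tworeg X Y" using g by (simp add: connected_tworeg_def)
  have "card Y = 1" using tworeg_card_eq[OF gt fin] True by simp
  then obtain j where Y: "Y = {j}" by (meson card_1_singletonE)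
  have "g (i, j) = 2" using tworegD(3)[OF gt, of i] X Y by simp
  then show ?thesis using True by (auto simp: row_weight_def X double_entry_weight_def)
next
  case False
  have gt: "g \<in> tworeg X Y" using g by (simp add: connected_tworeg_def)
  have "g (i, j) \<noteq> 2" if i: "i \<in> X" for i j
  proof
    assume 2: "g (i, j) = 2"
    then have j: "j \<in> Y" using tworegD(2)[OF gt, of i j] by simp
    have "splits g {i} {j}"
    proof (rule splits_if_line_sums[OF gt fin])
    qed (use i j 2 in auto)
    then have "{i} = X" using connected_tworegD[OF g, of "{i}" "{j}"] i j by simp
    then show False using False by auto
  qed
  then have "row_weight double_entry_weight X g = (\<Prod>i\<in>X. 2)"
    unfolding row_weight_def double_entry_weight_def by (intro prod.cong) auto
  then show ?thesis using False by simp
qed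

lemma connected_count:
  assumes "finite X" "finite Y" "card X = n" "card Y = n" "n > 0"
  shows "connected_weight (\<lambda>_. 1) X Y = cycle_weight n * (fact n * fact (n - 1))"
proof -
  have "connected_weight double_entry_weight X Y =
      (\<Sum>g\<in>connected_tworeg X Y. (if n = 1 then 1 else 2 ^ n) * row_weight (\<lambda>_. 1) X g)"
    unfolding connected_weight_def using connected_row_weight assms
    by (intro sum.cong) (auto simp: row_weight_def)
  also have "\<dots> = (if n = 1 then 1 else 2 ^ n) * connected_weight (\<lambda>_. 1) X Y"
    unfolding connected_weight_def by (rule sum_distrib_left[symmetric])
  finally show ?thesis
    using double_entry_connected_weight[OF assms] by (auto simp: cycle_weight_def)
qed

text \<open>
  The number of matrices of size \<open>n\<close> with all components of size at most \<open>r\<close>, divided by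
  \<open>(n!)\<^sup>2\<close> (see \<open>total_weight_small_density\<close>). This normalisation turns the two binomial
  coefficients of the recursion into the single factor \<open>n\<close>.
\<close>
fun small_density :: "nat \<Rightarrow> nat \<Rightarrow> real" where
  "small_density r n = (if n = 0 then 1 else
     (\<Sum>k = 1..min r n. cycle_weight k * small_density r (n - k)) / real n)"

declare small_density.simps [simp del]

lemma small_density_0: "small_density r 0 = 1"
  by (simp add: small_density.simps)

lemma small_density_rec:
  "n > 0 \<Longrightarrow> real n * small_density r n = (\<Sum>k = 1..min r n. cycle_weight k * small_density r (n - k))"
  by (subst small_density.simps) simp

lemma total_weight_small_density:
  assumes "finite X" "finite Y" "card X = n" "card Y = n"
  shows "total_weight (\<lambda>_. 1) r X Y = (fact n)\<^sup>2 * small_density r n"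
  using assms
proof (induction n arbitrary: X Y rule: less_induct)
  case (less n)
  note fin = less.prems(1,2) and n = less.prems(3,4)
  show ?case
  proof (cases "n = 0")
    case True
    then show ?thesis using fin n by (simp add: total_weight_empty small_density.simps[of r 0])
  next
    case False
    have "total_weight (\<lambda>_. 1) r X Y =
      (\<Sum>k = 1..min r n. real ((n - 1) choose (k - 1)) * real (n choose k) *
         (cycle_weight k * (fact k * fact (k - 1))) * ((fact (n - k))\<^sup>2 * small_density r (n - k)))"
    proof (rule total_weight_recursion[OF fin n])
      fix S T assume st: "S \<subseteq> X" "T \<subseteq> Y" "S \<noteq> {}" "card T = card S"
      have finst: "finite S" "finite T" using st fin finite_subset by auto
      have pos: "card S > 0" using st finst by (simp add: card_gt_0_iff)
      show "connected_weight (\<lambda>_. 1) S T = cycle_weight (card S) * (fact (card S) * fact (card S - 1))"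
        using connected_count[OF finst refl st(4) pos] .
      have "card (X - S) = n - card S" "card (Y - T) = n - card S"
        using st finst n by (simp_all add: card_Diff_subset)
      then show "total_weight (\<lambda>_. 1) r (X - S) (Y - T) =
          (fact (n - card S))\<^sup>2 * small_density r (n - card S)"
        using less.IH[of "n - card S" "X - S" "Y - T"] fin pos False by simp
    qed (use False in simp)
    also have "\<dots> = (\<Sum>k = 1..min r n. fact n * fact (n - 1) * (cycle_weight k * small_density r (n - k)))"
    proof (intro sum.cong refl)
      fix k assume k: "k \<in> {1..min r n}"
      then show "real ((n - 1) choose (k - 1)) * real (n choose k) * (cycle_weight k * (fact k * fact (k - 1))) *
          ((fact (n - k))\<^sup>2 * small_density r (n - k)) =
          fact n * fact (n - 1) * (cycle_weight k * small_density r (n - k))"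
        using binomial_fact_pair[of k n, symmetric] by simp
    qed
    also have "\<dots> = fact n * fact (n - 1) * (real n * small_density r n)"
      using False small_density_rec[of n r] by (simp add: sum_distrib_left)
    also have "\<dots> = (fact n)\<^sup>2 * small_density r n"
      using False fact_reduce[of n, where 'a = real] by (simp add: power2_eq_square)
    finally show ?thesis .
  qed
qed

section \<open>From matrices to functions\<close>

definition entry_fun :: "nat \<Rightarrow> nat mat \<Rightarrow> nat \<times> nat \<Rightarrow> nat" where
  "entry_fun n A = (\<lambda>(i, j). if i < n \<and> j < n then A $$ (i, j) else 0)"

lemma entry_fun_bij:
  "bij_betw (entry_fun n) (two_regular_mats n) (tworeg {..<n} {..<n})"
proof (rule bij_betwI[where g = "\<lambda>f. mat n n f"])
  show "entry_fun n \<in> two_regular_mats n \<rightarrow> tworeg {..<n} {..<n}"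
    by (auto simp: two_regular_mats_def tworeg_def entry_fun_def split: if_splits)
  show "(\<lambda>f. mat n n f) \<in> tworeg {..<n} {..<n} \<rightarrow> two_regular_mats n"
    by (auto simp: two_regular_mats_def tworeg_def)
  show "mat n n (entry_fun n A) = A" if "A \<in> two_regular_mats n" for A
    using that by (auto simp: two_regular_mats_def entry_fun_def)
  show "entry_fun n (mat n n f) = f" if f: "f \<in> tworeg {..<n} {..<n}" for f
  proof
    fix p :: "nat \<times> nat" obtain i j where p: "p = (i, j)" by force
    show "entry_fun n (mat n n f) p = f p"
      unfolding p entry_fun_def using tworeg_zero[OF f, where i = i and j = j] by (cases "i < n \<and> j < n") auto
  qed
qed

context
  fixes n :: nat and A :: "nat mat" and f :: "nat \<times> nat \<Rightarrow> nat"
  assumes A: "A \<in> two_regular_mats n" and f_def: "f = entry_fun n A"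
begin

lemma entry_fun_tworeg: "f \<in> tworeg {..<n} {..<n}"
  using entry_fun_bij A unfolding f_def bij_betw_def by blast

lemma is_component_iff_splits:
  "is_component A S T \<longleftrightarrow> S \<noteq> {} \<and> S \<subseteq> {..<n} \<and> T \<subseteq> {..<n} \<and> splits f S T"
proof -
  note f = entry_fun_tworeg
  have dims: "dim_row A = n" "dim_col A = n" using A by (auto simp: two_regular_mats_def)
  have rs: "(\<Sum>j\<in>T. f (i, j)) = (\<Sum>j\<in>T. A $$ (i, j))" if "i < n" "T \<subseteq> {..<n}" for i T
    using that by (intro sum.cong) (auto simp: f_def entry_fun_def)
  have cs: "(\<Sum>i\<in>S. f (i, j)) = (\<Sum>i\<in>S. A $$ (i, j))" if "j < n" "S \<subseteq> {..<n}" for j S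
    using that by (intro sum.cong) (auto simp: f_def entry_fun_def)
  show ?thesis
  proof
    assume c: "is_component A S T"
    then have ST: "S \<noteq> {}" "S \<subseteq> {..<n}" "T \<subseteq> {..<n}"
      and r: "\<And>i. i \<in> S \<Longrightarrow> (\<Sum>j\<in>T. A $$ (i, j)) = 2" and cc: "\<And>j. j \<in> T \<Longrightarrow> (\<Sum>i\<in>S. A $$ (i, j)) = 2"
      by (auto simp: is_component_def dims)
    have "splits f S T"
    proof (rule splits_if_line_sums[OF f _ _ ST(2,3)])
      show "(\<Sum>j\<in>T. f (i, j)) = 2" if "i \<in> S" for i
        using rs[of i T] r[OF that] that ST by auto
      show "(\<Sum>i\<in>S. f (i, j)) = 2" if "j \<in> T" for j
        using cs[of j S] cc[OF that] that ST by auto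
    qed auto
    then show "S \<noteq> {} \<and> S \<subseteq> {..<n} \<and> T \<subseteq> {..<n} \<and> splits f S T" using ST by blast
  next
    assume "S \<noteq> {} \<and> S \<subseteq> {..<n} \<and> T \<subseteq> {..<n} \<and> splits f S T"
    then have ST: "S \<noteq> {}" "S \<subseteq> {..<n}" "T \<subseteq> {..<n}" "splits f S T" by auto
    have ct: "cutout f S T \<in> tworeg S T"
      using cutout_tworeg[OF f _ _ ST(2-4)] by simp
    have "card S = card T"
      using tworeg_card_eq[OF ct] ST finite_subset[of _ "{..<n}"] by simp
    moreover from this have "T \<noteq> {}" using ST finite_subset[OF ST(2)] by auto
    moreover have "(\<Sum>j\<in>T. A $$ (i, j)) = 2" if "i \<in> S" for i
      using splits_row_sum[OF f _ ST(3,4) that ST(2)] rs[of i T] that ST by auto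
    moreover have "(\<Sum>i\<in>S. A $$ (i, j)) = 2" if "j \<in> T" for j
      using splits_col_sum[OF f _ ST(2,4) that ST(3)] cs[of j S] that ST by auto
    ultimately show "is_component A S T" using ST by (simp add: is_component_def dims)
  qed
qed

abbreviation (input) "rp \<equiv> row_part f {..<n} {..<n}"
abbreviation (input) "cp \<equiv> col_part f {..<n} {..<n}"

lemma part_is_component: "i < n \<Longrightarrow> is_component A (rp i) (cp i)"
  unfolding is_component_iff_splits
  using part_props[OF entry_fun_tworeg, of i] splits_part[of f "{..<n}" "{..<n}" i] by auto

text \<open>
  Together with the next lemma, this identifies the irreducible components of a matrix with the
  components of its rows.
\<close>
lemma irreducible_component_part:
  assumes i: "i < n" shows "irreducible_component A (rp i) (cp i)"
  unfolding irreducible_component_def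
proof (intro conjI allI impI)
  show "is_component A (rp i) (cp i)" using part_is_component[OF i] .
next
  fix S' T' assume a: "is_component A S' T' \<and> S' \<subseteq> rp i \<and> T' \<subseteq> cp i"
  then have c: "S' \<noteq> {}" "splits f S' T'" using is_component_iff_splits by auto
  have "splits (cutout f (rp i) (cp i)) S' T'"
    using splits_cutout[OF splits_part] a c by blast
  then show S: "S' = rp i"
    using connected_tworegD[OF part_connected[OF entry_fun_tworeg, of i], of S' T'] i a c by simp
  have "card T' = card (cp i)"
    using a part_is_component[OF i] S by (simp add: is_component_def)
  moreover have "finite (cp i)"
    using part_props(2)[OF entry_fun_tworeg, of i] i finite_subset[of "cp i" "{..<n}"] by auto
  ultimately show "T' = cp i" using a card_subset_eq by blast
qed

lemma irreducible_component_imp_part: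
  assumes irr: "irreducible_component A S T"
  shows "\<exists>i<n. S = rp i"
proof -
  have c: "S \<noteq> {}" "S \<subseteq> {..<n}" "T \<subseteq> {..<n}" "splits f S T"
    using irr unfolding irreducible_component_def is_component_iff_splits by auto
  then obtain i where i: "i \<in> S" "i < n" by auto
  have "rp i \<subseteq> S" "cp i \<subseteq> T" using part_subset[OF c(4,2,3) i(1)] by auto
  then have "rp i = S"
    using irr part_is_component[OF i(2)] unfolding irreducible_component_def by blast
  then show ?thesis using i by auto
qed

lemma largest_component_eq:
  "largest_component A = Max ((\<lambda>i. card (rp i)) ` {..<n})"
proof -
  have "num_irreducible j A > 0 \<longleftrightarrow> (\<exists>i<n. j = card (rp i))" for j
  proof -
    let ?I = "{(S, T). irreducible_component A S T \<and> card S = j}"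
    have "?I \<subseteq> Pow {..<n} \<times> Pow {..<n}"
      unfolding irreducible_component_def is_component_iff_splits by auto
    then have "finite ?I" by (rule finite_subset) auto
    then have "num_irreducible j A > 0 \<longleftrightarrow> ?I \<noteq> {}" by (simp add: num_irreducible_def card_gt_0_iff)
    also have "\<dots> \<longleftrightarrow> (\<exists>i<n. j = card (rp i))"
    proof
      assume "?I \<noteq> {}"
      then obtain S T where "irreducible_component A S T" "card S = j" by auto
      then show "\<exists>i<n. j = card (rp i)" using irreducible_component_imp_part by metis
    next
      assume "\<exists>i<n. j = card (rp i)"
      then obtain i where "i < n" "j = card (rp i)" by auto
      then have "(rp i, cp i) \<in> ?I" using irreducible_component_part by simp
      then show "?I \<noteq> {}" by blast
    qed
    finally show ?thesis .
  qed
  moreover have "1 \<le> card (rp i)" if "i < n" for i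
  proof -
    have "rp i \<noteq> {}" "rp i \<subseteq> {..<n}" using part_props[OF entry_fun_tworeg, of i] that by auto
    then show ?thesis using finite_subset[of "rp i" "{..<n}"] by (simp add: Suc_le_eq card_gt_0_iff)
  qed
  ultimately have "{j. 1 \<le> j \<and> num_irreducible j A > 0} = (\<lambda>i. card (rp i)) ` {..<n}" by auto
  then show ?thesis unfolding largest_component_def by simp
qed

lemma largest_component_le_iff:
  assumes "n > 0" shows "largest_component A \<le> r \<longleftrightarrow> blocks_le r {..<n} {..<n} f"
proof -
  have "largest_component A \<le> r \<longleftrightarrow> (\<forall>i<n. card (rp i) \<le> r)"
    unfolding largest_component_eq using assms by (subst Max_le_iff) auto
  also have "\<dots> \<longleftrightarrow> blocks_le r {..<n} {..<n} f"
  proof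
    assume le: "\<forall>i<n. card (rp i) \<le> r"
    show "blocks_le r {..<n} {..<n} f"
      unfolding blocks_le_def
    proof
      fix i assume i: "i \<in> {..<n}"
      show "\<exists>S T. S \<subseteq> {..<n} \<and> T \<subseteq> {..<n} \<and> splits f S T \<and> i \<in> S \<and> card S \<le> r"
        using part_props[OF entry_fun_tworeg i] splits_part[of f "{..<n}" "{..<n}" i] le i
        by (intro exI[of _ "rp i"] exI[of _ "cp i"]) simp
    qed
  next
    assume "blocks_le r {..<n} {..<n} f"
    then show "\<forall>i<n. card (rp i) \<le> r" using card_row_part_le[OF entry_fun_tworeg] by auto
  qed
  finally show ?thesis .
qed

end

lemma card_small_mats:
  assumes "n > 0"
  shows "real (card {A \<in> two_regular_mats n. largest_component A \<le> r}) = (fact n)\<^sup>2 * small_density r n"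
proof -
  have "bij_betw (entry_fun n) {A \<in> two_regular_mats n. largest_component A \<le> r}
      {f. f \<in> tworeg {..<n} {..<n} \<and> blocks_le r {..<n} {..<n} f}"
    using entry_fun_bij[of n]
  proof (rule bij_betw_subset)
    show "entry_fun n ` {A \<in> two_regular_mats n. largest_component A \<le> r} =
        {f. f \<in> tworeg {..<n} {..<n} \<and> blocks_le r {..<n} {..<n} f}"
    proof (intro equalityI subsetI)
      fix f assume "f \<in> entry_fun n ` {A \<in> two_regular_mats n. largest_component A \<le> r}"
      then obtain A where A: "A \<in> two_regular_mats n" "largest_component A \<le> r" "f = entry_fun n A" by auto
      then show "f \<in> {f. f \<in> tworeg {..<n} {..<n} \<and> blocks_le r {..<n} {..<n} f}"
        using largest_component_le_iff[OF A(1,3) assms, of r] entry_fun_tworeg[OF A(1,3)] by simp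
    next
      fix f assume f: "f \<in> {f. f \<in> tworeg {..<n} {..<n} \<and> blocks_le r {..<n} {..<n} f}"
      then have "f \<in> entry_fun n ` two_regular_mats n"
        using entry_fun_bij[of n] by (simp add: bij_betw_def)
      then obtain A where A: "A \<in> two_regular_mats n" "f = entry_fun n A" by auto
      then have "A \<in> {A \<in> two_regular_mats n. largest_component A \<le> r}"
        using f largest_component_le_iff[OF A assms, of r] by simp
      then show "f \<in> entry_fun n ` {A \<in> two_regular_mats n. largest_component A \<le> r}"
        unfolding A(2) by (rule imageI)
    qed
  qed auto
  then have "card {A \<in> two_regular_mats n. largest_component A \<le> r} =
      card {f. f \<in> tworeg {..<n} {..<n} \<and> blocks_le r {..<n} {..<n} f}"
    by (rule bij_betw_same_card)
  then have "real (card {A \<in> two_regular_mats n. largest_component A \<le> r}) =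
      total_weight (\<lambda>_. 1) r {..<n} {..<n}"
    by (simp add: total_weight_def row_weight_def)
  then show ?thesis using total_weight_small_density[of "{..<n}" "{..<n}" n r] by simp
qed

lemma largest_component_bounds:
  assumes "A \<in> two_regular_mats n" "n > 0"
  shows "1 \<le> largest_component A" "largest_component A \<le> n"
proof -
  show "largest_component A \<le> n"
    unfolding largest_component_le_iff[OF assms(1) refl assms(2)]
    by (rule blocks_le_trivial[OF entry_fun_tworeg[OF assms(1) refl]]) simp
  have "\<not> blocks_le 0 {..<n} {..<n} (entry_fun n A)"
  proof
    assume "blocks_le 0 {..<n} {..<n} (entry_fun n A)"
    then obtain S where "S \<subseteq> {..<n}" "0 \<in> S" "card S = 0"
      using assms(2) unfolding blocks_le_def by (metis le_zero_eq lessThan_iff)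
    then show False using finite_subset[of S "{..<n}"] by auto
  qed
  then have "\<not> largest_component A \<le> 0"
    using largest_component_le_iff[OF assms(1) refl assms(2), of 0] by blast
  then show "1 \<le> largest_component A" by simp
qed

lemma prob_largest_component_le:
  assumes "n > 0"
  shows "measure_pmf.prob (pmf_of_set (two_regular_mats n)) {A. largest_component A \<le> r} =
    small_density r n / small_density n n"
proof -
  let ?M = "two_regular_mats n"
  have all: "{A \<in> ?M. largest_component A \<le> n} = ?M"
    using largest_component_bounds(2) assms by auto
  have "measure_pmf.prob (pmf_of_set ?M) {A. largest_component A \<le> r} =
      real (card {A \<in> ?M. largest_component A \<le> r}) / real (card {A \<in> ?M. largest_component A \<le> n})"
    using finite_two_regular_mats[of n] two_regular_mats_nonempty[of n]
    by (subst measure_pmf_of_set) (simp_all add: all Int_def)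
  then show ?thesis unfolding card_small_mats[OF assms] by simp
qed

section \<open>Monotonicity of the densities\<close>

lemma small_density_nonneg: "small_density r n \<ge> 0"
proof (induction n rule: less_induct)
  case (less n)
  show ?case
  proof (cases "n = 0")
    case False
    have "(\<Sum>k = 1..min r n. cycle_weight k * small_density r (n - k)) \<ge> 0"
      using less False by (intro sum_nonneg mult_nonneg_nonneg) (auto simp: cycle_weight_def)
    then show ?thesis using small_density_rec[of n r] False by (metis not_gr_zero of_nat_0_less_iff zero_le_mult_iff not_less)
  qed (simp add: small_density_0)
qed

lemma small_density_mono_bound: "small_density r n \<le> small_density (r + d) n"
proof (induction n rule: less_induct)
  case (less n)
  show ?case
  proof (cases "n = 0")
    case False
    have "(\<Sum>k = 1..min r n. cycle_weight k * small_density r (n - k)) \<le>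
        (\<Sum>k = 1..min r n. cycle_weight k * small_density (r + d) (n - k))"
      using less False by (intro sum_mono mult_left_mono) (auto simp: cycle_weight_def)
    also have "\<dots> \<le> (\<Sum>k = 1..min (r + d) n. cycle_weight k * small_density (r + d) (n - k))"
      by (intro sum_mono2 mult_nonneg_nonneg small_density_nonneg) (auto simp: cycle_weight_def)
    finally have "real n * small_density r n \<le> real n * small_density (r + d) n"
      using small_density_rec False by simp
    then show ?thesis using False by simp
  qed (simp add: small_density_0)
qed

lemma small_density_stable: "n \<le> r \<Longrightarrow> n \<le> r' \<Longrightarrow> small_density r n = small_density r' n"
proof (induction n rule: less_induct)
  case (less n)
  show ?case
  proof (cases "n = 0")
    case False
    have "(\<Sum>k = 1..min r n. cycle_weight k * small_density r (n - k)) =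
        (\<Sum>k = 1..min r' n. cycle_weight k * small_density r' (n - k))"
      using less by (intro sum.cong) (auto intro!: less.IH)
    then have "real n * small_density r n = real n * small_density r' n"
      using small_density_rec False by simp
    then show ?thesis using False by simp
  qed (simp add: small_density_0)
qed

definition mat_density :: "nat \<Rightarrow> real" where
  "mat_density n = small_density n n"

lemma small_density_eq_mat: "n \<le> r \<Longrightarrow> small_density r n = mat_density n"
  unfolding mat_density_def by (rule small_density_stable) auto

lemma small_density_le_mat: "small_density r n \<le> mat_density n"
  using small_density_mono_bound[of r n n] small_density_eq_mat[of n "r + n"] by simp

lemma small_density_sum:
  fixes r n defines "S \<equiv> \<lambda>m. \<Sum>j<m. small_density r j"
  assumes "r > 0"
  shows "real (Suc n) * small_density r (Suc n) =
    small_density r n / 2 + (S (Suc n) - S (Suc n - r)) / 2"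
proof -
  let ?b = "small_density r"
  have "real (Suc n) * ?b (Suc n) = (\<Sum>k = 1..min r (Suc n). cycle_weight k * ?b (Suc n - k))"
    by (rule small_density_rec) simp
  also have "\<dots> = (\<Sum>k = 1..min r (Suc n). ?b (Suc n - k) / 2 + (if k = 1 then ?b n / 2 else 0))"
    by (intro sum.cong) (auto simp: cycle_weight_def)
  also have "\<dots> = (\<Sum>k = 1..min r (Suc n). ?b (Suc n - k)) / 2 + ?b n / 2"
    using assms(2) by (simp add: sum.distrib sum_divide_distrib)
  also have "(\<Sum>k = 1..min r (Suc n). ?b (Suc n - k)) = (\<Sum>j\<in>{..<Suc n} - {..<Suc n - r}. ?b j)"
    by (rule sum.reindex_bij_witness[where i = "\<lambda>j. Suc n - j" and j = "\<lambda>k. Suc n - k"]) auto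
  also have "\<dots> = S (Suc n) - S (Suc n - r)"
    unfolding S_def by (subst sum_diff) auto
  finally show ?thesis by simp
qed

text \<open>
  Subtracting the recursions for \<open>n + 1\<close> and \<open>n\<close> cancels all terms but those at the ends of the
  window of length \<open>r\<close>. Both corrections are at most 0, so \<open>small_density r\<close> is decreasing; this
  monotonicity is what makes the Tauberian argument work.
\<close>
lemma small_density_step:
  assumes "r > 0" "n > 0"
  shows "real (Suc n) * small_density r (Suc n) =
    real (Suc n) * small_density r n - small_density r (n - 1) / 2 -
      (if r \<le> n then small_density r (n - r) / 2 else 0)"
proof -
  let ?S = "\<lambda>m. \<Sum>j<m. small_density r j"
  obtain m where m: "n = Suc m" using assms(2) not0_implies_Suc by blast
  have 1: "real (Suc n) * small_density r (Suc n) = small_density r n / 2 + (?S (Suc n) - ?S (Suc n - r)) / 2"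
    by (rule small_density_sum[OF assms(1)])
  have 2: "real n * small_density r n = small_density r (n - 1) / 2 + (?S n - ?S (n - r)) / 2"
    using small_density_sum[OF assms(1), of m] by (simp add: m)
  have 3: "?S (Suc n - r) = ?S (n - r) + (if r \<le> n then small_density r (n - r) else 0)"
    by (cases "r \<le> n") (auto simp: Suc_diff_le)
  show ?thesis using 1 2 unfolding 3 by (cases "r \<le> n") (simp_all add: field_simps)
qed

lemma small_density_antimono_step:
  assumes "r > 0" shows "small_density r (Suc n) \<le> small_density r n"
proof (cases "n = 0")
  case True
  have "min r (Suc 0) = 1" using assms by simp
  then have "small_density r (Suc 0) = 1"
    using small_density_rec[of "Suc 0" r] by (simp add: cycle_weight_def small_density_0)
  then show ?thesis using True by (simp add: small_density_0)
next
  case False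
  then have "real (Suc n) * small_density r (Suc n) \<le> real (Suc n) * small_density r n"
    using small_density_step[OF assms, of n] small_density_nonneg[of r "n - 1"] small_density_nonneg[of r "n - r"]
    by (auto split: if_splits)
  then show ?thesis by simp
qed

lemma small_density_antimono: "r > 0 \<Longrightarrow> m \<le> n \<Longrightarrow> small_density r n \<le> small_density r m"
  using lift_Suc_antimono_le[of "small_density r" m n] small_density_antimono_step by blast

lemma small_density_le_1: "r > 0 \<Longrightarrow> small_density r n \<le> 1"
  using small_density_antimono[of r 0 n] by (simp add: small_density_0)

lemma mat_density_nonneg: "mat_density n \<ge> 0"
  by (simp add: mat_density_def small_density_nonneg)

lemma mat_density_0: "mat_density 0 = 1"
  by (simp add: mat_density_def small_density_0)

lemma mat_density_step:
  assumes "n > 0"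
  shows "real (Suc n) * mat_density (Suc n) = real (Suc n) * mat_density n - mat_density (n - 1) / 2"
  using small_density_step[of "Suc n" n] assms small_density_eq_mat[of _ "Suc n"] by simp

lemma mat_density_antimono: "m \<le> n \<Longrightarrow> mat_density n \<le> mat_density m"
  using small_density_antimono[of "Suc n" m n] small_density_eq_mat[of _ "Suc n"] by simp

lemma mat_density_le_1: "mat_density n \<le> 1"
  using mat_density_antimono[of 0 n] by (simp add: mat_density_0)

lemma mat_density_1: "mat_density (Suc 0) = 1"
  using small_density_rec[of "Suc 0" 1] small_density_eq_mat[of "Suc 0" 1]
  by (simp add: cycle_weight_def small_density_0)

text \<open>
  The step recursion gives a ratio of consecutive values of about \<open>1 - 1/(2*n) - 1/(4*n\<^sup>2)\<close>, whose
  square is slightly below \<open>1 - 1/n\<close>. Therefore \<open>sqrt n * mat_density n\<close> converges.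
\<close>
lemma mat_density_square_decreasing:
  assumes "n \<ge> 2"
  shows "real (Suc n) * (mat_density (Suc n))\<^sup>2 \<le> real n * (mat_density n)\<^sup>2"
proof -
  define m a0 a1 a2 where "m = real (Suc n)" and "a0 = mat_density (Suc n)"
    and "a1 = mat_density n" and "a2 = mat_density (n - 1)"
  have m: "m \<ge> 3" using assms by (simp add: m_def)
  have s1: "m * a0 = m * a1 - a2 / 2"
    using mat_density_step[of n] assms by (simp add: m_def a0_def a1_def a2_def)
  have "(m - 1) * a1 = (m - 1) * a2 - mat_density (n - 2) / 2"
    using mat_density_step[of "n - 1"] assms by (simp add: m_def a1_def a2_def numeral_2_eq_2 Suc_diff_Suc)
  moreover have "mat_density (n - 2) \<ge> a2" unfolding a2_def by (rule mat_density_antimono) simp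
  ultimately have "(m - 1) * a1 \<le> (m - 1) * a2 - a2 / 2" by simp
  then have s2: "(2 * m - 2) * a1 \<le> (2 * m - 3) * a2" by (simp add: algebra_simps)
  \<comment> \<open>the two recursion steps together give the ratio bound \<open>a0 \<le> (1 - q) * a1\<close>\<close>
  define q where "q = (m - 1) / (m * (2 * m - 3))"
  define u where "u = (m - 1) / (2 * m - 3)"
  have mq: "m * q = u" using m by (simp add: q_def u_def)
  have u2: "2 * u = 1 + 1 / (2 * m - 3)" using m by (simp add: u_def field_simps)
  have "(2 * m - 2) * a1 / (2 * m - 3) = 2 * (u * a1)" by (simp add: u_def algebra_simps diff_divide_distrib)
  moreover have "a2 \<ge> (2 * m - 2) * a1 / (2 * m - 3)"
    using s2 m by (simp add: field_simps)
  ultimately have "a2 \<ge> 2 * (u * a1)" by simp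
  then have "m * a0 \<le> m * a1 - u * a1" using s1 by linarith
  also have "\<dots> = m * ((1 - q) * a1)" by (simp add: mq[symmetric] algebra_simps)
  finally have le: "a0 \<le> (1 - q) * a1" using m by simp
  have a: "a0 \<ge> 0" "a1 \<ge> 0" by (simp_all add: a0_def a1_def mat_density_nonneg)
  have "m * a0\<^sup>2 \<le> m * ((1 - q) * a1)\<^sup>2"
    using le a m by (intro mult_left_mono power_mono) auto
  also have "\<dots> = (m * (1 - q)\<^sup>2) * a1\<^sup>2" by (simp add: power_mult_distrib)
  also have "\<dots> \<le> (m - 1) * a1\<^sup>2"
  proof (rule mult_right_mono)
    have "m * (1 - q)\<^sup>2 = m - 2 * (m * q) + (m * q)\<^sup>2 / m"
      using m by (simp add: power2_eq_square field_simps)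
    also have "\<dots> = m - 1 - 1 / (2 * m - 3) + u\<^sup>2 / m" unfolding mq using u2 by simp
    also have "\<dots> \<le> m - 1"
    proof -
      have "(m - 1)\<^sup>2 \<le> m * (2 * m - 3)"
      proof -
        have "m * (2 * m - 3) - (m - 1)\<^sup>2 = m * (m - 1) - 1" by (simp add: power2_eq_square algebra_simps)
        moreover have "m * (m - 1) \<ge> 1 * 1" using m by (intro mult_mono) auto
        ultimately show ?thesis by simp
      qed
      then have "(m - 1)\<^sup>2 / (m * (2 * m - 3)\<^sup>2) \<le> m * (2 * m - 3) / (m * (2 * m - 3)\<^sup>2)"
        using m by (intro divide_right_mono) auto
      also have "\<dots> = 1 / (2 * m - 3)" using m by (simp add: power2_eq_square)
      also have "(m - 1)\<^sup>2 / (m * (2 * m - 3)\<^sup>2) = u\<^sup>2 / m" by (simp add: u_def power_divide)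
      finally show ?thesis by simp
    qed
    finally show "m * (1 - q)\<^sup>2 \<le> m - 1" .
  qed simp
  finally show ?thesis by (simp add: m_def a0_def a1_def)
qed

lemma mat_density_sqrt_convergent:
  obtains C where "(\<lambda>n. sqrt (real n) * mat_density n) \<longlonglongrightarrow> C"
proof -
  let ?x = "\<lambda>n. real (n + 2) * (mat_density (n + 2))\<^sup>2"
  have "decseq ?x"
    unfolding decseq_Suc_iff using mat_density_square_decreasing[of "_ + 2"] by simp
  then obtain D where D: "?x \<longlonglongrightarrow> D"
    using decseq_convergent[of ?x 0] by auto
  have "(\<lambda>n. real n * (mat_density n)\<^sup>2) \<longlonglongrightarrow> D"
    using D by (rule LIMSEQ_offset)
  then have "(\<lambda>n. sqrt (real n * (mat_density n)\<^sup>2)) \<longlonglongrightarrow> sqrt D" by (rule tendsto_real_sqrt)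
  then have "(\<lambda>n. sqrt (real n) * mat_density n) \<longlonglongrightarrow> sqrt D"
    by (simp add: real_sqrt_mult mat_density_nonneg)
  then show ?thesis by (rule that)
qed

section \<open>Generating functions\<close>

lemma power_series_bounded_summable:
  fixes c :: "nat \<Rightarrow> real"
  assumes "\<And>n. \<bar>c n\<bar> \<le> 1" "\<bar>z\<bar> < 1"
  shows "summable (\<lambda>n. c n * z ^ n)"
proof (rule summable_comparison_test')
  show "summable (\<lambda>n. \<bar>z\<bar> ^ n)" using assms(2) by (simp add: summable_geometric)
  show "norm (c n * z ^ n) \<le> \<bar>z\<bar> ^ n" for n
    using mult_right_mono[OF assms(1)[of n], of "\<bar>z\<bar> ^ n"] by (simp add: abs_mult power_abs)
qed

lemma power_series_bounded_deriv:
  fixes c :: "nat \<Rightarrow> real"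
  assumes c: "\<And>n. \<bar>c n\<bar> \<le> 1" and z: "\<bar>z\<bar> < 1"
  shows "((\<lambda>z. \<Sum>n. c n * z ^ n) has_field_derivative (\<Sum>n. diffs c n * z ^ n)) (at z)"
    "summable (\<lambda>n. diffs c n * z ^ n)"
proof -
  obtain K where K: "\<bar>z\<bar> < K" "K < 1" using dense[OF z] by auto
  then have Kp: "\<bar>z\<bar> < \<bar>K\<bar>" "\<bar>K\<bar> < 1" by linarith+
  show "((\<lambda>z. \<Sum>n. c n * z ^ n) has_field_derivative (\<Sum>n. diffs c n * z ^ n)) (at z)"
    by (rule termdiffs_strong[where K = K]) (use power_series_bounded_summable[of c K, OF c] Kp in auto)
  show "summable (\<lambda>n. diffs c n * z ^ n)"
    by (rule termdiff_converges[where K = 1]) (use power_series_bounded_summable[of c, OF c] z in auto)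
qed

text \<open>
  The recursion says that the generating function and the exponential on the right have the same
  logarithmic derivative.
\<close>
lemma small_density_gf:
  assumes r: "r > 0" and z: "0 \<le> z" "z < 1"
  shows "(\<Sum>n. small_density r n * z ^ n) = exp (z / 2 + (\<Sum>k = 1..r. z ^ k / real k) / 2)"
proof -
  let ?b = "small_density r"
  define B where "B z = (\<Sum>n. ?b n * z ^ n)" for z :: real
  define P where "P z = z / 2 + (\<Sum>k = 1..r. z ^ k / real k) / 2" for z :: real
  define p where "p z = (\<Sum>k = 1..r. cycle_weight k * z ^ (k - 1))" for z :: real
  have b: "\<bar>?b n\<bar> \<le> 1" for n
    using small_density_nonneg[of r n] small_density_le_1[OF r, of n] by simp
  have dB: "(B has_field_derivative p x * B x) (at x)" if x: "\<bar>x\<bar> < 1" for x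
  proof -
    have Bs: "(\<lambda>n. ?b n * x ^ n) sums B x"
      unfolding B_def using power_series_bounded_summable[of ?b x, OF b x] by (rule summable_sums)
    have "(\<lambda>n. if k \<le> Suc n then ?b (Suc n - k) * x ^ n else 0) sums (x ^ (k - 1) * B x)"
      if k: "k \<in> {1..r}" for k
    proof -
      obtain l where l: "k = Suc l" using k by (cases k) auto
      have "(\<lambda>i. x ^ l * (?b i * x ^ i)) sums (x ^ l * B x)"
        using Bs by (rule sums_mult)
      moreover have "(\<lambda>i. x ^ l * (?b i * x ^ i)) =
          (\<lambda>i. if k \<le> Suc (i + l) then ?b (Suc (i + l) - k) * x ^ (i + l) else 0)"
        by (auto simp: fun_eq_iff power_add l)
      ultimately show ?thesis
        unfolding l by (subst sums_zero_iff_shift[of l, symmetric]) auto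
    qed
    then have "(\<lambda>n. \<Sum>k = 1..r. cycle_weight k * (if k \<le> Suc n then ?b (Suc n - k) * x ^ n else 0)) sums
        (\<Sum>k = 1..r. cycle_weight k * (x ^ (k - 1) * B x))"
      by (intro sums_sum sums_mult) auto
    moreover have "(\<Sum>k = 1..r. cycle_weight k * (if k \<le> Suc n then ?b (Suc n - k) * x ^ n else 0)) =
        diffs ?b n * x ^ n" for n
    proof -
      have "(\<Sum>k = 1..r. cycle_weight k * (if k \<le> Suc n then ?b (Suc n - k) * x ^ n else 0)) =
          (\<Sum>k = 1..min r (Suc n). cycle_weight k * (?b (Suc n - k) * x ^ n))"
        by (intro sum.mono_neutral_cong_right) auto
      also have "\<dots> = (\<Sum>k = 1..min r (Suc n). cycle_weight k * ?b (Suc n - k)) * x ^ n"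
        by (simp add: sum_distrib_right mult.assoc)
      finally show ?thesis
        using small_density_rec[of "Suc n" r] by (simp add: diffs_def)
    qed
    ultimately have "(\<lambda>n. diffs ?b n * x ^ n) sums (p x * B x)"
      by (simp add: p_def sum_distrib_right mult.assoc)
    then have "(\<Sum>n. diffs ?b n * x ^ n) = p x * B x" by (rule sums_unique[symmetric])
    then show ?thesis using power_series_bounded_deriv(1)[of ?b x, OF b x] unfolding B_def by simp
  qed
  have dP: "(P has_field_derivative p x) (at x)" for x
  proof -
    have "((\<lambda>z. \<Sum>k = 1..r. z ^ k / real k) has_field_derivative (\<Sum>k = 1..r. real k * x ^ (k - 1) / real k)) (at x)"
      by (intro DERIV_sum DERIV_cdivide) (auto intro!: derivative_eq_intros)
    then have "(P has_field_derivative (1 / 2 + (\<Sum>k = 1..r. real k * x ^ (k - 1) / real k) / 2)) (at x)"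
      unfolding P_def by (intro DERIV_add DERIV_cdivide DERIV_ident)
    moreover have "1 / 2 + (\<Sum>k = 1..r. real k * x ^ (k - 1) / real k) / 2 = p x"
    proof -
      have "p x = (\<Sum>k = 1..r. real k * x ^ (k - 1) / real k / 2 + (if k = 1 then 1 / 2 else 0))"
        unfolding p_def by (intro sum.cong) (auto simp: cycle_weight_def)
      also have "\<dots> = (\<Sum>k = 1..r. real k * x ^ (k - 1) / real k) / 2 + 1 / 2"
        using r by (simp add: sum.distrib sum_divide_distrib)
      finally show ?thesis by simp
    qed
    ultimately show ?thesis by simp
  qed
  have "((\<lambda>x. B x * exp (- P x)) has_field_derivative 0) (at x within {-1<..<1})" if "x \<in> {-1<..<1}" for x
  proof -
    have "\<bar>x\<bar> < 1" using that by auto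
    note d = dB[OF this] dP[of x]
    have "((\<lambda>x. B x * exp (- P x)) has_field_derivative
        p x * B x * exp (- P x) + (exp (- P x) * - p x) * B x) (at x)"
      by (intro DERIV_mult d DERIV_fun_exp DERIV_minus)
    then show ?thesis by (auto intro: has_field_derivative_at_within)
  qed
  then obtain c where c: "\<And>x. x \<in> {-1<..<1} \<Longrightarrow> B x * exp (- P x) = c"
    using has_field_derivative_zero_constant[of "{-1<..<1::real}" "\<lambda>x. B x * exp (- P x)"] by auto
  have "B 0 = 1" by (simp add: B_def small_density_0)
  moreover have "P 0 = 0" by (auto simp: P_def intro!: sum.neutral)
  ultimately have "c = 1" using c[of 0] by simp
  then have "B z * exp (- P z) = 1" using c[of z] z by simp
  then have "B z = exp (P z)" by (simp add: exp_minus field_simps)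
  then show ?thesis by (simp add: B_def P_def)
qed

text \<open>
  The step recursion amounts to \<open>(1 - z) A'(z) = (1 - z/2) A(z)\<close>. The square of \<open>A\<close> is used in the
  proof because it avoids differentiating a root.
\<close>
lemma mat_density_gf:
  assumes z: "0 \<le> z" "z < 1"
  shows "(\<Sum>n. mat_density n * z ^ n) = sqrt (exp z / (1 - z))"
proof -
  define A where "A z = (\<Sum>n. mat_density n * z ^ n)" for z :: real
  define A' where "A' z = (\<Sum>n. diffs mat_density n * z ^ n)" for z :: real
  have a: "\<bar>mat_density n\<bar> \<le> 1" for n
    using mat_density_nonneg[of n] mat_density_le_1[of n] by simp
  have eq: "(1 - x) * A' x = (1 - x / 2) * A x" if x: "\<bar>x\<bar> < 1" for x
  proof -
    have s0: "(\<lambda>n. mat_density n * x ^ n) sums A x"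
      unfolding A_def using power_series_bounded_summable[of mat_density x, OF a x] by (rule summable_sums)
    have s1: "(\<lambda>n. diffs mat_density n * x ^ n) sums A' x"
      unfolding A'_def using power_series_bounded_deriv(2)[of mat_density x, OF a x] by (rule summable_sums)
    have s2: "(\<lambda>n. real n * mat_density n * x ^ n) sums (x * A' x)"
    proof (subst sums_zero_iff_shift[of 1, symmetric])
      show "(\<lambda>i. real (i + 1) * mat_density (i + 1) * x ^ (i + 1)) sums (x * A' x)"
        using sums_mult[OF s1, of x] by (simp add: diffs_def mult_ac)
    qed simp
    have s3: "(\<lambda>n. (if n = 0 then 0 else mat_density (n - 1) * x ^ n)) sums (x * A x)"
    proof (subst sums_zero_iff_shift[of 1, symmetric])
      show "(\<lambda>i. if i + 1 = 0 then 0 else mat_density (i + 1 - 1) * x ^ (i + 1)) sums (x * A x)"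
        using sums_mult[OF s0, of x] by (simp add: mult_ac)
    qed simp
    have "(\<lambda>n. real n * mat_density n * x ^ n + mat_density n * x ^ n -
         (if n = 0 then 0 else mat_density (n - 1) * x ^ n) / 2) sums (x * A' x + A x - x * A x / 2)"
      by (intro sums_diff sums_add s2 s0 sums_divide s3)
    moreover have "real n * mat_density n * x ^ n + mat_density n * x ^ n -
         (if n = 0 then 0 else mat_density (n - 1) * x ^ n) / 2 = diffs mat_density n * x ^ n" for n
    proof (cases "n = 0")
      case True
      then show ?thesis by (simp add: diffs_def mat_density_0 mat_density_1)
    next
      case False
      have "diffs mat_density n * x ^ n = (real (Suc n) * mat_density n - mat_density (n - 1) / 2) * x ^ n"
        unfolding diffs_def using mat_density_step[of n] False by simp
      then show ?thesis using False by (simp add: algebra_simps)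
    qed
    ultimately have "(\<lambda>n. diffs mat_density n * x ^ n) sums (x * A' x + A x - x * A x / 2)" by simp
    then have "A' x = x * A' x + A x - x * A x / 2" using s1 sums_unique2 by blast
    then show ?thesis by (simp add: algebra_simps)
  qed
  have "((\<lambda>x. (A x)\<^sup>2 * exp (- x) * (1 - x)) has_field_derivative 0) (at x within {-1<..<1})"
    if "x \<in> {-1<..<1}" for x
  proof -
    have x: "\<bar>x\<bar> < 1" using that by auto
    have d: "(A has_field_derivative A' x) (at x)"
      using power_series_bounded_deriv(1)[of mat_density x, OF a x] unfolding A_def A'_def .
    have "((\<lambda>x. (A x)\<^sup>2 * exp (- x) * (1 - x)) has_field_derivative
        (2 * A x * A' x * exp (- x) - (A x)\<^sup>2 * exp (- x)) * (1 - x) - (A x)\<^sup>2 * exp (- x)) (at x)"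
      by (auto intro!: derivative_eq_intros d simp: power2_eq_square algebra_simps)
    moreover have "(2 * A x * A' x * exp (- x) - (A x)\<^sup>2 * exp (- x)) * (1 - x) - (A x)\<^sup>2 * exp (- x) =
        2 * A x * exp (- x) * ((1 - x) * A' x - (1 - x / 2) * A x)"
      by (simp add: algebra_simps power2_eq_square)
    ultimately show ?thesis using eq[OF x] by (auto intro: has_field_derivative_at_within)
  qed
  then obtain c where c: "\<And>x. x \<in> {-1<..<1} \<Longrightarrow> (A x)\<^sup>2 * exp (- x) * (1 - x) = c"
    using has_field_derivative_zero_constant[of "{-1<..<1::real}" "\<lambda>x. (A x)\<^sup>2 * exp (- x) * (1 - x)"] by auto
  have "A 0 = 1" by (simp add: A_def mat_density_0)
  then have "c = 1" using c[of 0] by simp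
  then have "(A z)\<^sup>2 * exp (- z) * (1 - z) = 1" using c[of z] z by simp
  then have "(A z)\<^sup>2 = exp z / (1 - z)" using z by (simp add: exp_minus field_simps)
  moreover have "A z \<ge> 0"
    unfolding A_def using z by (intro suminf_nonneg power_series_bounded_summable a mult_nonneg_nonneg mat_density_nonneg) auto
  ultimately have "A z = sqrt (exp z / (1 - z))" by (metis real_sqrt_abs abs_of_nonneg)
  then show ?thesis by (simp add: A_def)
qed

section \<open>The exponential integral\<close>

lemma nn_integral_exp_neg:
  assumes "s > 0"
  shows "(\<integral>\<^sup>+v. ennreal (exp (- (s * v))) * indicator {u..} v \<partial>lborel) = ennreal (exp (- (s * u)) / s)"
proof -
  have "((\<lambda>v. - exp (- (s * v)) / s) \<longlongrightarrow> 0) at_top"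
    using assms by real_asymp
  then have "(\<integral>\<^sup>+v. ennreal (exp (- (s * v))) * indicator {u..} v \<partial>lborel) = 0 - (- exp (- (s * u)) / s)"
    using assms by (intro nn_integral_FTC_atLeast) (auto intro!: derivative_eq_intros)
  then show ?thesis by simp
qed

lemma exp_integral_integrable:
  fixes u :: real assumes u: "u > 0" shows "set_integrable lborel {u..} (\<lambda>v. exp (- v) / v)"
proof -
  have "integrable lborel (\<lambda>v::real. exp (- v) * indicator {u..} v)"
  proof (rule integrableI_nonneg)
    have "(\<integral>\<^sup>+v. ennreal (exp (- v) * indicator {u..} v) \<partial>lborel) =
        (\<integral>\<^sup>+v. ennreal (exp (- (1 * v))) * indicator {u..} v \<partial>lborel)"
      by (intro nn_integral_cong) (auto simp: indicator_def)
    then show "(\<integral>\<^sup>+v. ennreal (exp (- v) * indicator {u..} v) \<partial>lborel) < \<infinity>"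
      using nn_integral_exp_neg[of 1 u] by simp
  qed auto
  then have i: "integrable lborel (\<lambda>v::real. exp (- v) * indicator {u..} v / u)" by (rule integrable_divide)
  show ?thesis
    unfolding set_integrable_def
  proof (rule Bochner_Integration.integrable_bound[OF i])
    show "AE v in lborel. norm (indicator {u..} v *\<^sub>R (exp (- v) / v)) \<le> norm (exp (- v) * indicator {u..} v / u)"
      using u by (intro AE_I2) (auto simp: indicator_def frac_le)
  qed simp
qed

lemma exp_integral_split:
  assumes "0 < c" "c \<le> u"
  shows "exp_integral c = integral {c..u} (\<lambda>v. exp (- v) / v) + exp_integral u"
proof -
  have i: "set_integrable lborel {c..u} (\<lambda>v. exp (- v) / v)"
    by (rule set_integrable_subset[OF exp_integral_integrable[OF assms(1)]]) auto
  have "{c..} = {c..u} \<union> {u..}" using assms by auto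
  then have "exp_integral c = (LBINT v:{c..u} \<union> {u..}. exp (- v) / v)" by (simp add: exp_integral_def)
  also have "\<dots> = (LBINT v:{c..u}. exp (- v) / v) + exp_integral u"
    unfolding exp_integral_def
  proof (rule set_integral_Un_AE[OF _ _ _ i exp_integral_integrable])
    show "AE x in lborel. \<not> (x \<in> {c..u} \<and> x \<in> {u..})"
      by (rule AE_mp[OF AE_lborel_singleton[of u]]) auto
  qed (use assms in auto)
  finally show ?thesis using set_borel_integral_eq_integral(2)[OF i] by simp
qed

lemma exp_integral_deriv:
  assumes u: "u > 0" shows "(exp_integral has_real_derivative - (exp (- u) / u)) (at u)"
proof -
  let ?\<phi> = "\<lambda>v::real. exp (- v) / v"
  define c d where "c = u / 2" and "d = u + 1"
  have c: "0 < c" "c < u" "u < d" using u by (auto simp: c_def d_def)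
  have cont: "continuous_on {c..d} ?\<phi>" using c by (intro continuous_intros) auto
  have "((\<lambda>x. integral {c..x} ?\<phi>) has_real_derivative ?\<phi> u) (at u within {c..d})"
    by (rule integral_has_real_derivative[OF cont]) (use c in simp)
  then have "((\<lambda>x. integral {c..x} ?\<phi>) has_real_derivative ?\<phi> u) (at u)"
    unfolding at_within_Icc_at[OF c(2,3)] .
  then have "((\<lambda>x. exp_integral c - integral {c..x} ?\<phi>) has_real_derivative 0 - ?\<phi> u) (at u)"
    by (intro DERIV_diff DERIV_const)
  then have "((\<lambda>x. exp_integral c - integral {c..x} ?\<phi>) has_real_derivative - ?\<phi> u) (at u)" by simp
  moreover have "\<forall>\<^sub>F x in nhds u. exp_integral x = exp_integral c - integral {c..x} ?\<phi>"
  proof -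
    have "\<forall>\<^sub>F x in nhds u. x \<in> {c<..}" using c by (intro eventually_nhds_in_open) auto
    then show ?thesis
    proof eventually_elim
      case (elim x)
      then have "c \<le> x" by simp
      from exp_integral_split[OF c(1) this] show ?case by simp
    qed
  qed
  ultimately show ?thesis by (subst DERIV_cong_ev[OF refl _ refl])
qed

lemma exp_integral_bounds:
  assumes u: "u > 0" shows "0 \<le> exp_integral u" "exp_integral u \<le> exp (- u) / u"
proof -
  show "0 \<le> exp_integral u"
    unfolding exp_integral_def set_lebesgue_integral_def
    using u by (intro integral_nonneg_AE AE_I2) (auto simp: indicator_def)
  have "ennreal (exp_integral u) = (\<integral>\<^sup>+v. ennreal (indicator {u..} v *\<^sub>R (exp (- v) / v)) \<partial>lborel)"
    unfolding exp_integral_def set_lebesgue_integral_def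
    using exp_integral_integrable[OF u] u unfolding set_integrable_def
    by (intro nn_integral_eq_integral[symmetric] AE_I2) (auto simp: indicator_def)
  also have "\<dots> \<le> (\<integral>\<^sup>+v. ennreal (1 / u) * (ennreal (exp (- (1 * v))) * indicator {u..} v) \<partial>lborel)"
    using u by (intro nn_integral_mono) (auto simp: indicator_def ennreal_mult[symmetric] intro!: ennreal_leI frac_le)
  also have "\<dots> = ennreal (1 / u) * ennreal (exp (- (1 * u)) / 1)"
    by (subst nn_integral_cmult) (simp_all add: nn_integral_exp_neg[of 1 u, simplified])
  also have "\<dots> = ennreal (exp (- u) / u)" using u by (simp add: ennreal_mult[symmetric])
  finally show "exp_integral u \<le> exp (- u) / u" using u by (simp add: ennreal_le_iff)
qed

lemma exp_integral_at_top: "(exp_integral \<longlongrightarrow> 0) at_top"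
proof (rule tendsto_sandwich)
  show "\<forall>\<^sub>F u in at_top. 0 \<le> exp_integral u" "\<forall>\<^sub>F u in at_top. exp_integral u \<le> exp (- u) / u"
    using exp_integral_bounds by (auto intro!: eventually_at_top_linorderI[of 1])
  show "((\<lambda>u. exp (- u) / u) \<longlongrightarrow> 0) (at_top :: real filter)" by real_asymp
qed auto

text \<open>
  A decreasing function with limit 0 is nonnegative.
\<close>
lemma nonneg_of_antideriv_vanishing:
  fixes f :: "real \<Rightarrow> real"
  assumes d: "\<And>x. x > 0 \<Longrightarrow> (f has_real_derivative f' x) (at x)" and le: "\<And>x. x > 0 \<Longrightarrow> f' x \<le> 0"
    and lim: "(f \<longlongrightarrow> 0) at_top" and s: "s > 0"
  shows "f s \<ge> 0"
proof (rule tendsto_upperbound[OF lim])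
  show "\<forall>\<^sub>F x in at_top. f x \<le> f s"
  proof (rule eventually_at_top_linorderI[of s])
    fix x assume x: "s \<le> x"
    show "f x \<le> f s"
    proof (rule DERIV_nonpos_imp_nonincreasing[OF x])
      fix y assume "s \<le> y" "y \<le> x"
      then have "y > 0" using s by simp
      then show "\<exists>D. (f has_real_derivative D) (at y) \<and> D \<le> 0" using d le by blast
    qed
  qed
qed simp

text \<open>
  For \<open>z = exp (- s / r)\<close> this is the tail \<open>\<Sum>k>r. z ^ k / k\<close> of the logarithmic series. The closed
  form is easy to differentiate.
\<close>
definition harmonic_tail :: "nat \<Rightarrow> real \<Rightarrow> real" where
  "harmonic_tail r s = - ln (1 - exp (- (s / real r))) - (\<Sum>k = 1..r. exp (- (s / real r)) ^ k / real k)"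

lemma harmonic_tail_deriv:
  assumes r: "r > 0" and s: "s > 0"
  defines "q \<equiv> exp (- (s / real r))"
  shows "(harmonic_tail r has_real_derivative - (exp (- s) * (q / (real r * (1 - q))))) (at s)"
proof -
  have q: "0 < q" "q < 1" using r s by (auto simp: q_def)
  have qr: "q ^ r = exp (- s)" using r by (simp add: q_def flip: exp_of_nat_mult)
  have "((\<lambda>s. \<Sum>k = 1..r. exp (- (s / real r)) ^ k / real k) has_real_derivative
      (\<Sum>k = 1..r. - (q ^ k / real r))) (at s)"
  proof (rule DERIV_sum)
    fix k assume k: "k \<in> {1..r}"
    then have "q ^ k = q * q ^ (k - 1)" by (cases k) auto
    then show "((\<lambda>s. exp (- (s / real r)) ^ k / real k) has_real_derivative - (q ^ k / real r)) (at s)"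
      using k r by (auto intro!: derivative_eq_intros simp: q_def)
  qed
  moreover have "((\<lambda>s. ln (1 - exp (- (s / real r)))) has_real_derivative (q / (real r * (1 - q)))) (at s)"
    using q r by (auto intro!: derivative_eq_intros simp: q_def field_simps)
  ultimately have "(harmonic_tail r has_real_derivative
      - (q / (real r * (1 - q))) - (\<Sum>k = 1..r. - (q ^ k / real r))) (at s)"
    unfolding harmonic_tail_def by (intro DERIV_diff DERIV_minus)
  moreover have "- (q / (real r * (1 - q))) - (\<Sum>k = 1..r. - (q ^ k / real r)) =
      - (exp (- s) * (q / (real r * (1 - q))))"
  proof -
    have "(\<Sum>k = 1..n. q ^ k) * (1 - q) = q * (1 - q ^ n)" for n
    proof (induction n)
      case (Suc n)
      have "(\<Sum>k = 1..Suc n. q ^ k) * (1 - q) = (\<Sum>k = 1..n. q ^ k) * (1 - q) + q ^ Suc n * (1 - q)"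
        by (simp add: distrib_right)
      also have "\<dots> = q * (1 - q ^ n) + q ^ Suc n * (1 - q)" by (simp only: Suc)
      also have "\<dots> = q * (1 - q ^ Suc n)" by (simp add: algebra_simps)
      finally show ?case .
    qed simp
    from this[of r] have S: "(\<Sum>k = 1..r. q ^ k) = q * (1 - exp (- s)) / (1 - q)" using q by (simp add: qr field_simps)
    have N: "(\<Sum>k = 1..r. - (q ^ k / real r)) = - ((\<Sum>k = 1..r. q ^ k) / real r)"
      by (simp add: sum_negf sum_divide_distrib)
    define w where "w = q / (real r * (1 - q))"
    have "q * (1 - exp (- s)) / (1 - q) / real r = w * (1 - exp (- s))" by (simp add: w_def mult.commute)
    then show ?thesis unfolding N S w_def[symmetric] by (simp add: algebra_simps)
  qed
  ultimately show ?thesis by simp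
qed

lemma harmonic_tail_at_top: "r > 0 \<Longrightarrow> (harmonic_tail r \<longlongrightarrow> 0) at_top"
proof -
  assume r: "r > 0"
  have e: "((\<lambda>s. exp (- (s / real r))) \<longlongrightarrow> 0) at_top" using r by real_asymp
  have "((\<lambda>s. - ln (1 - exp (- (s / real r))) - (\<Sum>k = 1..r. exp (- (s / real r)) ^ k / real k)) \<longlongrightarrow>
      - ln (1 - 0) - (\<Sum>k = 1..r. 0 ^ k / real k)) at_top"
    by (intro tendsto_intros e) auto
  moreover have "- ln (1 - 0) - (\<Sum>k = 1..r. 0 ^ k / real k) = (0::real)" by (auto intro!: sum.neutral)
  ultimately show ?thesis unfolding harmonic_tail_def by simp
qed

text \<open>
  Both functions of \<open>s\<close> vanish at infinity, so it suffices to compare derivatives. With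
  \<open>t = s / r\<close> and \<open>q = exp (- t)\<close> this means \<open>0 \<le> 1 / t - q / (1 - q) \<le> 1\<close>, which follows from
  \<open>exp x \<ge> 1 + x\<close> at \<open>x = t\<close> and \<open>x = - t\<close>.
\<close>
lemma harmonic_tail_exp_integral:
  assumes r: "r > 0" and s: "s > 0"
  shows "harmonic_tail r s \<le> exp_integral s" "exp_integral s \<le> harmonic_tail r s + exp (- s) / real r"
proof -
  define q where "q x = exp (- (x / real r))" for x :: real
  define e where "e x = 1 / x - q x / (real r * (1 - q x))" for x
  have e: "0 \<le> e x \<and> e x \<le> 1 / real r" if "x > 0" for x
  proof -
    define t where "t = x / real r"
    have t: "t > 0" "x = real r * t" using that r by (auto simp: t_def)
    have q: "0 < q x" "q x < 1" using that r by (auto simp: q_def)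
    have 1: "1 - q x \<le> t" using exp_ge_add_one_self[of "- t"] by (simp add: q_def t_def)
    have "(1 + t) * q x \<le> exp t * q x"
      using exp_ge_add_one_self[of t] q by (intro mult_right_mono) auto
    also have "exp t * q x = 1" by (simp add: q_def t_def flip: exp_add)
    finally have 2: "(1 + t) * q x \<le> 1" .
    have eq: "e x = (1 - q x - t * q x) / (t * (1 - q x)) / real r"
    proof -
      define Q where "Q = q x"
      have Q: "Q < 1" using q by (simp add: Q_def)
      have "e x = 1 / (real r * t) - Q / (real r * (1 - Q))"
        unfolding e_def Q_def t(2)[symmetric] ..
      also have "\<dots> = (1 / t - Q / (1 - Q)) / real r"
        by (simp add: diff_divide_distrib mult.commute)
      also have "1 / t - Q / (1 - Q) = (1 * (1 - Q) - Q * t) / (t * (1 - Q))"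
        using t(1) Q by (intro diff_frac_eq) auto
      finally show ?thesis by (simp add: Q_def mult.commute)
    qed
    have "(1 - q x - t * q x) / (t * (1 - q x)) \<le> 1"
      using 1 t(1) q by (simp add: divide_simps algebra_simps)
    moreover have "0 \<le> (1 - q x - t * q x) / (t * (1 - q x))"
      using 2 t(1) q by (intro divide_nonneg_pos) (auto simp: algebra_simps)
    ultimately show ?thesis
      unfolding eq by (metis divide_nonneg_nonneg divide_right_mono of_nat_0_le_iff)
  qed
  have d: "((\<lambda>x. exp_integral x - harmonic_tail r x) has_real_derivative - (exp (- x) * e x)) (at x)"
    if "x > 0" for x
    using DERIV_diff[OF exp_integral_deriv[OF that] harmonic_tail_deriv[OF r that]]
    by (simp add: e_def q_def algebra_simps)
  have lim: "((\<lambda>x. exp_integral x - harmonic_tail r x) \<longlongrightarrow> 0 - 0) at_top"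
    by (intro tendsto_diff exp_integral_at_top harmonic_tail_at_top r)
  have "0 \<le> exp_integral s - harmonic_tail r s"
    by (rule nonneg_of_antideriv_vanishing[OF d _ _ s]) (use e lim in auto)
  then show "harmonic_tail r s \<le> exp_integral s" by simp
  have "0 \<le> exp (- s) / real r - (exp_integral s - harmonic_tail r s)"
  proof (rule nonneg_of_antideriv_vanishing[where f' = "\<lambda>x. - exp (- x) / real r + exp (- x) * e x", OF _ _ _ s])
    show "((\<lambda>x. exp (- x) / real r - (exp_integral x - harmonic_tail r x)) has_real_derivative
        - exp (- x) / real r + exp (- x) * e x) (at x)" if "x > 0" for x
    proof -
      have "((\<lambda>x. exp (- x) / real r) has_real_derivative - exp (- x) / real r) (at x)"
        using r by (auto intro!: derivative_eq_intros)
      from DERIV_diff[OF this d[OF that]] show ?thesis by simp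
    qed
    show "- exp (- x) / real r + exp (- x) * e x \<le> 0" if "x > 0" for x
      using mult_left_mono[of "e x" "1 / real r" "exp (- x)"] e[OF that] by simp
    have "((\<lambda>x. exp (- x) / real r) \<longlongrightarrow> 0) at_top" using r by real_asymp
    then show "((\<lambda>x. exp (- x) / real r - (exp_integral x - harmonic_tail r x)) \<longlongrightarrow> 0) at_top"
      using tendsto_diff[OF _ lim] by fastforce
  qed
  then show "exp_integral s \<le> harmonic_tail r s + exp (- s) / real r" by simp
qed

lemma integral_of_nn_integral:
  fixes f :: "'a \<Rightarrow> real"
  assumes "f \<in> borel_measurable M" "\<And>x. 0 \<le> f x" "0 \<le> I" "(\<integral>\<^sup>+x. ennreal (f x) \<partial>M) = ennreal I"
  shows "integrable M f" "integral\<^sup>L M f = I"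
  using nn_integral_eq_integrable[of f M I] assms by auto

section \<open>Laplace transforms of step functions\<close>

lemma nn_integral_step_exp:
  fixes c :: "nat \<Rightarrow> real"
  assumes c: "\<And>n. 0 \<le> c n" "\<And>n. c n \<le> 1" and s: "s > 0" and r: "r > 0"
  defines "z \<equiv> exp (- (s / real r))"
  shows "(\<integral>\<^sup>+y. ennreal (c (nat \<lfloor>real r * y\<rfloor>) * exp (- (s * y))) * indicator {0..} y \<partial>lborel) =
    ennreal ((1 - z) / s * (\<Sum>n. c n * z ^ n))"
proof -
  have z: "0 < z" "z < 1" using s r by (auto simp: z_def)
  have zn: "exp (- (s * (real n / real r))) = z ^ n" for n
    by (simp add: z_def mult_ac flip: exp_of_nat_mult)
  let ?I = "\<lambda>n. {real n / real r..<real (Suc n) / real r}"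
  have mem: "y \<in> ?I n \<longleftrightarrow> n = nat \<lfloor>real r * y\<rfloor> \<and> 0 \<le> y" for n y
  proof -
    have "y \<in> ?I n \<longleftrightarrow> real n \<le> real r * y \<and> real r * y < real n + 1"
      using r by (simp add: field_simps)
    also have "\<dots> \<longleftrightarrow> \<lfloor>real r * y\<rfloor> = int n" by (simp add: floor_eq_iff)
    also have "\<dots> \<longleftrightarrow> n = nat \<lfloor>real r * y\<rfloor> \<and> 0 \<le> y"
    proof
      assume a: "\<lfloor>real r * y\<rfloor> = int n"
      then have "0 \<le> real r * y" by (metis of_nat_0_le_iff zero_le_floor)
      then show "n = nat \<lfloor>real r * y\<rfloor> \<and> 0 \<le> y" using a r by (simp add: zero_le_mult_iff)
    next
      assume "n = nat \<lfloor>real r * y\<rfloor> \<and> 0 \<le> y"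
      then show "\<lfloor>real r * y\<rfloor> = int n" using r by simp
    qed
    finally show ?thesis .
  qed
  have "(\<integral>\<^sup>+y. ennreal (c (nat \<lfloor>real r * y\<rfloor>) * exp (- (s * y))) * indicator {0..} y \<partial>lborel) =
      (\<integral>\<^sup>+y. (\<Sum>n. ennreal (c n * exp (- (s * y))) * indicator (?I n) y) \<partial>lborel)"
  proof (intro nn_integral_cong)
    fix y :: real
    show "ennreal (c (nat \<lfloor>real r * y\<rfloor>) * exp (- (s * y))) * indicator {0..} y =
        (\<Sum>n. ennreal (c n * exp (- (s * y))) * indicator (?I n) y)"
    proof (cases "0 \<le> y")
      case True
      have "(\<Sum>n. ennreal (c n * exp (- (s * y))) * indicator (?I n) y) =
          (\<Sum>n\<in>{nat \<lfloor>real r * y\<rfloor>}. ennreal (c n * exp (- (s * y))) * indicator (?I n) y)"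
        using mem[of y] by (intro suminf_finite) (auto simp: indicator_def)
      then show ?thesis using mem[of y "nat \<lfloor>real r * y\<rfloor>"] True by (simp add: indicator_def)
    next
      case False
      then have "indicator (?I n) y = (0 :: ennreal)" for n using mem[of y n] by (simp add: indicator_def)
      then show ?thesis using False by simp
    qed
  qed
  also have "\<dots> = (\<Sum>n. \<integral>\<^sup>+y. ennreal (c n * exp (- (s * y))) * indicator (?I n) y \<partial>lborel)"
    by (rule nn_integral_suminf) auto
  also have "\<dots> = (\<Sum>n. ennreal ((1 - z) / s * (c n * z ^ n)))"
  proof (intro suminf_cong)
    fix n
    have "(\<integral>\<^sup>+y. ennreal (c n * exp (- (s * y))) * indicator (?I n) y \<partial>lborel) =
        (\<integral>\<^sup>+y. ennreal (c n * exp (- (s * y))) * indicator {real n / real r..real (Suc n) / real r} y \<partial>lborel)"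
      by (rule nn_integral_cong_AE, rule AE_mp[OF AE_lborel_singleton[of "real (Suc n) / real r"]], rule AE_I2)
        (auto simp: indicator_def)
    also have "\<dots> = ennreal (- (c n / s) * exp (- (s * (real (Suc n) / real r))) -
        - (c n / s) * exp (- (s * (real n / real r))))"
    proof (rule nn_integral_FTC_Icc)
      show "((\<lambda>y. - (c n / s) * exp (- (s * y))) has_real_derivative c n * exp (- (s * y))) (at y)" for y
        using s by (auto intro!: derivative_eq_intros)
      show "0 \<le> c n * exp (- (s * y))" for y using c(1)[of n] by simp
      show "real n / real r \<le> real (Suc n) / real r" by (rule divide_right_mono) auto
    qed auto
    also have "- (c n / s) * exp (- (s * (real (Suc n) / real r))) - - (c n / s) * exp (- (s * (real n / real r)))
        = (1 - z) / s * (c n * z ^ n)"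
      unfolding zn using s by (simp add: field_simps)
    finally show "(\<integral>\<^sup>+y. ennreal (c n * exp (- (s * y))) * indicator (?I n) y \<partial>lborel) =
        ennreal ((1 - z) / s * (c n * z ^ n))" .
  qed
  also have "\<dots> = ennreal (\<Sum>n. (1 - z) / s * (c n * z ^ n))"
  proof (rule suminf_ennreal2)
    have "summable (\<lambda>n. c n * z ^ n)"
    proof (rule summable_comparison_test')
      show "summable (\<lambda>n. z ^ n)" using z by (simp add: summable_geometric)
      show "norm (c n * z ^ n) \<le> z ^ n" for n using c[of n] z by (simp add: mult_left_le_one_le)
    qed
    then show "summable (\<lambda>n. (1 - z) / s * (c n * z ^ n))" by (rule summable_mult)
    show "0 \<le> (1 - z) / s * (c n * z ^ n)" for n using c z s by simp
  qed
  also have "(\<Sum>n. (1 - z) / s * (c n * z ^ n)) = (1 - z) / s * (\<Sum>n. c n * z ^ n)"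
  proof (rule suminf_mult)
    show "summable (\<lambda>n. c n * z ^ n)"
    proof (rule summable_comparison_test')
      show "summable (\<lambda>n. z ^ n)" using z by (simp add: summable_geometric)
      show "norm (c n * z ^ n) \<le> z ^ n" for n using c[of n] z by (simp add: mult_left_le_one_le)
    qed
  qed
  finally show ?thesis .
qed

section \<open>Moments determine a distribution on the unit interval\<close>

text \<open>
  For bounded support the exponential series may be integrated term by term, so the
  characteristic function depends on the moments only.
\<close>
lemma char_unit_interval:
  assumes "real_distribution M" and supp: "AE x in M. x \<in> {0..1}"
  shows "char M t = (\<Sum>k. (\<i> * of_real t) ^ k /\<^sub>R fact k * of_real (LINT x|M. x ^ k))"
proof -
  interpret real_distribution M by fact
  let ?f = "\<lambda>k x. (\<i> * of_real t) ^ k /\<^sub>R fact k * complex_of_real (x ^ k)"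
  have le: "AE x in M. norm (x ^ k) \<le> 1" for k
    using supp by eventually_elim (auto simp: power_le_one)
  have int: "integrable M (\<lambda>x. x ^ k)" for k
    by (rule integrable_const_bound[OF le]) simp
  have nf: "norm (?f k x) = (\<bar>t\<bar> ^ k /\<^sub>R fact k) * \<bar>x ^ k\<bar>" for k x
    by (simp add: norm_mult norm_power power_abs)
  have "char M t = (CLINT x|M. (\<Sum>k. ?f k x))"
  proof -
    have "iexp (t * x) = (\<Sum>k. ?f k x)" for x
      by (simp add: exp_def power_mult_distrib mult_ac)
    then show ?thesis by (simp add: char_def)
  qed
  also have "\<dots> = (\<Sum>k. (CLINT x|M. ?f k x))"
  proof (rule integral_suminf)
    show "integrable M (?f k)" for k
      by (intro integrable_mult_right integrable_of_real int)
    show "AE x in M. summable (\<lambda>k. norm (?f k x))"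
    proof (rule AE_I2)
      fix x
      have "(\<lambda>k. norm (?f k x)) = (\<lambda>k. norm ((t * x) ^ k /\<^sub>R fact k))"
        unfolding nf by (simp add: power_mult_distrib abs_mult power_abs mult.assoc)
      then show "summable (\<lambda>k. norm (?f k x))" using summable_norm_exp[of "t * x"] by simp
    qed
    show "summable (\<lambda>k. LINT x|M. norm (?f k x))"
    proof (rule summable_comparison_test')
      show "summable (\<lambda>k. \<bar>t\<bar> ^ k /\<^sub>R fact k)" using summable_exp_generic[of "\<bar>t\<bar>"] by simp
      fix k
      have "(LINT x|M. norm (?f k x)) = (\<bar>t\<bar> ^ k /\<^sub>R fact k) * (LINT x|M. \<bar>x ^ k\<bar>)"
        unfolding nf by simp
      also have "\<dots> \<le> (\<bar>t\<bar> ^ k /\<^sub>R fact k) * 1"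
      proof (rule mult_left_mono)
        have "(LINT x|M. \<bar>x ^ k\<bar>) \<le> (LINT x|M. 1)"
          using le[of k] by (intro integral_mono_AE integrable_abs int) auto
        then show "(LINT x|M. \<bar>x ^ k\<bar>) \<le> 1" using prob_space by simp
      qed simp
      finally show "norm (LINT x|M. norm (?f k x)) \<le> \<bar>t\<bar> ^ k /\<^sub>R fact k" by simp
    qed
  qed
  also have "\<dots> = (\<Sum>k. (\<i> * of_real t) ^ k /\<^sub>R fact k * of_real (LINT x|M. x ^ k))"
    by (intro suminf_cong) (simp del: of_real_power)
  finally show ?thesis .
qed

lemma moments_determine_distribution:
  assumes "real_distribution M" "real_distribution N"
    and "AE x in M. x \<in> {0..1}" "AE x in N. x \<in> {0..1}"
    and "\<And>k. (LINT x|M. x ^ k) = (LINT x|N. x ^ k)"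
  shows "M = N"
  using assms by (intro Levy_uniqueness) (auto simp: char_unit_interval fun_eq_iff)

section \<open>Scaling of the densities\<close>

text \<open>
  In the regime where \<open>n = r * y\<close> and \<open>r\<close> tends to infinity, the densities are of order
  \<open>1 / sqrt r\<close>.
\<close>
definition scaled_all :: "nat \<Rightarrow> real \<Rightarrow> real" where
  "scaled_all r y = sqrt (real r) * mat_density (nat \<lfloor>real r * y\<rfloor>)"

definition scaled_small :: "nat \<Rightarrow> real \<Rightarrow> real" where
  "scaled_small r y = sqrt (real r) * small_density r (nat \<lfloor>real r * y\<rfloor>)"

lemma measurable_scaled [measurable]:
  "scaled_all r \<in> borel_measurable borel" "scaled_small r \<in> borel_measurable borel"
  unfolding scaled_all_def[abs_def] scaled_small_def[abs_def] by measurable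

lemma scaled_nonneg: "0 \<le> scaled_small r y" "scaled_small r y \<le> scaled_all r y"
  by (auto simp: scaled_small_def scaled_all_def intro!: mult_nonneg_nonneg mult_left_mono
      small_density_nonneg small_density_le_mat)

text \<open>
  This bound provides the integrable majorants for dominated convergence.
\<close>
lemma scaled_all_bound:
  obtains K where "K > 0" "\<And>r y. y > 0 \<Longrightarrow> scaled_all r y \<le> K / sqrt y"
proof -
  obtain C where C: "(\<lambda>n. sqrt (real n) * mat_density n) \<longlonglongrightarrow> C" by (rule mat_density_sqrt_convergent)
  then obtain B where B: "B > 0" "\<And>n. \<bar>sqrt (real n) * mat_density n\<bar> \<le> B"
    using convergent_imp_Bseq[OF convergentI[OF C]] by (auto elim!: BseqE)
  have "scaled_all r y \<le> (B + 1) / sqrt y" if y: "y > 0" for r y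
  proof -
    let ?n = "nat \<lfloor>real r * y\<rfloor>"
    have a: "mat_density ?n \<ge> 0" "mat_density ?n \<le> 1" by (simp_all add: mat_density_nonneg mat_density_le_1)
    have "0 \<le> real r * y" using y by simp
    then have "real r * y \<le> real ?n + 1" by linarith
    then have "sqrt (real r) * sqrt y \<le> sqrt (real ?n + 1)" by (simp flip: real_sqrt_mult)
    also have "\<dots> \<le> sqrt (real ?n) + 1" using sqrt_add_le_add_sqrt[of "real ?n" 1] by simp
    finally have "sqrt (real r) * sqrt y * mat_density ?n \<le> (sqrt (real ?n) + 1) * mat_density ?n"
      using a by (intro mult_right_mono) auto
    also have "\<dots> \<le> B + 1" using B(2)[of ?n] a by (simp add: distrib_right)
    finally show ?thesis using y by (simp add: scaled_all_def field_simps)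
  qed
  then show ?thesis using B(1) by (intro that[of "B + 1"]) auto
qed

lemma floor_scale_tendsto:
  assumes y: "y > 0"
  shows "filterlim (\<lambda>r. nat \<lfloor>real r * y\<rfloor>) at_top sequentially"
    "(\<lambda>r. real (nat \<lfloor>real r * y\<rfloor>) / real r) \<longlonglongrightarrow> y"
proof -
  have bd: "real r * y - 1 \<le> real (nat \<lfloor>real r * y\<rfloor>) \<and> real (nat \<lfloor>real r * y\<rfloor>) \<le> real r * y" for r
  proof -
    have "0 \<le> real r * y" using y by simp
    then show ?thesis by linarith
  qed
  show "(\<lambda>r. real (nat \<lfloor>real r * y\<rfloor>) / real r) \<longlonglongrightarrow> y"
  proof (rule tendsto_sandwich)
    show "\<forall>\<^sub>F r in sequentially. (real r * y - 1) / real r \<le> real (nat \<lfloor>real r * y\<rfloor>) / real r"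
      using bd by (intro always_eventually allI divide_right_mono) auto
    show "\<forall>\<^sub>F r in sequentially. real (nat \<lfloor>real r * y\<rfloor>) / real r \<le> real r * y / real r"
      using bd by (intro always_eventually allI divide_right_mono) auto
    show "(\<lambda>r. (real r * y - 1) / real r) \<longlonglongrightarrow> y" by real_asymp
    show "(\<lambda>r. real r * y / real r) \<longlonglongrightarrow> y" by real_asymp
  qed
  have "filterlim (\<lambda>r. real r * y - 1) at_top sequentially" using y by real_asymp
  then have "filterlim (\<lambda>r. real (nat \<lfloor>real r * y\<rfloor>)) at_top sequentially"
    by (rule filterlim_at_top_mono) (use bd in auto)
  then show "filterlim (\<lambda>r. nat \<lfloor>real r * y\<rfloor>) at_top sequentially"
    by (simp add: filterlim_sequentially_iff_filterlim_real)
qed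

lemma scaled_all_tendsto:
  assumes C: "(\<lambda>n. sqrt (real n) * mat_density n) \<longlonglongrightarrow> C" and y: "y > 0"
  shows "(\<lambda>r. scaled_all r y) \<longlonglongrightarrow> C / sqrt y"
proof -
  let ?n = "\<lambda>r. nat \<lfloor>real r * y\<rfloor>"
  have "(\<lambda>r. (sqrt (real (?n r)) * mat_density (?n r)) / sqrt (real (?n r) / real r)) \<longlonglongrightarrow> C / sqrt y"
    using y by (intro tendsto_divide tendsto_real_sqrt floor_scale_tendsto(2)
        filterlim_compose[OF C floor_scale_tendsto(1)]) auto
  moreover have "\<forall>\<^sub>F r in sequentially.
      (sqrt (real (?n r)) * mat_density (?n r)) / sqrt (real (?n r) / real r) = scaled_all r y"
  proof -
    have "\<forall>\<^sub>F r in sequentially. ?n r > 0"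
      using filterlim_at_top[THEN iffD1, OF floor_scale_tendsto(1)[OF y], rule_format, of 1]
      by eventually_elim linarith
    then show ?thesis
    proof eventually_elim
      case (elim r)
      have "sqrt (real m) * a / sqrt (real m / real r) = sqrt (real r) * a" if "0 < m" for m :: nat and a :: real
        using that by (simp add: real_sqrt_divide)
      from this[OF elim] show ?case unfolding scaled_all_def .
    qed
  qed
  ultimately show ?thesis by (rule Lim_transform_eventually)
qed

section \<open>Laplace transforms of the densities\<close>

lemma nn_integral_Gamma:
  fixes x c :: real
  assumes x: "x > 0" and c: "c > 0"
  shows "(\<integral>\<^sup>+t. ennreal (t powr (x - 1) * exp (- (c * t))) * indicator {0<..} t \<partial>lborel) =
    ennreal (Gamma x / c powr x)"
proof -
  let ?g = "\<lambda>c t. ennreal (t powr (x - 1) * exp (- (c * t))) * indicator {0<..} t"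
  let ?h = "\<lambda>t::real. if t \<in> {0..} then t powr (x - 1) / exp t else 0"
  have "(?h has_integral Gamma x) UNIV"
    using Gamma_integral_real[OF x] by (subst has_integral_restrict_UNIV)
  then have "(\<integral>\<^sup>+t. ennreal (?h t) \<partial>lborel) = ennreal (Gamma x)"
    by (rule nn_integral_has_integral_lborel[rotated 2]) auto
  moreover have "(\<integral>\<^sup>+t. ennreal (?h t) \<partial>lborel) = (\<integral>\<^sup>+t. ?g 1 t \<partial>lborel)"
    by (rule nn_integral_cong_AE, rule AE_mp[OF AE_lborel_singleton[of 0]], rule AE_I2)
      (auto simp: indicator_def exp_minus field_simps)
  ultimately have 1: "(\<integral>\<^sup>+t. ?g 1 t \<partial>lborel) = ennreal (Gamma x)" by simp
  have "(\<integral>\<^sup>+t. ?g c t \<partial>lborel) = ennreal \<bar>1 / c\<bar> * (\<integral>\<^sup>+t. ?g c (0 + 1 / c * t) \<partial>lborel)"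
    using c by (intro nn_integral_real_affine) auto
  also have "(\<integral>\<^sup>+t. ?g c (0 + 1 / c * t) \<partial>lborel) = (\<integral>\<^sup>+t. ennreal (1 / c powr (x - 1)) * ?g 1 t \<partial>lborel)"
    using c by (intro nn_integral_cong)
      (auto simp: indicator_def zero_less_mult_iff zero_less_divide_iff powr_divide ennreal_mult[symmetric])
  also have "\<dots> = ennreal (1 / c powr (x - 1)) * ennreal (Gamma x)"
    using 1 by (subst nn_integral_cmult) simp_all
  also have "ennreal \<bar>1 / c\<bar> * (ennreal (1 / c powr (x - 1)) * ennreal (Gamma x)) =
      ennreal (1 / c * (1 / c powr (x - 1) * Gamma x))"
    using c Gamma_real_pos[OF x] by (simp add: ennreal_mult[symmetric])
  also have "1 / c * (1 / c powr (x - 1) * Gamma x) = Gamma x / c powr x"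
    using c by (simp add: powr_diff)
  finally show ?thesis .
qed

lemma integral_inverse_sqrt_exp:
  assumes s: "s > (0::real)"
  shows "integrable lborel (\<lambda>y. indicator {0<..} y * (1 / sqrt y * exp (- (s * y))))"
    "(LBINT y. indicator {0<..} y * (1 / sqrt y * exp (- (s * y)))) = sqrt (pi / s)"
proof -
  have "(\<integral>\<^sup>+y. ennreal (indicator {0<..} y * (1 / sqrt y * exp (- (s * y)))) \<partial>lborel) =
      (\<integral>\<^sup>+t. ennreal (t powr (1 / 2 - 1) * exp (- (s * t))) * indicator {0<..} t \<partial>lborel)"
    by (intro nn_integral_cong)
      (auto simp: indicator_def powr_half_sqrt powr_minus_divide real_sqrt_divide)
  also have "\<dots> = ennreal (sqrt (pi / s))"
    using s by (subst nn_integral_Gamma) (auto simp: Gamma_one_half_real powr_half_sqrt real_sqrt_divide)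
  finally have nn: "(\<integral>\<^sup>+y. ennreal (indicator {0<..} y * (1 / sqrt y * exp (- (s * y)))) \<partial>lborel) = ennreal (sqrt (pi / s))" .
  show "integrable lborel (\<lambda>y. indicator {0<..} y * (1 / sqrt y * exp (- (s * y))))"
    "(LBINT y. indicator {0<..} y * (1 / sqrt y * exp (- (s * y)))) = sqrt (pi / s)"
    by (rule integral_of_nn_integral[OF _ _ _ nn]; use s in \<open>auto simp: indicator_def\<close>)+
qed

lemma integral_step_exp:
  fixes c :: "nat \<Rightarrow> real"
  assumes c: "\<And>n. 0 \<le> c n" "\<And>n. c n \<le> 1" and s: "s > 0" and r: "r > 0"
  defines "z \<equiv> exp (- (s / real r))"
  shows "integrable lborel (\<lambda>y. indicator {0<..} y * (c (nat \<lfloor>real r * y\<rfloor>) * exp (- (s * y))))"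
    "(LBINT y. indicator {0<..} y * (c (nat \<lfloor>real r * y\<rfloor>) * exp (- (s * y)))) = (1 - z) / s * (\<Sum>n. c n * z ^ n)"
proof -
  have z: "0 < z" "z < 1" using s r by (auto simp: z_def)
  have "(\<integral>\<^sup>+y. ennreal (indicator {0<..} y * (c (nat \<lfloor>real r * y\<rfloor>) * exp (- (s * y)))) \<partial>lborel) =
      (\<integral>\<^sup>+y. ennreal (c (nat \<lfloor>real r * y\<rfloor>) * exp (- (s * y))) * indicator {0..} y \<partial>lborel)"
    by (rule nn_integral_cong_AE, rule AE_mp[OF AE_lborel_singleton[of 0]], rule AE_I2) (auto simp: indicator_def)
  also have "\<dots> = ennreal ((1 - z) / s * (\<Sum>n. c n * z ^ n))"
    unfolding z_def by (rule nn_integral_step_exp[OF c s r])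
  finally have nn: "(\<integral>\<^sup>+y. ennreal (indicator {0<..} y * (c (nat \<lfloor>real r * y\<rfloor>) * exp (- (s * y)))) \<partial>lborel) =
      ennreal ((1 - z) / s * (\<Sum>n. c n * z ^ n))" .
  have "\<bar>c n\<bar> \<le> 1" for n using c[of n] by simp
  then have "summable (\<lambda>n. c n * z ^ n)" using z by (intro power_series_bounded_summable) auto
  then have "0 \<le> (1 - z) / s * (\<Sum>n. c n * z ^ n)"
    using z s c by (intro mult_nonneg_nonneg suminf_nonneg) auto
  note nn' = integral_of_nn_integral[OF _ _ this nn]
  show "integrable lborel (\<lambda>y. indicator {0<..} y * (c (nat \<lfloor>real r * y\<rfloor>) * exp (- (s * y))))"
    "(LBINT y. indicator {0<..} y * (c (nat \<lfloor>real r * y\<rfloor>) * exp (- (s * y)))) = (1 - z) / s * (\<Sum>n. c n * z ^ n)"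
    by (rule nn'; use c in \<open>auto simp: indicator_def\<close>)+
qed

definition laplace_all :: "nat \<Rightarrow> real \<Rightarrow> real" where
  "laplace_all r s = sqrt (real r) * ((1 - exp (- (s / real r))) / s *
     sqrt (exp (exp (- (s / real r))) / (1 - exp (- (s / real r)))))"

lemma laplace_scaled_all:
  assumes s: "s > 0" and r: "r > 0"
  shows "integrable lborel (\<lambda>y. indicator {0<..} y * (scaled_all r y * exp (- (s * y))))"
    "(LBINT y. indicator {0<..} y * (scaled_all r y * exp (- (s * y)))) = laplace_all r s"
proof -
  have z: "0 \<le> exp (- (s / real r))" "exp (- (s / real r)) < 1" using s r by auto
  have eq: "(\<lambda>y. indicator {0<..} y * (scaled_all r y * exp (- (s * y)))) =
     (\<lambda>y. sqrt (real r) * (indicator {0<..} y * (mat_density (nat \<lfloor>real r * y\<rfloor>) * exp (- (s * y)))))"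
    by (simp add: scaled_all_def mult_ac)
  note i = integral_step_exp[where c = mat_density, OF mat_density_nonneg mat_density_le_1 s r]
  show "integrable lborel (\<lambda>y. indicator {0<..} y * (scaled_all r y * exp (- (s * y))))"
    unfolding eq by (intro integrable_mult_right i)
  show "(LBINT y. indicator {0<..} y * (scaled_all r y * exp (- (s * y)))) = laplace_all r s"
    unfolding eq integral_mult_right_zero i(2) mat_density_gf[OF z] laplace_all_def ..
qed

lemma laplace_scaled_small:
  assumes s: "s > 0" and r: "r > 0"
  shows "integrable lborel (\<lambda>y. indicator {0<..} y * (scaled_small r y * exp (- (s * y))))"
    "(LBINT y. indicator {0<..} y * (scaled_small r y * exp (- (s * y)))) =
       laplace_all r s * exp (- (harmonic_tail r s / 2))"
proof -
  let ?z = "exp (- (s / real r))"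
  have z: "0 \<le> ?z" "?z < 1" using s r by auto
  have eq: "(\<lambda>y. indicator {0<..} y * (scaled_small r y * exp (- (s * y)))) =
     (\<lambda>y. sqrt (real r) * (indicator {0<..} y * (small_density r (nat \<lfloor>real r * y\<rfloor>) * exp (- (s * y)))))"
    by (simp add: scaled_small_def mult_ac)
  note i = integral_step_exp[where c = "small_density r", OF small_density_nonneg small_density_le_1[OF r] s r]
  show "integrable lborel (\<lambda>y. indicator {0<..} y * (scaled_small r y * exp (- (s * y))))"
    unfolding eq by (intro integrable_mult_right i)
  have "exp (?z / 2 + (\<Sum>k = 1..r. ?z ^ k / real k) / 2) =
      sqrt (exp ?z / (1 - ?z)) * exp (- (harmonic_tail r s / 2))"
  proof -
    have "sqrt (exp ?z / (1 - ?z)) = sqrt (exp (?z - ln (1 - ?z)))"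
      using z by (simp add: exp_diff)
    also have "\<dots> = exp ((?z - ln (1 - ?z)) / 2)"
      by (intro real_sqrt_unique) (auto simp flip: exp_double)
    finally show ?thesis
      by (simp add: harmonic_tail_def flip: exp_add) (simp add: field_simps)
  qed
  then show "(LBINT y. indicator {0<..} y * (scaled_small r y * exp (- (s * y)))) =
       laplace_all r s * exp (- (harmonic_tail r s / 2))"
    unfolding eq integral_mult_right_zero i(2) small_density_gf[OF r z] laplace_all_def by simp
qed

lemma laplace_all_tendsto:
  assumes s: "s > 0" shows "(\<lambda>r. laplace_all r s) \<longlonglongrightarrow> sqrt (exp 1 / s)"
proof -
  have 1: "(\<lambda>r. real r * (1 - exp (- (s / real r)))) \<longlonglongrightarrow> s" using s by real_asymp
  have 2: "(\<lambda>r. exp (exp (- (s / real r)))) \<longlonglongrightarrow> exp 1" using s by real_asymp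
  have "(\<lambda>r. sqrt (real r * (1 - exp (- (s / real r)))) * sqrt (exp (exp (- (s / real r)))) / s)
      \<longlonglongrightarrow> sqrt s * sqrt (exp 1) / s"
    using s by (intro tendsto_intros 1 2) auto
  moreover have "\<forall>\<^sub>F r in sequentially.
      sqrt (real r * (1 - exp (- (s / real r)))) * sqrt (exp (exp (- (s / real r)))) / s = laplace_all r s"
  proof (rule eventually_sequentiallyI[of 1])
    fix r :: nat assume r: "1 \<le> r"
    define w where "w = 1 - exp (- (s / real r))"
    have w: "w > 0" using s r by (simp add: w_def)
    have key: "w / s * (E / sqrt w) = sqrt w * E / s" for E
    proof -
      have "w / s * (E / sqrt w) = (w / sqrt w) * E / s" by simp
      then show ?thesis using w by (simp add: real_div_sqrt)
    qed
    show "sqrt (real r * (1 - exp (- (s / real r)))) * sqrt (exp (exp (- (s / real r)))) / s = laplace_all r s"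
      unfolding laplace_all_def w_def[symmetric] real_sqrt_mult real_sqrt_divide key by simp
  qed
  moreover have "sqrt s * sqrt (exp 1) / s = sqrt (exp 1 / s)"
  proof -
    have "sqrt s / s = 1 / sqrt s" using s by (simp add: field_simps)
    then have "(sqrt s / s) * sqrt (exp 1) = 1 / sqrt s * sqrt (exp 1)" by (simp only:)
    then show ?thesis by (simp add: real_sqrt_divide)
  qed
  ultimately show ?thesis by (simp only: Lim_transform_eventually)
qed

text \<open>
  Existence of the limit \<open>C\<close> is known already. Its value comes from computing the limit of the
  Laplace transforms at 1 in two ways: by dominated convergence it is \<open>C * sqrt pi\<close>, and by the
  generating function it is \<open>sqrt (exp 1)\<close>.
\<close>
lemma mat_density_asymptotics:
  "(\<lambda>n. sqrt (real n) * mat_density n) \<longlonglongrightarrow> sqrt (exp 1 / pi)"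
proof -
  obtain C where C: "(\<lambda>n. sqrt (real n) * mat_density n) \<longlonglongrightarrow> C" by (rule mat_density_sqrt_convergent)
  obtain K where K: "K > 0" "\<And>r y. y > 0 \<Longrightarrow> scaled_all r y \<le> K / sqrt y" by (rule scaled_all_bound) auto
  let ?w = "\<lambda>y::real. indicator {0<..} y * (1 / sqrt y * exp (- (1 * y)))"
  note w = integral_inverse_sqrt_exp[of 1]
  have "(\<lambda>r. LBINT y. indicator {0<..} y * (scaled_all r y * exp (- (1 * y)))) \<longlonglongrightarrow> (LBINT y. C * ?w y)"
  proof (rule integral_dominated_convergence[where w = "\<lambda>y. K * ?w y"])
    show "integrable lborel (\<lambda>y. K * ?w y)" using w(1) by (intro integrable_mult_right) simp
    show "AE y in lborel. (\<lambda>r. indicator {0<..} y * (scaled_all r y * exp (- (1 * y)))) \<longlonglongrightarrow> C * ?w y"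
    proof (rule AE_I2)
      fix y :: real
      show "(\<lambda>r. indicator {0<..} y * (scaled_all r y * exp (- (1 * y)))) \<longlonglongrightarrow> C * ?w y"
      proof (cases "y > 0")
        case True
        have "(\<lambda>r. scaled_all r y * exp (- (1 * y))) \<longlonglongrightarrow> C / sqrt y * exp (- (1 * y))"
          by (intro tendsto_mult scaled_all_tendsto[OF C True] tendsto_const)
        then show ?thesis using True by simp
      qed simp
    qed
    show "AE y in lborel. norm (indicator {0<..} y * (scaled_all r y * exp (- (1 * y)))) \<le> K * ?w y" for r
    proof (rule AE_I2)
      fix y :: real
      show "norm (indicator {0<..} y * (scaled_all r y * exp (- (1 * y)))) \<le> K * ?w y"
      proof (cases "y > 0")
        case True
        have "0 \<le> scaled_all r y" using scaled_nonneg[of r y] by linarith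
        then show ?thesis using True mult_right_mono[OF K(2)[OF True], of "exp (- y)" r] by (simp add: abs_mult)
      qed simp
    qed
  qed auto
  then have lim: "(\<lambda>r. LBINT y. indicator {0<..} y * (scaled_all r y * exp (- (1 * y)))) \<longlonglongrightarrow> C * sqrt pi"
    by (simp only: integral_mult_right_zero w(2)[OF less_numeral_extra(1)] div_by_1)
  have "\<forall>\<^sub>F r in sequentially. (LBINT y. indicator {0<..} y * (scaled_all r y * exp (- (1 * y)))) = laplace_all r 1"
    by (rule eventually_sequentiallyI[of 1]) (rule laplace_scaled_all(2), auto)
  from Lim_transform_eventually[OF lim this] laplace_all_tendsto[of 1, OF less_numeral_extra(1)]
  have "C * sqrt pi = sqrt (exp 1 / 1)" by (rule LIMSEQ_unique)
  then have "C * sqrt pi = sqrt (exp 1)" by simp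
  then have "C = sqrt (exp 1 / pi)" by (simp add: real_sqrt_divide field_simps)
  then show ?thesis using C by simp
qed

lemma harmonic_tail_tendsto:
  assumes s: "s > 0" shows "(\<lambda>r. harmonic_tail r s) \<longlonglongrightarrow> exp_integral s"
proof (rule tendsto_sandwich)
  show "\<forall>\<^sub>F r in sequentially. exp_integral s - exp (- s) / real r \<le> harmonic_tail r s"
    using harmonic_tail_exp_integral(2)[OF _ s] by (intro eventually_sequentiallyI[of 1]) (simp add: diff_le_eq)
  show "\<forall>\<^sub>F r in sequentially. harmonic_tail r s \<le> exp_integral s"
    using harmonic_tail_exp_integral(1)[OF _ s] by (intro eventually_sequentiallyI[of 1]) simp
  show "(\<lambda>r. exp_integral s - exp (- s) / real r) \<longlonglongrightarrow> exp_integral s" by real_asymp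
qed simp

definition limit_laplace :: "real \<Rightarrow> real" where
  "limit_laplace s = sqrt (exp 1 / s) * (1 - exp (- (exp_integral s / 2)))"

definition scaled_large :: "nat \<Rightarrow> real \<Rightarrow> real" where
  "scaled_large r y = scaled_all r y - scaled_small r y"

lemma scaled_large_eq_0: "y \<le> 1 \<Longrightarrow> scaled_large r y = 0"
proof -
  assume y: "y \<le> 1"
  have "real r * y \<le> real r" using mult_left_mono[OF y, of "real r"] by simp
  then have "nat \<lfloor>real r * y\<rfloor> \<le> r" by linarith
  then show ?thesis
    by (simp add: scaled_large_def scaled_all_def scaled_small_def small_density_eq_mat)
qed

lemma scaled_large_bounds: "0 \<le> scaled_large r y" "scaled_large r y \<le> scaled_all r y"
  using scaled_nonneg[where r = r and y = y] by (auto simp: scaled_large_def)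

text \<open>
  The generating functions of all matrices and of those with small components differ by the
  factor \<open>exp (- harmonic_tail r s / 2)\<close> at \<open>z = exp (- s / r)\<close>. Up to \<open>y = 1\<close> the two densities
  agree, so the transform may be taken over \<open>y > 1\<close>.
\<close>
lemma laplace_scaled_large_tendsto:
  assumes s: "s > 0"
  shows "(\<lambda>r. LBINT y. indicator {1<..} y * (scaled_large r y * exp (- (s * y)))) \<longlonglongrightarrow> limit_laplace s"
proof -
  have "(\<lambda>r. laplace_all r s * (1 - exp (- (harmonic_tail r s / 2)))) \<longlonglongrightarrow> limit_laplace s"
    unfolding limit_laplace_def
    by (intro tendsto_intros laplace_all_tendsto harmonic_tail_tendsto s) simp
  moreover have "\<forall>\<^sub>F r in sequentially. laplace_all r s * (1 - exp (- (harmonic_tail r s / 2))) =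
      (LBINT y. indicator {1<..} y * (scaled_large r y * exp (- (s * y))))"
  proof (rule eventually_sequentiallyI[of 1])
    fix r :: nat assume "1 \<le> r"
    then have r: "r > 0" by simp
    have "(LBINT y. indicator {1<..} y * (scaled_large r y * exp (- (s * y)))) =
        (LBINT y. indicator {0<..} y * (scaled_all r y * exp (- (s * y))) -
          indicator {0<..} y * (scaled_small r y * exp (- (s * y))))"
    proof (intro Bochner_Integration.integral_cong refl)
      fix y :: real
      show "indicator {1<..} y * (scaled_large r y * exp (- (s * y))) =
          indicator {0<..} y * (scaled_all r y * exp (- (s * y))) -
          indicator {0<..} y * (scaled_small r y * exp (- (s * y)))"
        using scaled_large_eq_0[of y r] by (cases "y \<le> 1"; cases "y > 0") (auto simp: scaled_large_def algebra_simps)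
    qed
    also have "\<dots> = laplace_all r s - laplace_all r s * exp (- (harmonic_tail r s / 2))"
      using laplace_scaled_all[OF s r] laplace_scaled_small[OF s r]
      by (subst Bochner_Integration.integral_diff) auto
    finally show "laplace_all r s * (1 - exp (- (harmonic_tail r s / 2))) =
      (LBINT y. indicator {1<..} y * (scaled_large r y * exp (- (s * y))))" by (simp add: algebra_simps)
  qed
  ultimately show ?thesis by (rule Lim_transform_eventually)
qed

section \<open>Pointwise convergence\<close>

text \<open>
  Negating and freezing the argument below 1 yields bounded increasing functions, as Helly's
  selection theorem requires. Nothing is lost, since below 1 there is no restriction on the
  components.
\<close>
definition neg_small :: "nat \<Rightarrow> real \<Rightarrow> real" where
  "neg_small r y = - scaled_small r (max y 1)"

lemma neg_small_mono: "mono (neg_small r)"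
proof (rule monoI)
  fix x y :: real assume xy: "x \<le> y"
  show "neg_small r x \<le> neg_small r y"
  proof (cases "r = 0")
    case False
    have "nat \<lfloor>real r * max x 1\<rfloor> \<le> nat \<lfloor>real r * max y 1\<rfloor>"
      using xy by (intro nat_mono floor_mono mult_left_mono) auto
    then show ?thesis
      using False by (auto simp: neg_small_def scaled_small_def intro!: mult_left_mono small_density_antimono)
  qed (simp add: neg_small_def scaled_small_def)
qed

lemma neg_small_right_continuous: "continuous (at_right x) (neg_small r)"
proof -
  let ?u = "\<lambda>y. real r * max y 1"
  have "(?u \<longlongrightarrow> ?u x) (at_right x)" by (intro tendsto_intros)
  then have "\<forall>\<^sub>F y in at_right x. ?u y < of_int \<lfloor>?u x\<rfloor> + 1"
    by (rule order_tendstoD) simp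
  moreover have "\<forall>\<^sub>F y in at_right x. y > x" by (rule eventually_at_right_less)
  ultimately have "\<forall>\<^sub>F y in at_right x. neg_small r x = neg_small r y"
  proof eventually_elim
    case (elim y)
    have "?u x \<le> ?u y" using elim by (intro mult_left_mono) auto
    then have "\<lfloor>?u y\<rfloor> = \<lfloor>?u x\<rfloor>" using elim(1) by linarith
    then show ?case by (simp add: neg_small_def scaled_small_def)
  qed
  then show ?thesis unfolding continuous_within by (rule Lim_transform_eventually[OF tendsto_const])
qed

lemma neg_small_bounded:
  obtains K where "K > 0" "\<And>r y. \<bar>neg_small r y\<bar> \<le> K" "\<And>r y. y > 0 \<Longrightarrow> scaled_all r y \<le> K / sqrt y"
proof -
  obtain K where K: "K > 0" "\<And>r y. y > 0 \<Longrightarrow> scaled_all r y \<le> K / sqrt y" by (rule scaled_all_bound) auto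
  have "\<bar>neg_small r y\<bar> \<le> K" for r y
  proof -
    have "scaled_small r (max y 1) \<le> K / sqrt (max y 1)"
    proof -
      have "0 < max y 1" by simp
      from K(2)[OF this, of r] show ?thesis using scaled_nonneg(2)[of r "max y 1"] by linarith
    qed
    also have "\<dots> \<le> K / 1" using K(1) by (intro divide_left_mono) auto
    finally show ?thesis using scaled_nonneg(1)[of r "max y 1"] by (simp add: neg_small_def)
  qed
  then show ?thesis using K by (intro that[of K]) auto
qed

abbreviation mat_const :: real where "mat_const \<equiv> sqrt (exp 1 / pi)"

text \<open>
  The properties that pin down a limit \<open>F\<close> of the functions \<open>neg_small r\<close>: the integrand is the
  limit of \<open>scaled_large r y * exp (- s * y)\<close>, so its integral must be the limit of the Laplace
  transforms.
\<close>
definition small_limit :: "(real \<Rightarrow> real) \<Rightarrow> bool" where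
  "small_limit F \<longleftrightarrow> mono F \<and> (\<forall>x. continuous (at_right x) F) \<and> bounded (range F) \<and>
     (\<forall>s>0. integrable lborel (\<lambda>y. indicator {1<..} y * ((mat_const / sqrt y + F y) * exp (- (s * y)))) \<and>
        (LBINT y. indicator {1<..} y * ((mat_const / sqrt y + F y) * exp (- (s * y)))) = limit_laplace s)"

lemma AE_isCont_mono: "mono F \<Longrightarrow> AE y in lborel. isCont (F :: real \<Rightarrow> real) y"
  using AE_not_in[OF countable_imp_null_set_lborel[OF mono_ctble_discont[of F]]] by simp

lemma small_limit_of_subsequence:
  assumes \<sigma>: "strict_mono (\<sigma> :: nat \<Rightarrow> nat)"
    and F: "\<And>x. continuous (at_right x) F" "mono F" "\<And>x. \<bar>F x\<bar> \<le> K"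
    and lim: "\<And>x. isCont F x \<Longrightarrow> (\<lambda>n. neg_small (\<sigma> n) x) \<longlonglongrightarrow> F x"
  shows "small_limit F"
  unfolding small_limit_def
proof (intro conjI allI impI F)
  show "bounded (range F)" using F(3) by (auto simp: bounded_iff)
  fix s :: real assume s: "s > 0"
  obtain K' where K': "K' > 0" "\<And>r y. y > 0 \<Longrightarrow> scaled_all r y \<le> K' / sqrt y" by (rule scaled_all_bound) auto
  let ?w = "\<lambda>y::real. K' * (indicator {0<..} y * (1 / sqrt y * exp (- (s * y))))"
  let ?f = "\<lambda>n y. indicator {1<..} y * (scaled_large (\<sigma> n) y * exp (- (s * y)))"
  let ?F = "\<lambda>y. indicator {1<..} y * ((mat_const / sqrt y + F y) * exp (- (s * y)))"
  have Fm [measurable]: "F \<in> borel_measurable borel" using F(2) by (rule borel_measurable_mono)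
  have fm: "scaled_large r \<in> borel_measurable borel" for r
    unfolding scaled_large_def[abs_def] by measurable
  have w: "integrable lborel ?w" by (intro integrable_mult_right integral_inverse_sqrt_exp(1) s)
  have ptw: "AE y in lborel. (\<lambda>n. ?f n y) \<longlonglongrightarrow> ?F y"
    using AE_isCont_mono[OF F(2)]
  proof eventually_elim
    case (elim y)
    show ?case
    proof (cases "y > 1")
      case True
      have "(\<lambda>n. scaled_all (\<sigma> n) y) \<longlonglongrightarrow> mat_const / sqrt y"
        using True by (intro filterlim_compose[OF scaled_all_tendsto[OF mat_density_asymptotics] filterlim_subseq[OF \<sigma>]]) simp
      moreover have "(\<lambda>n. neg_small (\<sigma> n) y) \<longlonglongrightarrow> F y" by (rule lim[OF elim])
      ultimately have "(\<lambda>n. (scaled_all (\<sigma> n) y + neg_small (\<sigma> n) y) * exp (- (s * y))) \<longlonglongrightarrow>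
          (mat_const / sqrt y + F y) * exp (- (s * y))"
        by (intro tendsto_mult tendsto_add tendsto_const)
      then show ?thesis using True by (simp add: neg_small_def scaled_large_def max_def)
    qed simp
  qed
  have bound: "AE y in lborel. norm (?f n y) \<le> ?w y" for n
  proof (rule AE_I2)
    fix y :: real
    show "norm (?f n y) \<le> ?w y"
    proof (cases "y > 1")
      case True
      have "scaled_large (\<sigma> n) y \<le> K' / sqrt y"
        using scaled_large_bounds(2)[of "\<sigma> n" y] K'(2)[of y "\<sigma> n"] True by linarith
      then have "scaled_large (\<sigma> n) y * exp (- (s * y)) \<le> K' / sqrt y * exp (- (s * y))"
        by (rule mult_right_mono) simp
      then show ?thesis using True scaled_large_bounds(1)[of "\<sigma> n" y] by (simp add: abs_mult)
    next
      case False
      then show ?thesis using K' by (auto simp: indicator_def)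
    qed
  qed
  have m1: "?F \<in> borel_measurable lborel" by measurable
  have m2: "?f n \<in> borel_measurable lborel" for n using fm[of "\<sigma> n"] by measurable
  show "integrable lborel ?F" by (rule integrable_dominated_convergence[OF m1 m2 w ptw bound])
  have "(\<lambda>n. LBINT y. ?f n y) \<longlonglongrightarrow> (LBINT y. ?F y)"
    by (rule integral_dominated_convergence[OF m1 m2 w ptw bound])
  moreover have "(\<lambda>n. LBINT y. ?f n y) \<longlonglongrightarrow> limit_laplace s"
    by (rule filterlim_compose[OF laplace_scaled_large_tendsto[OF s] filterlim_subseq[OF \<sigma>]])
  ultimately show "(LBINT y. ?F y) = limit_laplace s" by (rule LIMSEQ_unique)
qed

lemma AE_lborel_interval_witness:
  assumes "AE x in lborel. P x" "(a::real) < b"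
  shows "\<exists>x\<in>{a<..<b}. P x"
proof (rule ccontr)
  assume neg: "\<not> ?thesis"
  have "AE x in lborel. x \<notin> {a<..<b}"
    using assms(1) by eventually_elim (use neg in blast)
  moreover have "{x \<in> space lborel. \<not> x \<notin> {a<..<b}} = {a<..<b}" by auto
  ultimately have "emeasure lborel {a<..<b} = 0"
    by (subst (asm) AE_iff_measurable) auto
  then show False using assms(2) by simp
qed

text \<open>
  A set of full measure contains points arbitrarily close to \<open>y\<close> on the right.
\<close>
lemma right_continuous_eq_of_AE:
  fixes F G :: "real \<Rightarrow> real"
  assumes ae: "AE y in lborel. y > 1 \<longrightarrow> F y = G y"
    and F: "continuous (at_right y) F" and G: "continuous (at_right y) G" and y: "y > 1"
  shows "F y = G y"
proof -
  have "\<exists>z. y < z \<and> z < y + 1 / real (Suc n) \<and> F z = G z" for n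
    using AE_lborel_interval_witness[OF ae, of y "y + 1 / real (Suc n)"] y by force
  then obtain z where z: "\<And>n. y < z n" "\<And>n. z n < y + 1 / real (Suc n)" "\<And>n. F (z n) = G (z n)"
    by metis
  have "z \<longlonglongrightarrow> y"
  proof (rule tendsto_sandwich)
    show "\<forall>\<^sub>F n in sequentially. y \<le> z n" by (intro always_eventually allI less_imp_le z)
    show "\<forall>\<^sub>F n in sequentially. z n \<le> y + 1 / real (Suc n)" by (intro always_eventually allI less_imp_le z)
    show "(\<lambda>n. y + 1 / real (Suc n)) \<longlonglongrightarrow> y" by real_asymp
  qed simp
  then have lim: "filterlim z (at_right y) sequentially"
    using z(1) by (auto simp: filterlim_at intro!: always_eventually less_imp_neq[symmetric])
  have "(\<lambda>n. F (z n)) \<longlonglongrightarrow> F y" "(\<lambda>n. G (z n)) \<longlonglongrightarrow> G y"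
    using F G lim unfolding continuous_within by (auto intro: filterlim_compose)
  then show ?thesis unfolding z(3) by (rule LIMSEQ_unique)
qed

text \<open>
  The Laplace transform determines \<open>F\<close>: adding a constant \<open>K\<close> makes the density
  \<open>(K + F y) * exp (- y)\<close> on \<open>y > 1\<close> positive, and the substitution \<open>x = exp (- y)\<close> carries it to a
  measure on the unit interval whose moments are values of the transform at positive integers.
\<close>
lemma small_limit_unique:
  assumes F: "small_limit F" and G: "small_limit G" and y: "y > 1"
  shows "F y = G y"
proof -
  obtain B where B: "\<And>x. \<bar>F x\<bar> \<le> B" using F by (auto simp: small_limit_def bounded_iff)
  obtain D where D: "\<And>x. \<bar>G x\<bar> \<le> D" using G by (auto simp: small_limit_def bounded_iff)
  \<comment> \<open>the summand 1 keeps the total mass \<open>T\<close> below strictly positive\<close>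
  define K where "K = B + D + 1"
  have K: "1 \<le> K + F x" "1 \<le> K + G x" for x
    using B[of x] D[of x] by (auto simp: K_def)
  define c :: "(real \<Rightarrow> real) \<Rightarrow> real \<Rightarrow> real \<Rightarrow> real" where
    "c H s x = indicator {1<..} x * ((K + H x) * exp (- (s * x)))" for H s x
  have e: "integrable lborel (\<lambda>x::real. indicator {1<..} x * (1 / sqrt x * exp (- (s * x))))"
    and e': "integrable lborel (\<lambda>x::real. indicator {1<..} x * exp (- (s * x)))" if s: "s > 0" for s
  proof -
    show "integrable lborel (\<lambda>x::real. indicator {1<..} x * (1 / sqrt x * exp (- (s * x))))"
      by (rule Bochner_Integration.integrable_bound[OF integral_inverse_sqrt_exp(1)[OF s]])
        (auto simp: indicator_def)
    have "integrable lborel (\<lambda>x. indicator {1..} x * exp (- (s * x)))"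
    proof (rule integral_of_nn_integral(1))
      have "(\<integral>\<^sup>+x. ennreal (indicator {1..} x * exp (- (s * x))) \<partial>lborel) =
          (\<integral>\<^sup>+x. ennreal (exp (- (s * x))) * indicator {1..} x \<partial>lborel)"
        by (intro nn_integral_cong) (auto simp: indicator_def)
      then show "(\<integral>\<^sup>+x. ennreal (indicator {1..} x * exp (- (s * x))) \<partial>lborel) = ennreal (exp (- (s * 1)) / s)"
        using nn_integral_exp_neg[OF s, of 1] by simp
    qed (use s in \<open>auto simp: indicator_def\<close>)
    then show "integrable lborel (\<lambda>x::real. indicator {1<..} x * exp (- (s * x)))"
      by (rule Bochner_Integration.integrable_bound) (auto simp: indicator_def)
  qed
  have c: "integrable lborel (c H s)"
    "(LBINT x. c H s x) = limit_laplace s - mat_const * (LBINT x. indicator {1<..} x * (1 / sqrt x * exp (- (s * x))))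
       + K * (LBINT x. indicator {1<..} x * exp (- (s * x)))"
    if H: "small_limit H" and s: "s > 0" for H s
  proof -
    let ?h = "\<lambda>y. indicator {1<..} y * ((mat_const / sqrt y + H y) * exp (- (s * y)))"
    have h: "integrable lborel ?h" "(LBINT y. ?h y) = limit_laplace s"
      using H s unfolding small_limit_def by auto
    have eq: "c H s = (\<lambda>x. ?h x - mat_const * (indicator {1<..} x * (1 / sqrt x * exp (- (s * x))))
        + K * (indicator {1<..} x * exp (- (s * x))))"
      by (auto simp: c_def fun_eq_iff algebra_simps)
    show "integrable lborel (c H s)"
      unfolding eq by (intro Bochner_Integration.integrable_add Bochner_Integration.integrable_diff
          integrable_mult_right h e e' s)
    have "(LBINT x. c H s x) = (LBINT y. ?h y) -
        (LBINT x. mat_const * (indicator {1<..} x * (1 / sqrt x * exp (- (s * x))))) +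
        (LBINT x. K * (indicator {1<..} x * exp (- (s * x))))"
      unfolding eq by (subst Bochner_Integration.integral_add Bochner_Integration.integral_diff;
        (intro Bochner_Integration.integrable_diff integrable_mult_right h e e' s)?)+ simp
    then show "(LBINT x. c H s x) = limit_laplace s - mat_const * (LBINT x. indicator {1<..} x * (1 / sqrt x * exp (- (s * x))))
       + K * (LBINT x. indicator {1<..} x * exp (- (s * x)))"
      unfolding h(2) integral_mult_right_zero .
  qed
  define T where "T = (LBINT x. c F 1 x)"
  have TG: "T = (LBINT x. c G 1 x)" unfolding T_def using c(2)[OF F, of 1] c(2)[OF G, of 1] by simp
  have cn: "c F s x \<ge> 0" "c G s x \<ge> 0" for s x
    using K[of x] by (auto simp: c_def indicator_def)
  have Tpos: "T > 0"
  proof -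
    have "(LBINT x. indicator {1<..} x * exp (- (1 * x))) \<le> T"
      unfolding T_def using K by (intro integral_mono e' c(1) F) (auto simp: c_def indicator_def)
    moreover have "(LBINT x::real. indicator {1<..} x * exp (- (1 * x))) > 0"
    proof -
      have "(LBINT x::real. indicator {1<..} x * exp (- (1 * x))) \<ge> (LBINT x::real. exp (- 2 :: real) * indicator {1<..2} x)"
      proof (rule integral_mono)
        show "integrable lborel (\<lambda>x::real. exp (- 2 :: real) * indicator {1<..2} x)"
          by (rule integrable_mult_right, rule integrable_real_indicator) auto
        show "integrable lborel (\<lambda>x::real. indicator {1<..} x * exp (- (1 * x)))" by (rule e') simp
        show "exp (- 2 :: real) * indicator {1<..2} x \<le> indicator {1<..} x * exp (- (1 * x))" for x :: real
          by (auto simp: indicator_def)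
      qed
      moreover have "(LBINT x::real. exp (- 2 :: real) * indicator {1<..2} x) > 0" by simp
      ultimately show ?thesis by linarith
    qed
    ultimately show ?thesis by linarith
  qed
  define d where "d H x = ennreal (c H 1 x / T)" for H x
  define M where "M H = distr (density lborel (d H)) borel (\<lambda>x. exp (- x))" for H
  have Fm [measurable]: "F \<in> borel_measurable borel" "G \<in> borel_measurable borel"
    using F G by (auto simp: small_limit_def intro: borel_measurable_mono)
  have dm: "d H \<in> borel_measurable borel" if "H \<in> borel_measurable borel" for H
    using that unfolding d_def c_def by measurable
  have M: "real_distribution (M H)" "AE x in M H. x \<in> {0..1}"
      "(LINT x|M H. x ^ k) = (LBINT x. c H (real k + 1) x) / T" "distr (M H) borel (\<lambda>x. - ln x) = density lborel (d H)"
    if H: "small_limit H" and Hm [measurable]: "H \<in> borel_measurable borel"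
      and Hn: "\<And>s x. c H s x \<ge> 0" and HT: "(LBINT x. c H 1 x) = T" for H k
  proof -
    have [measurable]: "d H \<in> borel_measurable borel" by (rule dm[OF Hm])
    have "emeasure (density lborel (d H)) UNIV = (\<integral>\<^sup>+x. d H x \<partial>lborel)"
      by (subst emeasure_density) auto
    also have "\<dots> = ennreal (LBINT x. c H 1 x / T)"
      unfolding d_def using Hn Tpos c(1)[OF H, of 1] by (intro nn_integral_eq_integral) auto
    also have "\<dots> = 1" using HT Tpos by simp
    finally have p: "prob_space (density lborel (d H))" by (intro prob_spaceI) simp
    then interpret prob_space "density lborel (d H)" .
    show "real_distribution (M H)"
      unfolding M_def by (intro real_distribution_distr) simp
    show "AE x in M H. x \<in> {0..1}"
      unfolding M_def by (subst AE_distr_iff) (auto simp: AE_density d_def c_def indicator_def)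
    have "(LINT x|M H. x ^ k) = (LINT x|density lborel (d H). exp (- x) ^ k)"
      unfolding M_def by (subst integral_distr) auto
    also have "\<dots> = (LBINT x. (c H 1 x / T) *\<^sub>R exp (- x) ^ k)"
      unfolding d_def
    proof (rule integral_density)
      show "(\<lambda>x. c H 1 x / T) \<in> borel_measurable lborel" unfolding c_def by measurable
      show "AE x in lborel. 0 \<le> c H 1 x / T" using Hn[of 1] Tpos by (intro AE_I2) simp
    qed measurable
    also have "\<dots> = (LBINT x. c H (real k + 1) x / T)"
    proof (intro Bochner_Integration.integral_cong refl)
      fix x :: real
      have "exp (- x) ^ k * exp (- (1 * x)) = exp (- ((real k + 1) * x))"
        unfolding exp_of_nat_mult[symmetric] exp_add[symmetric] by (simp add: algebra_simps)
      then show "(c H 1 x / T) *\<^sub>R exp (- x) ^ k = c H (real k + 1) x / T"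
        unfolding c_def by (simp add: mult_ac)
    qed
    finally show "(LINT x|M H. x ^ k) = (LBINT x. c H (real k + 1) x) / T" by simp
    have "distr (M H) borel (\<lambda>x. - ln x) = distr (density lborel (d H)) borel (\<lambda>x. x)"
      unfolding M_def by (subst distr_distr) (auto simp: comp_def)
    then show "distr (M H) borel (\<lambda>x. - ln x) = density lborel (d H)"
      by (simp add: distr_id2)
  qed
  note MF = M[OF F Fm(1) cn(1) T_def[symmetric]] and MG = M[OF G Fm(2) cn(2) TG[symmetric]]
  have "M F = M G"
  proof (rule moments_determine_distribution[OF MF(1) MG(1) MF(2) MG(2)])
    fix k show "(LINT x|M F. x ^ k) = (LINT x|M G. x ^ k)"
      unfolding MF(3) MG(3) by (subst c(2)[OF F], simp, subst c(2)[OF G]) auto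
  qed
  then have "density lborel (d F) = density lborel (d G)" using MF(4) MG(4) by simp
  then have "AE x in lborel. d F x = d G x"
    using dm[OF Fm(1)] dm[OF Fm(2)] by (intro sigma_finite_measure.density_unique[OF sigma_finite_lborel]) auto
  then have "AE x in lborel. x > 1 \<longrightarrow> F x = G x"
  proof eventually_elim
    case (elim x)
    then have "c F 1 x / T = c G 1 x / T" using cn Tpos by (simp add: d_def)
    then show ?case using Tpos by (auto simp: c_def)
  qed
  then show ?thesis
    using F G y by (intro right_continuous_eq_of_AE[of F G]) (auto simp: small_limit_def)
qed

text \<open>
  Every subsequence of \<open>neg_small\<close> has a further subsequence that converges to some
  \<open>small_limit\<close>, and all these limits coincide beyond 1. The additional positivity, which holds
  because \<open>scaled_small \<le> scaled_all\<close>, allows the use of nonnegative integrals later.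
\<close>
lemma scaled_small_tendsto:
  "\<exists>F. small_limit F \<and> (AE y in lborel. y > 1 \<longrightarrow> 0 \<le> mat_const / sqrt y + F y) \<and>
    (\<forall>y>1. isCont F y \<longrightarrow> (\<lambda>r. scaled_small r y) \<longlonglongrightarrow> - F y)"
proof -
  obtain K where K: "\<And>r y. \<bar>neg_small r y\<bar> \<le> K" by (rule neg_small_bounded) blast
  have helly: "\<exists>u F. strict_mono (u :: nat \<Rightarrow> nat) \<and> small_limit F \<and>
      (\<forall>x. isCont F x \<longrightarrow> (\<lambda>n. neg_small (t (u n)) x) \<longlonglongrightarrow> F x)"
    if t: "strict_mono t" for t :: "nat \<Rightarrow> nat"
  proof -
    obtain u F where u: "strict_mono (u :: nat \<Rightarrow> nat)" "\<forall>x. continuous (at_right x) F" "mono F" "\<forall>x. \<bar>F x\<bar> \<le> K"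
      "\<forall>x. continuous (at x) F \<longrightarrow> (\<lambda>n. neg_small (t (u n)) x) \<longlonglongrightarrow> F x"
      using Helly_selection[of "\<lambda>n. neg_small (t n)" K] neg_small_mono neg_small_right_continuous K by blast
    have "small_limit F"
      using u t by (intro small_limit_of_subsequence[of "t \<circ> u" F K]) (auto intro: strict_mono_o)
    then show ?thesis using u by blast
  qed
  obtain u F where F: "small_limit F" using helly[of id] by (auto simp: strict_mono_def)
  have lim: "(\<lambda>r. scaled_small r y) \<longlonglongrightarrow> - F y" if y: "y > 1" "isCont F y" for y
  proof (rule ccontr)
    assume neg: "\<not> ?thesis"
    then obtain e where e: "e > 0" "\<not> (\<forall>\<^sub>F r in sequentially. dist (scaled_small r y) (- F y) < e)"
      by (auto simp: tendsto_iff)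
    have "infinite {r. \<not> dist (scaled_small r y) (- F y) < e}"
      using e(2) by (simp add: cofinite_eq_sequentially[symmetric] eventually_cofinite)
    from infinite_enumerate[OF this] obtain t :: "nat \<Rightarrow> nat"
      where t: "strict_mono t" and "\<forall>n. t n \<in> {r. \<not> dist (scaled_small r y) (- F y) < e}" by auto
    then have t2: "\<not> dist (scaled_small (t n) y) (- F y) < e" for n by simp
    obtain u G where u: "strict_mono u" "small_limit G"
      "\<And>x. isCont G x \<Longrightarrow> (\<lambda>n. neg_small (t (u n)) x) \<longlonglongrightarrow> G x"
      using helly[OF t] by blast
    have eq: "G x = F x" if "x > 1" for x using small_limit_unique[OF u(2) F that] .
    have "isCont G y"
    proof -
      have "\<forall>\<^sub>F x in nhds y. x \<in> {1<..}" using y by (intro eventually_nhds_in_open) auto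
      then have "\<forall>\<^sub>F x in nhds y. G x = F x" by eventually_elim (use eq in auto)
      then show ?thesis using y(2) by (subst isCont_cong)
    qed
    then have "(\<lambda>n. - neg_small (t (u n)) y) \<longlonglongrightarrow> - F y" using u(3)[of y] eq[OF y(1)] by (intro tendsto_minus) simp
    then have "(\<lambda>n. scaled_small (t (u n)) y) \<longlonglongrightarrow> - F y" using y(1) by (simp add: neg_small_def max_def)
    then have "\<forall>\<^sub>F n in sequentially. dist (scaled_small (t (u n)) y) (- F y) < e" using e(1) by (simp add: tendsto_iff)
    then obtain n where "dist (scaled_small (t (u n)) y) (- F y) < e"
      unfolding eventually_sequentially by blast
    then show False using t2[of "u n"] by simp
  qed
  have "mono F" using F by (simp add: small_limit_def)
  from AE_isCont_mono[OF this] have "AE y in lborel. y > 1 \<longrightarrow> 0 \<le> mat_const / sqrt y + F y"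
  proof eventually_elim
    case (elim y)
    have "- F y \<le> mat_const / sqrt y" if "y > 1"
      using that scaled_nonneg(2)
      by (intro LIMSEQ_le[OF lim[OF that elim] scaled_all_tendsto[OF mat_density_asymptotics]]) auto
    then show ?case by force
  qed
  then show ?thesis using F lim by (intro exI[of _ F]) simp
qed

text \<open>
  Convergence at a fixed \<open>y\<close> is transferred to arguments that only tend to \<open>y\<close> by squeezing
  between nearby continuity points; these exist because a monotone function has at most countably
  many discontinuities.
\<close>
lemma small_density_tendsto:
  assumes F: "mono F" and lim: "\<And>y. y > 1 \<Longrightarrow> isCont F y \<Longrightarrow> (\<lambda>r. scaled_small r y) \<longlonglongrightarrow> - F y"
    and y: "y > 1" "isCont F y" and r: "filterlim r at_top sequentially"
    and ratio: "(\<lambda>n. real n / real (r n)) \<longlonglongrightarrow> y"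
  shows "(\<lambda>n. sqrt (real (r n)) * small_density (r n) n) \<longlonglongrightarrow> - F y"
proof -
  have sand: "\<exists>x. l < x \<and> x < u \<and> isCont F x" if "l < u" for l u
    using real_interval_avoid_countable_set[OF that mono_ctble_discont[OF F]] by auto
  have le: "scaled_small m v \<le> sqrt (real m) * small_density m n" if "real n / real m \<le> v" "m > 0" for m n v
  proof -
    have "real n \<le> real m * v" using that by (simp add: field_simps)
    then have "n \<le> nat \<lfloor>real m * v\<rfloor>" by linarith
    then show ?thesis using that unfolding scaled_small_def by (intro mult_left_mono small_density_antimono) auto
  qed
  have ge: "sqrt (real m) * small_density m n \<le> scaled_small m v" if "v \<le> real n / real m" "m > 0" for m n v
  proof -
    have "real m * v \<le> real n" using that by (simp add: field_simps)
    then have "nat \<lfloor>real m * v\<rfloor> \<le> n" by linarith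
    then show ?thesis using that unfolding scaled_small_def by (intro mult_left_mono small_density_antimono) auto
  qed
  have pos: "\<forall>\<^sub>F n in sequentially. 0 < r n"
    using filterlim_at_top[THEN iffD1, OF r, rule_format, of 1] by eventually_elim simp
  show ?thesis
  proof (rule order_tendstoI)
    fix a assume a: "a < - F y"
    have "\<forall>\<^sub>F x in at_right y. F x < - a"
      using y(2) a by (intro order_tendstoD[of F "F y"]) (auto simp: isCont_def filterlim_at_split)
    then obtain b where b: "b > y" "\<And>x. y < x \<Longrightarrow> x < b \<Longrightarrow> F x < - a"
      unfolding eventually_at_right_field by auto
    obtain v where v: "y < v" "v < b" "isCont F v" using sand[OF b(1)] by blast
    have "\<forall>\<^sub>F m in sequentially. a < scaled_small m v"
      using lim[of v] v y b(2)[of v] by (intro order_tendstoD(1)[of _ "- F v"]) auto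
    then have "\<forall>\<^sub>F n in sequentially. a < scaled_small (r n) v" using r by (rule eventually_compose_filterlim)
    moreover have "\<forall>\<^sub>F n in sequentially. real n / real (r n) < v" using order_tendstoD(2)[OF ratio v(1)] .
    ultimately show "\<forall>\<^sub>F n in sequentially. a < sqrt (real (r n)) * small_density (r n) n"
      using pos by eventually_elim (use le in \<open>meson less_imp_le less_le_trans\<close>)
  next
    fix a assume a: "- F y < a"
    have "\<forall>\<^sub>F x in at_left y. - a < F x"
      using y(2) a by (intro order_tendstoD[of F "F y"]) (auto simp: isCont_def filterlim_at_split)
    then obtain b where b: "b < y" "\<And>x. b < x \<Longrightarrow> x < y \<Longrightarrow> - a < F x"
      unfolding eventually_at_left_field by auto
    obtain v where v: "max b 1 < v" "v < y" "isCont F v" using sand[of "max b 1" y] b(1) y(1) by auto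
    have "\<forall>\<^sub>F m in sequentially. scaled_small m v < a"
      using lim[of v] v y b(2)[of v] by (intro order_tendstoD(2)[of _ "- F v"]) auto
    then have "\<forall>\<^sub>F n in sequentially. scaled_small (r n) v < a" using r by (rule eventually_compose_filterlim)
    moreover have "\<forall>\<^sub>F n in sequentially. v < real n / real (r n)" using order_tendstoD(1)[OF ratio v(2)] .
    ultimately show "\<forall>\<^sub>F n in sequentially. sqrt (real (r n)) * small_density (r n) n < a"
      using pos by eventually_elim (use ge in \<open>meson less_imp_le le_less_trans\<close>)
  qed
qed

section \<open>The limiting moments\<close>

lemma exp_integral_continuous: "continuous_on {0<..} exp_integral"
  by (intro continuous_at_imp_continuous_on ballI DERIV_isCont[OF exp_integral_deriv]) simp

text \<open>
  The function \<open>exp (- exp_integral s / 2)\<close> increases from 0 to 1 on the positive axis. Apart from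
  elementary factors, \<open>limit_laplace\<close> is its complement, and the integrand of \<open>limit_moment\<close> is its
  density.
\<close>
definition survival :: "real \<Rightarrow> real" where
  "survival s = 1 - exp (- (exp_integral s / 2))"

definition survival_density :: "real \<Rightarrow> real" where
  "survival_density u = indicator {0<..} u * (exp (- (exp_integral u / 2)) * (exp (- u) / u) / 2)"

lemma survival_density_nonneg: "0 \<le> survival_density u"
  by (auto simp: survival_density_def indicator_def)

lemma survival_density_measurable [measurable]: "survival_density \<in> borel_measurable borel"
proof -
  have "(\<lambda>u. indicator {0<..} u *\<^sub>R (exp (- (exp_integral u / 2)) * (exp (- u) / u) / 2)) \<in> borel_measurable borel"
    by (intro borel_measurable_continuous_on_indicator continuous_intros exp_integral_continuous) auto
  then show ?thesis by (simp add: survival_density_def[abs_def])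
qed

lemma survival_measurable: "(\<lambda>s. indicator {0<..} s * survival s) \<in> borel_measurable borel"
proof -
  have "(\<lambda>s. indicator {0<..} s *\<^sub>R survival s) \<in> borel_measurable borel"
    unfolding survival_def
    by (intro borel_measurable_continuous_on_indicator continuous_intros exp_integral_continuous) auto
  then show ?thesis by simp
qed

lemma survival_nonneg: "s > 0 \<Longrightarrow> 0 \<le> survival s"
  using exp_integral_bounds(1)[of s] by (simp add: survival_def)

lemma survival_eq_nn_integral:
  assumes s: "s > 0"
  shows "(\<integral>\<^sup>+u. ennreal (survival_density u) * indicator {s..} u \<partial>lborel) = ennreal (survival s)"
proof -
  have "((\<lambda>u. exp (- (exp_integral u / 2))) \<longlongrightarrow> exp (- (0 / 2))) at_top"
    by (intro tendsto_intros exp_integral_at_top) simp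
  then have lim: "((\<lambda>u. exp (- (exp_integral u / 2))) \<longlongrightarrow> 1) at_top" by simp
  have "(\<integral>\<^sup>+u. ennreal (survival_density u) * indicator {s..} u \<partial>lborel) =
      ennreal (1 - exp (- (exp_integral s / 2)))"
  proof (rule nn_integral_FTC_atLeast[OF survival_density_measurable _ survival_density_nonneg lim])
    fix x assume "s \<le> x"
    then have x: "x > 0" using s by simp
    show "((\<lambda>u. exp (- (exp_integral u / 2))) has_real_derivative survival_density x) (at x)"
      using x by (auto intro!: derivative_eq_intros exp_integral_deriv simp: survival_density_def)
  qed
  then show ?thesis by (simp add: survival_def)
qed

lemma nn_integral_power_Icc:
  assumes "u \<ge> 0" "m \<ge> 1"
  shows "(\<integral>\<^sup>+s. ennreal (real m * s ^ (m - 1)) * indicator {0..u} s \<partial>lborel) = ennreal (u ^ m)"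
proof -
  have "(\<integral>\<^sup>+s. ennreal (real m * s ^ (m - 1)) * indicator {0..u} s \<partial>lborel) = ennreal (u ^ m - 0 ^ m)"
    by (rule nn_integral_FTC_Icc) (use assms in \<open>auto intro!: derivative_eq_intros\<close>)
  then show ?thesis using assms by simp
qed

text \<open>
  Integration by parts, carried out as an exchange of integrals so that no boundary terms arise.
\<close>
lemma nn_integral_survival_moment:
  assumes m: "m \<ge> 1"
  shows "(\<integral>\<^sup>+s. ennreal (indicator {0<..} s * (real m * s ^ (m - 1) * survival s)) \<partial>lborel) =
    (\<integral>\<^sup>+u. ennreal (u ^ m * survival_density u) \<partial>lborel)"
proof -
  let ?k = "\<lambda>s u. ennreal (indicator {0<..} s * (real m * s ^ (m - 1))) *
      (ennreal (survival_density u) * indicator {s..} u)"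
  let ?k' = "\<lambda>s u. if 0 < s \<and> s \<le> u then ennreal (real m * s ^ (m - 1)) * ennreal (survival_density u) else 0"
  have kk: "?k s u = ?k' s u" for s u by (auto simp: indicator_def)
  have "(\<integral>\<^sup>+s. ennreal (indicator {0<..} s * (real m * s ^ (m - 1) * survival s)) \<partial>lborel) =
      (\<integral>\<^sup>+s. (\<integral>\<^sup>+u. ?k s u \<partial>lborel) \<partial>lborel)"
  proof (intro nn_integral_cong)
    fix s :: real
    have "(\<integral>\<^sup>+u. ?k s u \<partial>lborel) = ennreal (indicator {0<..} s * (real m * s ^ (m - 1))) *
        (\<integral>\<^sup>+u. ennreal (survival_density u) * indicator {s..} u \<partial>lborel)"
      by (rule nn_integral_cmult) measurable
    then show "ennreal (indicator {0<..} s * (real m * s ^ (m - 1) * survival s)) = (\<integral>\<^sup>+u. ?k s u \<partial>lborel)"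
      using survival_eq_nn_integral[of s] survival_nonneg[of s]
      by (cases "s > 0") (auto simp: ennreal_mult[symmetric])
  qed
  also have "\<dots> = (\<integral>\<^sup>+u. (\<integral>\<^sup>+s. ?k s u \<partial>lborel) \<partial>lborel)"
    unfolding kk by (rule lborel_pair.Fubini') measurable
  also have "\<dots> = (\<integral>\<^sup>+u. ennreal (u ^ m * survival_density u) \<partial>lborel)"
  proof (intro nn_integral_cong)
    fix u :: real
    show "(\<integral>\<^sup>+s. ?k s u \<partial>lborel) = ennreal (u ^ m * survival_density u)"
    proof (cases "u > 0")
      case True
      have "(\<integral>\<^sup>+s. ?k s u \<partial>lborel) =
          (\<integral>\<^sup>+s. ennreal (survival_density u) * (ennreal (real m * s ^ (m - 1)) * indicator {0..u} s) \<partial>lborel)"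
        by (rule nn_integral_cong_AE, rule AE_mp[OF AE_lborel_singleton[of 0]], rule AE_I2)
          (auto simp: indicator_def mult.commute)
      also have "\<dots> = ennreal (survival_density u) * ennreal (u ^ m)"
        using nn_integral_power_Icc[of u m] True m by (subst nn_integral_cmult) auto
      finally show ?thesis using True survival_density_nonneg[of u] by (simp add: ennreal_mult[symmetric] mult.commute)
    next
      case False
      then have "survival_density u = 0" by (simp add: survival_density_def)
      then show ?thesis by simp
    qed
  qed
  finally show ?thesis .
qed

text \<open>
  The upper bound results from dropping \<open>exp (- exp_integral u / 2) \<le> 1\<close>, which leaves a Gamma
  integral.
\<close>
lemma limit_moment_nn_integral:
  assumes m: "m \<ge> 1"
  shows "(\<integral>\<^sup>+u. ennreal (u ^ m * survival_density u) \<partial>lborel) = ennreal (limit_moment m * Gamma (real m + 1/2) / sqrt pi)"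
    and "0 \<le> limit_moment m" "limit_moment m \<le> sqrt pi * Gamma (real m) / (2 * Gamma (real m + 1/2))"
proof -
  let ?f = "\<lambda>u. indicator {0<..} u * (exp (- (1/2) * exp_integral u - u) * u ^ (m - 1))"
  have eq: "u ^ m * survival_density u = ?f u / 2" for u
  proof -
    have e: "exp (- (1/2) * exp_integral u - u) = exp (- (exp_integral u / 2)) * exp (- u)"
      by (simp flip: exp_add)
    obtain k where "m = Suc k" using m by (cases m) auto
    then show ?thesis unfolding e by (auto simp: survival_density_def indicator_def)
  qed
  have fm: "?f \<in> borel_measurable borel"
  proof -
    have "?f = (\<lambda>u. 2 * (u ^ m * survival_density u))" unfolding eq by (simp add: fun_eq_iff)
    then show ?thesis by simp
  qed
  have fn: "0 \<le> ?f u" for u by (auto simp: indicator_def)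
  have le: "?f u \<le> indicator {0<..} u * (u powr (real m - 1) * exp (- (1 * u)))" for u
  proof (cases "u > 0")
    case True
    have "exp (- (1/2) * exp_integral u - u) \<le> exp (- (1 * u))"
      using exp_integral_bounds(1)[OF True] by simp
    moreover have "u powr (real m - 1) = u ^ (m - 1)"
      using True m by (simp add: powr_realpow[symmetric] of_nat_diff)
    ultimately show ?thesis using True by (simp add: mult.commute mult_left_mono)
  qed simp
  have G: "(\<integral>\<^sup>+u. ennreal (indicator {0<..} u * (u powr (real m - 1) * exp (- (1 * u)))) \<partial>lborel) = ennreal (Gamma (real m))"
  proof -
    have "(\<integral>\<^sup>+u. ennreal (indicator {0<..} u * (u powr (real m - 1) * exp (- (1 * u)))) \<partial>lborel) =
        (\<integral>\<^sup>+t. ennreal (t powr (real m - 1) * exp (- (1 * t))) * indicator {0<..} t \<partial>lborel)"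
      by (intro nn_integral_cong) (auto simp: indicator_def)
    then show ?thesis using nn_integral_Gamma[of "real m" 1] m by simp
  qed
  have Gpos: "Gamma (real m) > 0" "Gamma (real m + 1/2) > 0" using m by (auto intro!: Gamma_real_pos)
  have Gi: "integrable lborel (\<lambda>u. indicator {0<..} u * (u powr (real m - 1) * exp (- (1 * u))))"
    "(LBINT u. indicator {0<..} u * (u powr (real m - 1) * exp (- (1 * u)))) = Gamma (real m)"
    by (rule integral_of_nn_integral[OF _ _ _ G]; use Gpos in \<open>auto simp: indicator_def\<close>)+
  have fi: "integrable lborel ?f"
    by (rule Bochner_Integration.integrable_bound[OF Gi(1)]) (use fm fn le in \<open>auto intro!: AE_I2 order_trans[OF le abs_ge_self]\<close>)
  define I where "I = (LBINT u. ?f u)"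
  have I: "(LBINT u:{0<..}. exp (- (1/2) * exp_integral u - u) * u ^ (m - 1)) = I"
    by (simp add: I_def set_lebesgue_integral_def)
  have Ile: "I \<le> Gamma (real m)" unfolding I_def Gi(2)[symmetric] by (rule integral_mono[OF fi Gi(1) le])
  have I0: "0 \<le> I" unfolding I_def by (rule integral_nonneg_AE) (use fn in auto)
  have lm: "limit_moment m = sqrt pi / (2 * Gamma (real m + 1/2)) * I" unfolding limit_moment_def I ..
  have "(\<integral>\<^sup>+u. ennreal (u ^ m * survival_density u) \<partial>lborel) = ennreal (LBINT u. ?f u / 2)"
    unfolding eq using fi fn by (intro nn_integral_eq_integral) auto
  also have "(LBINT u. ?f u / 2) = limit_moment m * Gamma (real m + 1/2) / sqrt pi"
  proof -
    have "(LBINT u. ?f u / 2) = I / 2" unfolding I_def by (rule integral_divide_zero)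
    moreover have "sqrt pi / (2 * G) * J * G / sqrt pi = J / 2" if "G > 0" for G J :: real using that by simp
    ultimately show ?thesis unfolding lm using Gpos(2) by presburger
  qed
  finally show "(\<integral>\<^sup>+u. ennreal (u ^ m * survival_density u) \<partial>lborel) = ennreal (limit_moment m * Gamma (real m + 1/2) / sqrt pi)" .
  show "0 \<le> limit_moment m" unfolding lm using I0 Gpos by simp
  show "limit_moment m \<le> sqrt pi * Gamma (real m) / (2 * Gamma (real m + 1/2))"
    unfolding lm using mult_left_mono[OF Ile, of "sqrt pi / (2 * Gamma (real m + 1/2))"] Gpos by simp
qed

text \<open>
  The functional equation multiplies the ratio by \<open>x / (x + 1/2)\<close> at \<open>x = m + 1\<close>, and the square
  of this factor is at most \<open>x / (x + 1)\<close>. So the ratio is at most of order \<open>1 / sqrt m\<close>.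
\<close>
lemma Gamma_ratio_tendsto_0: "(\<lambda>m. Gamma (real (Suc m)) / Gamma (real (Suc m) + 1/2)) \<longlonglongrightarrow> 0"
proof -
  define q where "q m = Gamma (real (Suc m)) / Gamma (real (Suc m) + 1/2)" for m
  have qpos: "q m > 0" for m by (auto simp: q_def intro!: divide_pos_pos Gamma_real_pos)
  have step: "q (Suc m) = q m * (real (Suc m) / (real (Suc m) + 1/2))" for m
  proof -
    have "Gamma (real (Suc m) + 1) = real (Suc m) * Gamma (real (Suc m))" by (rule Gamma_plus1) (auto elim!: nonpos_Ints_cases)
    moreover have "Gamma (real (Suc m) + 1/2 + 1) = (real (Suc m) + 1/2) * Gamma (real (Suc m) + 1/2)"
      by (rule Gamma_plus1) (auto elim!: nonpos_Ints_cases)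
    ultimately show ?thesis by (simp add: q_def add_ac mult_ac)
  qed
  have sq: "(q m)\<^sup>2 \<le> (q 0)\<^sup>2 / real (Suc m)" for m
  proof (induction m)
    case (Suc m)
    define x where "x = real (Suc m)"
    have x: "x > 0" by (simp add: x_def)
    have "(x / (x + 1/2))\<^sup>2 \<le> x / (x + 1)"
    proof -
      have "x\<^sup>2 * (x + 1) \<le> x * (x + 1/2)\<^sup>2" using x by (simp add: power2_eq_square algebra_simps)
      then show ?thesis using x by (simp add: power_divide divide_le_eq le_divide_eq mult.commute field_simps)
    qed
    then have "(q m)\<^sup>2 * (x / (x + 1/2))\<^sup>2 \<le> (q 0)\<^sup>2 / x * (x / (x + 1))"
      using Suc x by (intro mult_mono) (auto simp: x_def)
    moreover have "(q (Suc m))\<^sup>2 = (q m)\<^sup>2 * (x / (x + 1/2))\<^sup>2"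
      unfolding step x_def by (rule power_mult_distrib)
    moreover have "(q 0)\<^sup>2 / x * (x / (x + 1)) = (q 0)\<^sup>2 / real (Suc (Suc m))"
      using x by (simp add: x_def add_ac)
    ultimately show ?case by simp
  qed simp
  have "(\<lambda>m. (q m)\<^sup>2) \<longlonglongrightarrow> 0"
  proof (rule tendsto_sandwich[OF _ _ tendsto_const])
    show "\<forall>\<^sub>F m in sequentially. 0 \<le> (q m)\<^sup>2" by simp
    show "\<forall>\<^sub>F m in sequentially. (q m)\<^sup>2 \<le> (q 0)\<^sup>2 / real (Suc m)" using sq by simp
    show "(\<lambda>m. (q 0)\<^sup>2 / real (Suc m)) \<longlonglongrightarrow> 0" by real_asymp
  qed
  from tendsto_real_sqrt[OF this] have "q \<longlonglongrightarrow> 0"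
    using qpos by (simp add: less_imp_le)
  then show ?thesis unfolding q_def .
qed

lemma limit_moment_tendsto_0: "(\<lambda>m. limit_moment (Suc m)) \<longlonglongrightarrow> 0"
proof (rule tendsto_sandwich[OF _ _ tendsto_const])
  show "\<forall>\<^sub>F m in sequentially. 0 \<le> limit_moment (Suc m)" using limit_moment_nn_integral(2) by simp
  show "\<forall>\<^sub>F m in sequentially. limit_moment (Suc m) \<le>
      sqrt pi / 2 * (Gamma (real (Suc m)) / Gamma (real (Suc m) + 1/2))"
    using limit_moment_nn_integral(3)[of "Suc _"] by (intro always_eventually allI) (simp add: field_simps)
  show "(\<lambda>m. sqrt pi / 2 * (Gamma (real (Suc m)) / Gamma (real (Suc m) + 1/2))) \<longlonglongrightarrow> 0"
    using tendsto_mult_right_zero[OF Gamma_ratio_tendsto_0] by blast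
qed

text \<open>
  Only the Laplace transform of \<open>mat_const / sqrt y + F y\<close> is known, but that is enough: up to the
  factor \<open>Gamma (m + 1/2)\<close>, the power \<open>y powr (- (m + 1/2))\<close> is a mixture of exponentials
  \<open>exp (- s * y)\<close>, and exchanging the integrals turns the transform into a moment of \<open>survival\<close>.
\<close>
lemma nn_integral_limit_profile:
  assumes F: "small_limit F" and nn: "AE y in lborel. y > 1 \<longrightarrow> 0 \<le> mat_const / sqrt y + F y"
    and m: "m \<ge> 1"
  shows "(\<integral>\<^sup>+y. ennreal (indicator {1<..} y * (y powr (- (real m + 1/2)) * (mat_const / sqrt y + F y))) \<partial>lborel) =
    ennreal (mat_const * limit_moment m / real m)"
proof -
  have Fm [measurable]: "F \<in> borel_measurable borel"
    using F by (auto simp: small_limit_def intro: borel_measurable_mono)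
  \<comment> \<open>truncation at 0 changes the integrand on a null set only\<close>
  define G where "G y = indicator {1<..} y * max 0 (mat_const / sqrt y + F y)" for y
  have Gm [measurable]: "G \<in> borel_measurable borel" unfolding G_def[abs_def] by measurable
  have G0: "0 \<le> G y" for y by (auto simp: G_def)
  have GF: "AE y in lborel. G y = indicator {1<..} y * (mat_const / sqrt y + F y)"
    using nn by eventually_elim (auto simp: G_def indicator_def)
  have Gamma_pos: "Gamma (real m + 1/2) > 0" using m by (intro Gamma_real_pos) simp
  have lap: "(\<integral>\<^sup>+y. ennreal (G y * exp (- (s * y))) \<partial>lborel) = ennreal (limit_laplace s)" if s: "s > 0" for s
  proof -
    let ?h = "\<lambda>y. indicator {1<..} y * ((mat_const / sqrt y + F y) * exp (- (s * y)))"
    have h: "integrable lborel ?h" "(LBINT y. ?h y) = limit_laplace s"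
      using F s unfolding small_limit_def by auto
    have "(\<integral>\<^sup>+y. ennreal (G y * exp (- (s * y))) \<partial>lborel) = (\<integral>\<^sup>+y. ennreal (?h y) \<partial>lborel)"
      by (rule nn_integral_cong_AE, use GF in eventually_elim) (simp add: mult.assoc)
    also have "\<dots> = ennreal (LBINT y. ?h y)"
    proof (rule nn_integral_eq_integral[OF h(1)])
      show "AE y in lborel. 0 \<le> ?h y" using nn by eventually_elim (auto simp: indicator_def)
    qed
    finally show ?thesis unfolding h(2) .
  qed
  let ?w = "\<lambda>s::real. indicator {0<..} s * s powr (real m + 1/2 - 1)"
  have w0: "0 \<le> ?w s" for s by simp
  let ?A = "\<integral>\<^sup>+y. ennreal (indicator {1<..} y * (y powr (- (real m + 1/2)) * (mat_const / sqrt y + F y))) \<partial>lborel"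
  have "ennreal (Gamma (real m + 1/2)) * ?A =
      (\<integral>\<^sup>+y. ennreal (Gamma (real m + 1/2)) * ennreal (y powr (- (real m + 1/2)) * G y) \<partial>lborel)"
  proof -
    have "?A = (\<integral>\<^sup>+y. ennreal (y powr (- (real m + 1/2)) * G y) \<partial>lborel)"
      by (rule nn_integral_cong_AE, use GF in eventually_elim) (simp add: mult_ac)
    then show ?thesis by (subst nn_integral_cmult) auto
  qed
  also have "\<dots> = (\<integral>\<^sup>+y. (\<integral>\<^sup>+s. ennreal (?w s * (G y * exp (- (s * y)))) \<partial>lborel) \<partial>lborel)"
  proof (intro nn_integral_cong)
    fix y :: real
    show "ennreal (Gamma (real m + 1/2)) * ennreal (y powr (- (real m + 1/2)) * G y) =
        (\<integral>\<^sup>+s. ennreal (?w s * (G y * exp (- (s * y)))) \<partial>lborel)"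
    proof (cases "y > 1")
      case True
      have "(\<integral>\<^sup>+s. ennreal (?w s * (G y * exp (- (s * y)))) \<partial>lborel) =
          (\<integral>\<^sup>+s. ennreal (G y) * (ennreal (s powr (real m + 1/2 - 1) * exp (- (y * s))) * indicator {0<..} s) \<partial>lborel)"
        using G0[of y] by (intro nn_integral_cong) (auto simp: indicator_def ennreal_mult[symmetric] mult_ac)
      also have "\<dots> = ennreal (G y) * ennreal (Gamma (real m + 1/2) / y powr (real m + 1/2))"
        using nn_integral_Gamma[of "real m + 1/2" y] True by (subst nn_integral_cmult) auto
      finally have eq: "(\<integral>\<^sup>+s. ennreal (?w s * (G y * exp (- (s * y)))) \<partial>lborel) =
          ennreal (G y) * ennreal (Gamma (real m + 1/2) / y powr (real m + 1/2))" .
      have p: "y powr (- (real m + 1/2)) = 1 / y powr (real m + 1/2)" by (rule powr_minus_divide)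
      show ?thesis
        unfolding eq p using G0[of y] Gamma_pos True by (simp add: ennreal_mult[symmetric] mult_ac)
    qed (simp add: G_def)
  qed
  also have "\<dots> = (\<integral>\<^sup>+s. (\<integral>\<^sup>+y. ennreal (?w s * (G y * exp (- (s * y)))) \<partial>lborel) \<partial>lborel)"
    by (rule lborel_pair.Fubini') measurable
  also have "\<dots> = (\<integral>\<^sup>+s. ennreal (sqrt (exp 1) / real m) *
      ennreal (indicator {0<..} s * (real m * s ^ (m - 1) * survival s)) \<partial>lborel)"
  proof (intro nn_integral_cong)
    fix s :: real
    show "(\<integral>\<^sup>+y. ennreal (?w s * (G y * exp (- (s * y)))) \<partial>lborel) =
        ennreal (sqrt (exp 1) / real m) * ennreal (indicator {0<..} s * (real m * s ^ (m - 1) * survival s))"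
    proof (cases "s > 0")
      case True
      have "(\<integral>\<^sup>+y. ennreal (?w s * (G y * exp (- (s * y)))) \<partial>lborel) =
          (\<integral>\<^sup>+y. ennreal (?w s) * ennreal (G y * exp (- (s * y))) \<partial>lborel)"
        using G0 by (intro nn_integral_cong) (simp add: ennreal_mult[symmetric])
      also have "\<dots> = ennreal (?w s) * ennreal (limit_laplace s)"
        using lap[OF True] by (subst nn_integral_cmult) auto
      also have "\<dots> = ennreal (?w s * limit_laplace s)"
      proof -
        have "0 \<le> limit_laplace s" using True exp_integral_bounds(1)[OF True] by (simp add: limit_laplace_def)
        then show ?thesis by (simp add: ennreal_mult[symmetric])
      qed
      also have "?w s * limit_laplace s = sqrt (exp 1) / real m * (real m * s ^ (m - 1) * survival s)"
      proof -
        have "s powr (real m + 1/2 - 1) = s powr (real (m - 1)) * s powr (1/2)"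
          using m by (simp flip: powr_add add: of_nat_diff)
        also have "\<dots> = s ^ (m - 1) * sqrt s" using True by (simp add: powr_realpow powr_half_sqrt)
        finally have p: "s powr (real m + 1/2 - 1) = s ^ (m - 1) * sqrt s" .
        show ?thesis unfolding p using True m
          by (simp add: limit_laplace_def survival_def real_sqrt_divide)
      qed
      finally show ?thesis using True survival_nonneg[OF True] by (simp add: ennreal_mult[symmetric])
    qed simp
  qed
  also have "\<dots> = ennreal (sqrt (exp 1) / real m) * (\<integral>\<^sup>+s. ennreal (indicator {0<..} s * (real m * s ^ (m - 1) * survival s)) \<partial>lborel)"
  proof (rule nn_integral_cmult)
    have "(\<lambda>s. real m * s ^ (m - 1) * (indicator {0<..} s * survival s)) \<in> borel_measurable borel"
      using survival_measurable by measurable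
    then show "(\<lambda>s. ennreal (indicator {0<..} s * (real m * s ^ (m - 1) * survival s))) \<in> borel_measurable lborel"
      by (simp add: mult_ac)
  qed
  also have "\<dots> = ennreal (sqrt (exp 1) / real m) * ennreal (limit_moment m * Gamma (real m + 1/2) / sqrt pi)"
    unfolding nn_integral_survival_moment[OF m] limit_moment_nn_integral(1)[OF m] ..
  also have "\<dots> = ennreal (Gamma (real m + 1/2)) * ennreal (mat_const * limit_moment m / real m)"
    using limit_moment_nn_integral(2)[OF m] Gamma_pos
    by (simp add: ennreal_mult[symmetric] real_sqrt_divide mult_ac)
  finally have "ennreal (Gamma (real m + 1/2)) * ?A = ennreal (Gamma (real m + 1/2)) * ennreal (mat_const * limit_moment m / real m)" .
  then show ?thesis using Gamma_pos by (simp add: ennreal_mult_cancel_left)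
qed

text \<open>
  For positive \<open>n\<close> and \<open>y\<close>, the largest integer strictly below \<open>n / y\<close>.
\<close>
definition below :: "nat \<Rightarrow> real \<Rightarrow> nat" where
  "below n y = nat (\<lceil>real n / y\<rceil> - 1)"

lemma less_iff_le_below:
  assumes "n > 0" "y > 0" shows "real k < real n / y \<longleftrightarrow> k \<le> below n y"
proof -
  have pos: "real n / y > 0" using assms by simp
  have "real k < real n / y \<longleftrightarrow> int k < \<lceil>real n / y\<rceil>" by (simp add: less_ceiling_iff)
  also have "\<dots> \<longleftrightarrow> k \<le> below n y"
    using pos unfolding below_def by linarith
  finally show ?thesis .
qed

lemma below_tendsto:
  assumes y: "y > 0"
  shows "filterlim (\<lambda>n. below n y) at_top sequentially" "(\<lambda>n. real n / real (below n y)) \<longlonglongrightarrow> y"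
proof -
  have bd: "real n / y - 1 \<le> real (below n y) \<and> real (below n y) \<le> real n / y" for n
  proof -
    have "0 \<le> real n / y" using y by simp
    then show ?thesis unfolding below_def by linarith
  qed
  have "filterlim (\<lambda>n. real n / y - 1) at_top sequentially" using y by real_asymp
  then have "filterlim (\<lambda>n. real (below n y)) at_top sequentially"
    by (rule filterlim_at_top_mono) (use bd in auto)
  then show "filterlim (\<lambda>n. below n y) at_top sequentially"
    by (simp add: filterlim_sequentially_iff_filterlim_real)
  have br: "(\<lambda>n. real (below n y) / real n) \<longlonglongrightarrow> 1 / y"
  proof (rule tendsto_sandwich)
    show "\<forall>\<^sub>F n in sequentially. (real n / y - 1) / real n \<le> real (below n y) / real n"
      using bd by (intro always_eventually allI divide_right_mono) auto
    show "\<forall>\<^sub>F n in sequentially. real (below n y) / real n \<le> real n / y / real n"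
      using bd by (intro always_eventually allI divide_right_mono) auto
    have "(\<lambda>n. (real n / y - 1) / real n) \<longlonglongrightarrow> inverse y" using y by real_asymp
    then show "(\<lambda>n. (real n / y - 1) / real n) \<longlonglongrightarrow> 1 / y" by (simp only: inverse_eq_divide)
    have "(\<lambda>n. real n / y / real n) \<longlonglongrightarrow> inverse y" using y by real_asymp
    then show "(\<lambda>n. real n / y / real n) \<longlonglongrightarrow> 1 / y" by (simp only: inverse_eq_divide)
  qed
  have "(\<lambda>n. 1 / (real (below n y) / real n)) \<longlonglongrightarrow> 1 / (1 / y)"
    by (rule tendsto_divide[OF tendsto_const br]) (use y in simp)
  then show "(\<lambda>n. real n / real (below n y)) \<longlonglongrightarrow> y" by simp
qed

text \<open>
  A zero of this decreasing sequence would contradict the positive limit of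
  \<open>sqrt n * mat_density n\<close>.
\<close>
lemma mat_density_pos: "mat_density n > 0"
proof (rule ccontr)
  assume "\<not> ?thesis"
  then have 0: "mat_density n = 0" using mat_density_nonneg[of n] by simp
  have "mat_density k = 0" if "k \<ge> n" for k
    using mat_density_antimono[OF that] mat_density_nonneg[of k] 0 by simp
  then have "\<forall>\<^sub>F k in sequentially. sqrt (real k) * mat_density k = 0"
    by (intro eventually_sequentiallyI[of n]) simp
  then have "(\<lambda>k. sqrt (real k) * mat_density k) \<longlonglongrightarrow> 0" by (rule tendsto_eventually)
  then have "mat_const = 0" using mat_density_asymptotics LIMSEQ_unique by blast
  then show False by simp
qed

text \<open>
  The factor in the last bracket is the probability that the largest component has size at least
  \<open>n / y\<close>. It converges almost everywhere to \<open>1 + F y * sqrt y / mat_const\<close>, and the power of \<open>y\<close> in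
  front is an integrable majorant.
\<close>
lemma large_component_moment_tendsto:
  assumes m: "m \<ge> 1"
  shows "(\<lambda>n. LBINT y. indicator {1<..} y * (real m * y powr (- real m - 1) *
      (1 - small_density (below n y) n / mat_density n))) \<longlonglongrightarrow> limit_moment m"
proof -
  obtain F where F: "small_limit F" and nn: "AE y in lborel. y > 1 \<longrightarrow> 0 \<le> mat_const / sqrt y + F y"
    and "\<forall>y>1. isCont F y \<longrightarrow> (\<lambda>r. scaled_small r y) \<longlonglongrightarrow> - F y"
    using scaled_small_tendsto by auto
  then have lim: "\<And>y. y > 1 \<Longrightarrow> isCont F y \<Longrightarrow> (\<lambda>r. scaled_small r y) \<longlonglongrightarrow> - F y" by simp
  have Fmono: "mono F" using F by (simp add: small_limit_def)
  have Fm [measurable]: "F \<in> borel_measurable borel" using Fmono by (rule borel_measurable_mono)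
  let ?f = "\<lambda>n y. indicator {1<..} y * (real m * y powr (- real m - 1) * (1 - small_density (below n y) n / mat_density n))"
  let ?g = "\<lambda>y. indicator {1<..} y * (real m / mat_const * (y powr (- (real m + 1/2)) * (mat_const / sqrt y + F y)))"
  let ?w = "\<lambda>y::real. real m * (indicator {1<..} y * y powr (- real m - 1))"
  have wi: "integrable lborel (\<lambda>y::real. indicator {1<..} y * y powr (- real m - 1))"
  proof -
    have "((\<lambda>x. - (x powr - real m) / real m) \<longlongrightarrow> 0) at_top" using m by real_asymp
    then have "(\<integral>\<^sup>+y. ennreal (y powr (- real m - 1)) * indicator {1..} y \<partial>lborel) = ennreal (0 - - (1 powr - real m) / real m)"
      using m by (intro nn_integral_FTC_atLeast) (auto intro!: derivative_eq_intros)
    moreover have "(\<integral>\<^sup>+y. ennreal (y powr (- real m - 1)) * indicator {1..} y \<partial>lborel) =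
        (\<integral>\<^sup>+y. ennreal (indicator {1<..} y * y powr (- real m - 1)) \<partial>lborel)"
      by (rule nn_integral_cong_AE, rule AE_mp[OF AE_lborel_singleton[of 1]], rule AE_I2) (auto simp: indicator_def)
    ultimately have "(\<integral>\<^sup>+y. ennreal (indicator {1<..} y * y powr (- real m - 1)) \<partial>lborel) = ennreal (1 / real m)" by simp
    then show ?thesis by (rule integral_of_nn_integral(1)[rotated 3]) (use m in auto)
  qed
  have ptw: "AE y in lborel. (\<lambda>n. ?f n y) \<longlonglongrightarrow> ?g y"
    using AE_isCont_mono[OF Fmono]
  proof eventually_elim
    case (elim y)
    show ?case
    proof (cases "y > 1")
      case True
      then have y0: "y > 0" by simp
      note b = below_tendsto[OF y0]
      have "(\<lambda>n. sqrt (real (below n y)) * small_density (below n y) n * sqrt (real n / real (below n y)) /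
          (sqrt (real n) * mat_density n)) \<longlonglongrightarrow> - F y * sqrt y / mat_const"
        by (intro tendsto_divide tendsto_mult tendsto_real_sqrt b(2) mat_density_asymptotics
            small_density_tendsto[OF Fmono lim True elim b]) auto
      moreover have "\<forall>\<^sub>F n in sequentially. sqrt (real (below n y)) * small_density (below n y) n * sqrt (real n / real (below n y)) /
          (sqrt (real n) * mat_density n) = small_density (below n y) n / mat_density n"
      proof -
        have "\<forall>\<^sub>F n in sequentially. 1 \<le> below n y"
          using b(1) unfolding filterlim_at_top by blast
        moreover have "\<forall>\<^sub>F n in sequentially. n \<ge> (1::nat)" by (rule eventually_ge_at_top)
        ultimately show ?thesis
        proof eventually_elim
          case (elim n)
          have "sqrt p * c * sqrt (q / p) / (sqrt q * d) = c / d" if "p > 0" "q > 0" for p q c d :: real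
            using that by (simp add: real_sqrt_divide)
          then show ?case using elim by simp
        qed
      qed
      ultimately have "(\<lambda>n. small_density (below n y) n / mat_density n) \<longlonglongrightarrow> - F y * sqrt y / mat_const"
        by (rule Lim_transform_eventually)
      then have "(\<lambda>n. real m * y powr (- real m - 1) * (1 - small_density (below n y) n / mat_density n)) \<longlonglongrightarrow>
          real m * y powr (- real m - 1) * (1 - - F y * sqrt y / mat_const)"
        by (intro tendsto_mult[OF tendsto_const] tendsto_diff[OF tendsto_const])
      moreover have "real m * y powr (- real m - 1) * (1 - - F y * sqrt y / mat_const) =
          real m / mat_const * (y powr (- (real m + 1/2)) * (mat_const / sqrt y + F y))"
      proof -
        have "- (real m + 1/2) = (- real m - 1) + 1/2" by simp
        then have "y powr (- (real m + 1/2)) = y powr (- real m - 1) * sqrt y"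
          using y0 by (simp only: powr_add powr_half_sqrt less_imp_le)
        moreover have "P * (1 - - F y * s / c) = 1 / c * (P * s * (c / s + F y))" if "s > 0" "c > 0" for P s c :: real
          using that by (simp add: field_simps)
        ultimately show ?thesis using y0 by simp
      qed
      ultimately show ?thesis using True by simp
    qed simp
  qed
  have bound: "AE y in lborel. norm (?f n y) \<le> ?w y" for n
  proof (rule AE_I2)
    fix y :: real
    have "0 \<le> small_density (below n y) n / mat_density n" "small_density (below n y) n / mat_density n \<le> 1"
      using small_density_nonneg[of "below n y" n] small_density_le_mat[of "below n y" n] mat_density_pos[of n] by auto
    then have "\<bar>1 - small_density (below n y) n / mat_density n\<bar> \<le> 1" by linarith
    then have "real m * y powr (- real m - 1) * \<bar>1 - small_density (below n y) n / mat_density n\<bar> \<le> real m * y powr (- real m - 1) * 1"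
      by (intro mult_left_mono) auto
    then show "norm (?f n y) \<le> ?w y" by (auto simp: indicator_def abs_mult)
  qed
  have m2: "?f n \<in> borel_measurable lborel" for n unfolding below_def by measurable
  have m1: "?g \<in> borel_measurable lborel" by measurable
  have w: "integrable lborel ?w" using wi by (rule integrable_mult_right)
  have "(\<lambda>n. LBINT y. ?f n y) \<longlonglongrightarrow> (LBINT y. ?g y)"
    by (rule integral_dominated_convergence[OF m1 m2 w ptw bound])
  moreover have "(LBINT y. ?g y) = limit_moment m"
  proof -
    let ?h = "\<lambda>y. indicator {1<..} y * (y powr (- (real m + 1/2)) * (mat_const / sqrt y + F y))"
    have hm: "?h \<in> borel_measurable lborel" by measurable
    have h0: "AE y in lborel. 0 \<le> ?h y" using nn by eventually_elim (auto simp: indicator_def)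
    have "integrable lborel ?h \<and> integral\<^sup>L lborel ?h = mat_const * limit_moment m / real m"
      using nn_integral_eq_integrable[OF hm h0, of "mat_const * limit_moment m / real m"]
        nn_integral_limit_profile[OF F nn m] limit_moment_nn_integral(2)[OF m] by simp
    moreover have "(LBINT y. ?g y) = (LBINT y. real m / mat_const * ?h y)"
      by (intro Bochner_Integration.integral_cong refl) (simp add: mult_ac)
    ultimately show ?thesis using m by (simp only: integral_mult_right_zero) simp
  qed
  ultimately show ?thesis by simp
qed

section \<open>The law of the largest component\<close>

lemma real_distribution_law: "real_distribution (largest_component_law n)"
  unfolding largest_component_law_def by (rule prob_space.real_distribution_distr[OF measure_pmf.prob_space_axioms]) simp

lemma law_measure:
  assumes "B \<in> sets borel"
  shows "measure (largest_component_law n) B =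
    measure_pmf.prob (pmf_of_set (two_regular_mats n)) {A. real (largest_component A) / real n \<in> B}"
  unfolding largest_component_law_def using assms by (subst measure_distr) (auto simp: vimage_def)

lemma law_support:
  assumes "n > 0" shows "AE x in largest_component_law n. x \<in> {0<..1}"
proof -
  have "real (largest_component A) / real n \<in> {0<..1}" if "A \<in> two_regular_mats n" for A
    using largest_component_bounds[OF that assms] assms by (simp add: divide_le_eq)
  then show ?thesis
    unfolding largest_component_law_def
    by (subst AE_distr_iff) (auto simp: AE_measure_pmf_iff two_regular_mats_nonempty finite_two_regular_mats)
qed

lemma law_atMost:
  assumes n: "n > 0" and x: "x \<ge> 0"
  shows "measure (largest_component_law n) {..x} = small_density (nat \<lfloor>x * real n\<rfloor>) n / mat_density n"
proof -
  have "real k / real n \<in> {..x} \<longleftrightarrow> k \<le> nat \<lfloor>x * real n\<rfloor>" for k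
  proof -
    have "0 \<le> x * real n" using x by simp
    have "real k / real n \<in> {..x} \<longleftrightarrow> real k \<le> x * real n" using n by (simp add: divide_le_eq)
    also have "\<dots> \<longleftrightarrow> k \<le> nat \<lfloor>x * real n\<rfloor>" using \<open>0 \<le> x * real n\<close> by linarith
    finally show ?thesis .
  qed
  then show ?thesis
    using prob_largest_component_le[OF n] by (simp add: law_measure mat_density_def)
qed

lemma law_atLeast:
  assumes n: "n > 0" and y: "y > 0"
  shows "measure (largest_component_law n) {1 / y..} = 1 - small_density (below n y) n / mat_density n"
proof -
  have "real k / real n \<in> {1 / y..} \<longleftrightarrow> \<not> k \<le> below n y" for k
  proof -
    have "real k / real n \<in> {1 / y..} \<longleftrightarrow> \<not> real k < real n / y" using n y by (simp add: field_simps not_less)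
    then show ?thesis using less_iff_le_below[OF n y] by simp
  qed
  then have "measure (largest_component_law n) {1 / y..} =
      measure_pmf.prob (pmf_of_set (two_regular_mats n)) (UNIV - {A. largest_component A \<le> below n y})"
    by (simp add: law_measure set_diff_eq)
  also have "\<dots> = 1 - measure_pmf.prob (pmf_of_set (two_regular_mats n)) {A. largest_component A \<le> below n y}"
    using measure_pmf.prob_compl[of "{A. largest_component A \<le> below n y}"] by simp
  finally show ?thesis using prob_largest_component_le[OF n] by (simp add: mat_density_def)
qed

section \<open>Convergence of the moments\<close>

lemma nn_integral_powr_atLeast:
  assumes x: "x > 0" "x \<le> 1" and m: "m \<ge> 1"
  shows "(\<integral>\<^sup>+y. ennreal (real m * y powr (- real m - 1)) * indicator {1 / x..} y \<partial>lborel) = ennreal (x ^ m)"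
proof -
  have "((\<lambda>y. - (y powr - real m)) \<longlongrightarrow> 0) at_top" using m by real_asymp
  then have "(\<integral>\<^sup>+y. ennreal (real m * y powr (- real m - 1)) * indicator {1 / x..} y \<partial>lborel) =
      ennreal (0 - - ((1 / x) powr - real m))"
  proof (rule nn_integral_FTC_atLeast[rotated 3])
    fix y assume "1 / x \<le> y"
    then have y: "y > 0" using x by (meson less_le_trans zero_less_divide_1_iff)
    then show "((\<lambda>y. - (y powr - real m)) has_real_derivative real m * y powr (- real m - 1)) (at y)"
      by (auto intro!: derivative_eq_intros)
  qed auto
  also have "0 - - ((1 / x) powr - real m) = x ^ m"
    using x by (simp add: powr_minus powr_divide powr_realpow)
  finally show ?thesis .
qed

text \<open>
  The usual formula for moments in terms of tail probabilities, in the variable \<open>y = 1 / t\<close>.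
\<close>
lemma moment_eq_integral_tail:
  assumes "real_distribution \<mu>" and supp: "AE x in \<mu>. x \<in> {0<..1}" and m: "m \<ge> 1"
  shows "(LINT x|\<mu>. x ^ m) = (LBINT y. indicator {1<..} y * (real m * y powr (- real m - 1) * measure \<mu> {1 / y..}))"
proof -
  interpret real_distribution \<mu> by fact
  interpret P: pair_sigma_finite \<mu> lborel ..
  let ?k = "\<lambda>x y. if x > 0 \<and> 1 / x \<le> y \<and> 1 < y then ennreal (real m * y powr (- real m - 1)) else 0"
  have meas_tail [measurable]: "(\<lambda>y. measure \<mu> {1 / y..}) \<in> borel_measurable borel"
  proof -
    have "mono (\<lambda>t. measure \<mu> {..<t})" by (intro monoI finite_measure_mono) auto
    then have [measurable]: "(\<lambda>t. measure \<mu> {..<t}) \<in> borel_measurable borel" by (rule borel_measurable_mono)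
    have "measure \<mu> {t..} = 1 - measure \<mu> {..<t}" for t
    proof -
      have "{t..} = space \<mu> - {..<t}" by auto
      then show ?thesis using prob_compl[of "{..<t}"] by simp
    qed
    then show ?thesis by simp
  qed
  have "(\<integral>\<^sup>+x. ennreal (x ^ m) \<partial>\<mu>) = (\<integral>\<^sup>+x. (\<integral>\<^sup>+y. ?k x y \<partial>lborel) \<partial>\<mu>)"
  proof (rule nn_integral_cong_AE, use supp in eventually_elim)
    fix x :: real assume x: "x \<in> {0<..1}"
    have "(\<integral>\<^sup>+y. ?k x y \<partial>lborel) =
        (\<integral>\<^sup>+y. ennreal (real m * y powr (- real m - 1)) * indicator {1 / x..} y \<partial>lborel)"
    proof (rule nn_integral_cong_AE, rule AE_mp[OF AE_lborel_singleton[of 1]], rule AE_I2, rule impI)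
      fix y :: real assume "y \<noteq> 1"
      moreover have "1 \<le> 1 / x" using x by simp
      ultimately have "1 / x \<le> y \<Longrightarrow> 1 < y" by linarith
      then show "?k x y = ennreal (real m * y powr (- real m - 1)) * indicator {1 / x..} y"
        using x by (cases "1 / x \<le> y") (simp_all add: indicator_def)
    qed
    then show "ennreal (x ^ m) = (\<integral>\<^sup>+y. ?k x y \<partial>lborel)" using nn_integral_powr_atLeast[OF _ _ m, of x] x by simp
  qed
  also have "\<dots> = (\<integral>\<^sup>+y. (\<integral>\<^sup>+x. ?k x y \<partial>\<mu>) \<partial>lborel)"
    by (rule P.Fubini'[symmetric]) measurable
  also have "\<dots> = (\<integral>\<^sup>+y. ennreal (indicator {1<..} y * (real m * y powr (- real m - 1) * measure \<mu> {1 / y..})) \<partial>lborel)"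
  proof (intro nn_integral_cong)
    fix y :: real
    show "(\<integral>\<^sup>+x. ?k x y \<partial>\<mu>) = ennreal (indicator {1<..} y * (real m * y powr (- real m - 1) * measure \<mu> {1 / y..}))"
    proof (cases "y > 1")
      case True
      have "(\<integral>\<^sup>+x. ?k x y \<partial>\<mu>) = (\<integral>\<^sup>+x. ennreal (real m * y powr (- real m - 1)) * indicator {1 / y..} x \<partial>\<mu>)"
      proof (intro nn_integral_cong)
        fix x :: real
        have "1 / x \<le> y \<longleftrightarrow> 1 / y \<le> x" if "x > 0" using that True by (simp add: field_simps)
        moreover have "x > 0" if "1 / y \<le> x" using that True by (intro less_le_trans[of 0 "1 / y" x]) simp_all
        ultimately show "?k x y = ennreal (real m * y powr (- real m - 1)) * indicator {1 / y..} x"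
          using True by (auto simp: indicator_def)
      qed
      also have "\<dots> = ennreal (real m * y powr (- real m - 1)) * ennreal (measure \<mu> {1 / y..})"
        by (subst nn_integral_cmult_indicator) (auto simp: emeasure_eq_measure)
      finally show ?thesis using True by (simp add: ennreal_mult[symmetric])
    qed simp
  qed
  finally have nn: "(\<integral>\<^sup>+x. ennreal (x ^ m) \<partial>\<mu>) =
      (\<integral>\<^sup>+y. ennreal (indicator {1<..} y * (real m * y powr (- real m - 1) * measure \<mu> {1 / y..})) \<partial>lborel)" .
  have int: "integrable \<mu> (\<lambda>x. x ^ m)"
  proof (rule integrable_const_bound[where B = 1])
    show "AE x in \<mu>. norm (x ^ m) \<le> 1" using supp by eventually_elim (auto simp: power_le_one)
  qed simp
  have pos: "AE x in \<mu>. 0 \<le> x ^ m" using supp by eventually_elim auto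
  have I: "(\<integral>\<^sup>+x. ennreal (x ^ m) \<partial>\<mu>) = ennreal (LINT x|\<mu>. x ^ m)"
    using int pos by (rule nn_integral_eq_integral)
  show ?thesis
    by (rule integral_of_nn_integral(2)[symmetric])
      (use nn I pos in \<open>auto intro!: integral_nonneg_AE simp: indicator_def\<close>)
qed

lemma law_moment_tendsto:
  assumes m: "m \<ge> 1"
  shows "(\<lambda>n. LINT x|largest_component_law n. x ^ m) \<longlonglongrightarrow> limit_moment m"
proof (rule Lim_transform_eventually[OF large_component_moment_tendsto[OF m]])
  show "\<forall>\<^sub>F n in sequentially. (LBINT y. indicator {1<..} y * (real m * y powr (- real m - 1) *
      (1 - small_density (below n y) n / mat_density n))) = (LINT x|largest_component_law n. x ^ m)"
  proof (rule eventually_sequentiallyI[of 1])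
    fix n :: nat assume "1 \<le> n"
    then have n: "n > 0" by simp
    have "(LINT x|largest_component_law n. x ^ m) = (LBINT y. indicator {1<..} y *
        (real m * y powr (- real m - 1) * measure (largest_component_law n) {1 / y..}))"
      by (rule moment_eq_integral_tail[OF real_distribution_law law_support[OF n] m])
    also have "\<dots> = (LBINT y. indicator {1<..} y * (real m * y powr (- real m - 1) *
      (1 - small_density (below n y) n / mat_density n)))"
      using law_atLeast[OF n] by (intro Bochner_Integration.integral_cong refl) (auto simp: indicator_def)
    finally show "(LBINT y. indicator {1<..} y * (real m * y powr (- real m - 1) *
      (1 - small_density (below n y) n / mat_density n))) = (LINT x|largest_component_law n. x ^ m)" by simp
  qed
qed

text \<open>
  All weights in the recursion are at most 1, and none of its \<open>r\<close> terms exceeds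
  \<open>mat_density (n - r)\<close>.
\<close>
lemma small_density_le_ratio:
  assumes n: "n > 0" and r: "r \<le> n"
  shows "small_density r n \<le> real r / real n * mat_density (n - r)"
proof -
  have "real n * small_density r n = (\<Sum>k = 1..min r n. cycle_weight k * small_density r (n - k))"
    by (rule small_density_rec[OF n])
  also have "\<dots> \<le> (\<Sum>k = 1..min r n. 1 * mat_density (n - r))"
  proof (intro sum_mono mult_mono)
    fix k assume k: "k \<in> {1..min r n}"
    have "small_density r (n - k) \<le> mat_density (n - k)" by (rule small_density_le_mat)
    also have "\<dots> \<le> mat_density (n - r)" using k by (intro mat_density_antimono) auto
    finally show "small_density r (n - k) \<le> mat_density (n - r)" .
  qed (auto simp: cycle_weight_def small_density_nonneg)
  also have "\<dots> = real r * mat_density (n - r)" using r by simp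
  finally show ?thesis using n by (simp add: field_simps)
qed

text \<open>
  For \<open>r \<le> x * n\<close> with \<open>x \<le> 1/2\<close>, the quotient \<open>mat_density (n - r) / mat_density n\<close> is bounded,
  so that the preceding bound is of order \<open>x\<close>, uniformly in \<open>n\<close>.
\<close>
lemma law_near_0:
  obtains K where "\<And>x n. 0 \<le> x \<Longrightarrow> x \<le> 1/2 \<Longrightarrow> n \<ge> 2 \<Longrightarrow> measure (largest_component_law n) {..x} \<le> K * x"
proof -
  have C: "(\<lambda>n. sqrt (real n) * mat_density n) \<longlonglongrightarrow> mat_const" by (rule mat_density_asymptotics)
  have pos: "sqrt (real n) * mat_density n > 0" if "n > 0" for n using that mat_density_pos by simp
  obtain B where B: "\<And>n. sqrt (real n) * mat_density n \<le> B" "B > 0"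
  proof -
    have "Bseq (\<lambda>n. sqrt (real n) * mat_density n)" by (rule convergent_imp_Bseq[OF convergentI[OF C]])
    then obtain B where "B > 0" "\<And>n. norm (sqrt (real n) * mat_density n) \<le> B" by (auto elim!: BseqE)
    then show ?thesis by (intro that[of B]) (auto intro: order_trans[OF abs_ge_self])
  qed
  have "(\<lambda>n. inverse (sqrt (real n) * mat_density n)) \<longlonglongrightarrow> inverse mat_const"
    by (rule tendsto_inverse[OF C]) simp
  then have "Bseq (\<lambda>n. inverse (sqrt (real n) * mat_density n))" by (intro convergent_imp_Bseq convergentI)
  then obtain D where D: "D > 0" "\<And>n. norm (inverse (sqrt (real n) * mat_density n)) \<le> D" by (auto elim!: BseqE)
  have "measure (largest_component_law n) {..x} \<le> (2 * B * D) * x" if x: "0 \<le> x" "x \<le> 1/2" and n: "n \<ge> 2" for x n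
  proof -
    define r where "r = nat \<lfloor>x * real n\<rfloor>"
    have xn: "0 \<le> x * real n" "x * real n \<le> real n / 2" using x mult_right_mono[OF x(2), of "real n"] by auto
    then have rx: "real r \<le> x * real n" unfolding r_def by linarith
    then have rn: "2 * real r \<le> real n" using xn by linarith
    then have r: "r \<le> n" and rn': "real n \<le> 4 * real (n - r)" by (auto simp: of_nat_diff)
    have nr: "n - r > 0" using rn n by linarith
    have "sqrt (real n) \<le> sqrt (4 * real (n - r))" using rn' by simp
    also have "\<dots> = 2 * sqrt (real (n - r))" by (simp add: real_sqrt_mult)
    finally have "sqrt (real n) * mat_density (n - r) \<le> 2 * sqrt (real (n - r)) * mat_density (n - r)"
      by (rule mult_right_mono) (rule mat_density_nonneg)
    also have "\<dots> \<le> 2 * B" using B(1)[of "n - r"] by simp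
    finally have 1: "sqrt (real n) * mat_density (n - r) \<le> 2 * B" .
    have 2: "1 / (sqrt (real n) * mat_density n) \<le> D"
      using D(2)[of n] pos[of n] n by (simp add: inverse_eq_divide)
    have "mat_density (n - r) / mat_density n =
        (sqrt (real n) * mat_density (n - r)) * (1 / (sqrt (real n) * mat_density n))"
      using n by simp
    also have "\<dots> \<le> (2 * B) * D" using 1 2 B(2) n mat_density_nonneg[of n] by (rule_tac mult_mono) simp_all
    finally have ratio: "mat_density (n - r) / mat_density n \<le> 2 * B * D" .
    have "measure (largest_component_law n) {..x} = small_density r n / mat_density n"
      using law_atMost[of n x] n x by (simp add: r_def)
    also have "\<dots> \<le> (real r / real n * mat_density (n - r)) / mat_density n"
      using small_density_le_ratio[of n r] r n mat_density_nonneg[of n] by (intro divide_right_mono) auto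
    also have "\<dots> = (real r / real n) * (mat_density (n - r) / mat_density n)" by simp
    also have "\<dots> \<le> x * (2 * B * D)"
      using rx ratio n x mat_density_nonneg by (intro mult_mono) (auto simp: divide_le_eq)
    finally show ?thesis by (simp add: mult.commute)
  qed
  then show ?thesis using that by blast
qed

section \<open>The limit law\<close>

lemma is_limit_law_AE: "is_limit_law \<mu> \<Longrightarrow> AE x in \<mu>. x \<in> {0<..<1}"
proof -
  assume l: "is_limit_law \<mu>"
  then interpret real_distribution \<mu> by (simp add: is_limit_law_def)
  show ?thesis using l by (intro AE_prob_1) (simp add: is_limit_law_def)
qed

lemma is_limit_law_moment:
  assumes l: "is_limit_law \<mu>" and m: "m \<ge> 1"
  shows "(LINT x|\<mu>. x ^ m) = limit_moment m"
proof -
  interpret real_distribution \<mu> using l by (simp add: is_limit_law_def)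
  have "(LINT x|\<mu>. x ^ m) = (LINT u:{0<..<1}|\<mu>. u ^ m)"
    unfolding set_lebesgue_integral_def
  proof (rule integral_cong_AE)
    show "AE x in \<mu>. x ^ m = indicator {0<..<1} x *\<^sub>R x ^ m"
      using is_limit_law_AE[OF l] by (rule eventually_mono) (simp add: indicator_def)
  qed auto
  then show ?thesis using l m by (simp add: is_limit_law_def)
qed

lemma limit_law_unique:
  assumes "is_limit_law \<mu>" "is_limit_law \<nu>" shows "\<mu> = \<nu>"
proof (rule moments_determine_distribution)
  show r: "real_distribution \<mu>" "real_distribution \<nu>" using assms by (auto simp: is_limit_law_def)
  show "AE x in \<mu>. x \<in> {0..1}" "AE x in \<nu>. x \<in> {0..1}"
    by (rule eventually_mono[OF is_limit_law_AE[OF assms(1)]], simp)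
      (rule eventually_mono[OF is_limit_law_AE[OF assms(2)]], simp)
  fix k
  interpret M: real_distribution \<mu> by (rule r)
  interpret N: real_distribution \<nu> by (rule r)
  show "(LINT x|\<mu>. x ^ k) = (LINT x|\<nu>. x ^ k)"
    using is_limit_law_moment[OF assms(1), of k] is_limit_law_moment[OF assms(2), of k] M.prob_space N.prob_space
    by (cases "k = 0") auto
qed

lemma law_cdf_outside:
  assumes n: "n > 0"
  shows "x < 0 \<Longrightarrow> cdf (largest_component_law n) x = 0" "1 \<le> x \<Longrightarrow> cdf (largest_component_law n) x = 1"
proof -
  interpret real_distribution "largest_component_law n" by (rule real_distribution_law)
  show "cdf (largest_component_law n) x = 0" if "x < 0"
    unfolding cdf_def
    by (rule prob_eq_0[THEN iffD2], simp, rule eventually_mono[OF law_support[OF n]]) (use that in auto)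
  show "cdf (largest_component_law n) x = 1" if "1 \<le> x"
    unfolding cdf_def
    by (rule prob_eq_1[THEN iffD2], simp, rule eventually_mono[OF law_support[OF n]]) (use that in auto)
qed

text \<open>
  All laws with \<open>n > 0\<close> live on the unit interval. Since \<open>law_support\<close> says
  nothing about \<open>n = 0\<close>, the interval is widened to suit that law as well.
\<close>
lemma tight_law: "tight largest_component_law"
  unfolding tight_def
proof (intro conjI allI impI real_distribution_law)
  fix e :: real assume e: "0 < e"
  interpret z: real_distribution "largest_component_law 0" by (rule real_distribution_law)
  obtain a b where ab: "a < b" "1 - e < measure (largest_component_law 0) {a<..b}"
  proof -
    have "(cdf (largest_component_law 0) \<longlongrightarrow> 1) at_top" by (rule z.cdf_lim_at_top_prob)
    then obtain b where b: "b > 0" "cdf (largest_component_law 0) b > 1 - e / 2"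
    proof -
      assume lim: "(cdf (largest_component_law 0) \<longlongrightarrow> 1) at_top"
      have "\<forall>\<^sub>F b in at_top. 0 < b \<and> 1 - e / 2 < cdf (largest_component_law 0) b"
        by (intro eventually_conj eventually_gt_at_top order_tendstoD(1)[OF lim]) (use e in simp)
      then obtain b where "0 < b \<and> 1 - e / 2 < cdf (largest_component_law 0) b"
        using eventually_happens trivial_limit_at_top_linorder by blast
      then show ?thesis using that by blast
    qed
    have "(cdf (largest_component_law 0) \<longlongrightarrow> 0) at_bot" by (rule z.cdf_lim_at_bot)
    then obtain a where a: "a < 0" "cdf (largest_component_law 0) a < e / 2"
    proof -
      assume lim: "(cdf (largest_component_law 0) \<longlongrightarrow> 0) at_bot"
      have "\<forall>\<^sub>F a in at_bot. a < 0 \<and> cdf (largest_component_law 0) a < e / 2"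
        by (intro eventually_conj eventually_gt_at_bot order_tendstoD(2)[OF lim]) (use e in simp)
      then obtain a where "a < 0 \<and> cdf (largest_component_law 0) a < e / 2"
        using eventually_happens trivial_limit_at_bot_linorder by blast
      then show ?thesis using that by blast
    qed
    have "measure (largest_component_law 0) {a<..b} = cdf (largest_component_law 0) b - cdf (largest_component_law 0) a"
      using a b by (intro z.cdf_diff_eq[symmetric]) simp
    then show ?thesis using a b by (intro that[of a b]) auto
  qed
  show "\<exists>a b. a < b \<and> (\<forall>n. 1 - e < measure (largest_component_law n) {a<..b})"
  proof (intro exI conjI allI)
    show "min a (-1) < max b 1" using ab by auto
    fix n
    show "1 - e < measure (largest_component_law n) {min a (-1)<..max b 1}"
    proof (cases "n = 0")
      case True
      have "measure (largest_component_law 0) {a<..b} \<le> measure (largest_component_law 0) {min a (-1)<..max b 1}"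
        by (intro z.finite_measure_mono) auto
      then show ?thesis using ab True by simp
    next
      case False
      interpret n: real_distribution "largest_component_law n" by (rule real_distribution_law)
      have "measure (largest_component_law n) {min a (-1)<..max b 1} = 1"
        by (rule n.prob_eq_1[THEN iffD2], simp, rule eventually_mono[OF law_support[of n]]) (use False in auto)
      then show ?thesis using e by simp
    qed
  qed
qed

text \<open>
  The limit inherits the unit interval and the limits of the moments. It has no atom at 0 by
  \<open>law_near_0\<close>, and none at 1 because such an atom would bound all moments from below although
  they tend to 0.
\<close>
lemma subsequential_limit_is_limit_law:
  assumes s: "strict_mono s" and \<nu>: "real_distribution \<nu>"
    and w: "weak_conv_m (largest_component_law \<circ> s) \<nu>"
  shows "is_limit_law \<nu>"
proof -
  interpret real_distribution \<nu> by fact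
  have spos: "\<forall>\<^sub>F k in sequentially. s k \<ge> 2"
    using filterlim_subseq[OF s] by (simp add: filterlim_at_top)
  have cd: "(\<lambda>k. cdf (largest_component_law (s k)) x) \<longlonglongrightarrow> cdf \<nu> x" if "isCont (cdf \<nu>) x" for x
    using w that by (simp add: weak_conv_m_def weak_conv_def)
  have dense: "\<exists>x. l < x \<and> x < u \<and> isCont (cdf \<nu>) x" if "l < u" for l u
    using real_interval_avoid_countable_set[OF that mono_ctble_discont[of "cdf \<nu>"]] cdf_nondecreasing
    by (auto simp: mono_def)
  obtain K where K: "\<And>x n. 0 \<le> x \<Longrightarrow> x \<le> 1/2 \<Longrightarrow> n \<ge> 2 \<Longrightarrow> measure (largest_component_law n) {..x} \<le> K * x"
    by (rule law_near_0) blast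
  have "cdf \<nu> 0 \<le> 0"
  proof (rule tendsto_lowerbound)
    show "((\<lambda>x. K * x) \<longlongrightarrow> 0) (at_right 0)"
      by (rule tendsto_eq_intros | simp)+
    have "cdf \<nu> 0 \<le> K * u" if u: "0 < u" "u < 1/2" "K \<ge> 0" for u
    proof -
      obtain x where x: "0 < x" "x < u" "isCont (cdf \<nu>) x" using dense[OF u(1)] by blast
      have "cdf \<nu> x \<le> K * x"
      proof (rule tendsto_upperbound[OF cd[OF x(3)]])
        show "\<forall>\<^sub>F k in sequentially. cdf (largest_component_law (s k)) x \<le> K * x"
          using spos by eventually_elim (use K[of x] x u in \<open>simp add: cdf_def\<close>)
      qed simp
      also have "K * x \<le> K * u" using x u by (intro mult_left_mono) auto
      finally show ?thesis using cdf_nondecreasing[of 0 x] x by simp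
    qed
    moreover have "K \<ge> 0"
    proof -
      have "0 \<le> measure (largest_component_law 2) {..1/4}" by simp
      also have "\<dots> \<le> K * (1/4)" by (rule K) auto
      finally show ?thesis by simp
    qed
    ultimately show "\<forall>\<^sub>F x in at_right 0. cdf \<nu> 0 \<le> K * x"
      unfolding eventually_at_right_field by (intro exI[of _ "1/2"]) auto
  qed simp
  then have c0: "cdf \<nu> 0 = 0" using cdf_nonneg[of 0] by simp
  have c1: "cdf \<nu> 1 = 1"
  proof -
    have one: "1 \<le> cdf \<nu> x" if x: "x > 1" for x
    proof -
      obtain u where u: "1 < u" "u < x" "isCont (cdf \<nu>) u" using dense[OF x] by blast
      have "\<forall>\<^sub>F k in sequentially. cdf (largest_component_law (s k)) u = 1"
        using spos by eventually_elim (use law_cdf_outside(2) u in simp)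
      then have "(\<lambda>k. cdf (largest_component_law (s k)) u) \<longlonglongrightarrow> 1" by (rule tendsto_eventually)
      then have "cdf \<nu> u = 1" using cd[OF u(3)] LIMSEQ_unique by blast
      then show ?thesis using cdf_nondecreasing[of u x] u by simp
    qed
    have "1 \<le> cdf \<nu> 1"
    proof (rule tendsto_lowerbound)
      show "(cdf \<nu> \<longlongrightarrow> cdf \<nu> 1) (at_right 1)"
        using cdf_is_right_cont[of 1] by (simp add: continuous_within)
      show "\<forall>\<^sub>F x in at_right 1. 1 \<le> cdf \<nu> x"
        using eventually_at_right_less[of 1] by eventually_elim (rule one)
    qed simp
    then show ?thesis using cdf_bounded_prob[of 1] by simp
  qed
  have supp: "AE x in \<nu>. x \<in> {0<..1}"
  proof -
    have "measure \<nu> {0<..1} = 1" using cdf_diff_eq[of 0 1] c0 c1 by simp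
    then show ?thesis by (rule AE_prob_1)
  qed
  have moments: "(LINT x|\<nu>. x ^ m) = limit_moment m" if m: "m \<ge> 1" for m
  proof -
    \<comment> \<open>truncation makes the power function bounded without changing it on the supports\<close>
    let ?f = "\<lambda>x::real. (max 0 (min 1 x)) ^ m"
    have f: "AE x in \<mu>. ?f x = x ^ m" if "AE x in \<mu>. x \<in> {0<..1}" for \<mu> :: "real measure"
      using that by (rule eventually_mono) (auto simp: max_def min_def)
    have eq: "integral\<^sup>L \<mu> ?f = (LINT x|\<mu>. x ^ m)"
      if "real_distribution \<mu>" "AE x in \<mu>. x \<in> {0<..1}" for \<mu> :: "real measure"
    proof -
      interpret m: real_distribution \<mu> by fact
      show ?thesis by (rule integral_cong_AE[OF _ _ f[OF that(2)]]) simp_all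
    qed
    have "(\<lambda>k. integral\<^sup>L ((largest_component_law \<circ> s) k) ?f) \<longlonglongrightarrow> integral\<^sup>L \<nu> ?f"
    proof (rule weak_conv_imp_integral_bdd_continuous_conv[OF _ \<nu> w])
      show "real_distribution ((largest_component_law \<circ> s) k)" for k by (simp add: real_distribution_law)
      show "norm (?f x) \<le> 1" for x by (auto simp: power_le_one)
      show "isCont ?f x" for x by (intro continuous_intros)
    qed
    moreover have "\<forall>\<^sub>F k in sequentially. integral\<^sup>L ((largest_component_law \<circ> s) k) ?f =
        (LINT x|largest_component_law (s k). x ^ m)"
      using spos by eventually_elim (use eq[OF real_distribution_law law_support] in simp)
    ultimately have "(\<lambda>k. LINT x|largest_component_law (s k). x ^ m) \<longlonglongrightarrow> integral\<^sup>L \<nu> ?f"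
      by (rule Lim_transform_eventually)
    moreover have "(\<lambda>k. LINT x|largest_component_law (s k). x ^ m) \<longlonglongrightarrow> limit_moment m"
      by (rule filterlim_compose[OF law_moment_tendsto[OF m] filterlim_subseq[OF s]])
    ultimately show ?thesis using eq[OF \<nu> supp] LIMSEQ_unique by metis
  qed
  have one: "measure \<nu> {1} = 0"
  proof -
    have "measure \<nu> {1} \<le> limit_moment (Suc m)" for m
    proof -
      have int: "integrable \<nu> (\<lambda>x. x ^ Suc m)"
      proof (rule integrable_const_bound[where B = 1])
        show "AE x in \<nu>. norm (x ^ Suc m) \<le> 1"
          using supp by (rule eventually_mono) (simp add: abs_mult power_abs mult_le_one power_le_one)
      qed simp
      have "measure \<nu> {1} = (LINT x|\<nu>. indicator {1} x)" by simp
      also have "\<dots> \<le> (LINT x|\<nu>. x ^ Suc m)"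
      proof (rule integral_mono_AE[OF _ int])
        show "AE x in \<nu>. indicator {1} x \<le> x ^ Suc m"
          using supp by (rule eventually_mono) (auto simp: indicator_def)
      qed (rule integrable_real_indicator, simp_all add: emeasure_eq_measure)
      also have "\<dots> = limit_moment (Suc m)" by (rule moments) simp
      finally show ?thesis .
    qed
    then have "measure \<nu> {1} \<le> 0"
      by (intro LIMSEQ_le_const[OF limit_moment_tendsto_0]) auto
    then show ?thesis by (simp add: measure_le_0_iff)
  qed
  have AE1: "AE x in \<nu>. x \<in> {0<..<1}"
  proof -
    have "AE x in \<nu>. x \<notin> {1}" using one prob_eq_0[of "{1}"] by simp
    with supp show ?thesis by eventually_elim auto
  qed
  show ?thesis
    unfolding is_limit_law_def
  proof (intro conjI allI impI \<nu>)
    show "measure \<nu> {0<..<1} = 1" using AE1 by (intro prob_eq_1[THEN iffD2]) simp_all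
    fix m :: nat assume m: "m \<ge> 1"
    have "(LINT u:{0<..<1}|\<nu>. u ^ m) = (LINT x|\<nu>. x ^ m)"
      unfolding set_lebesgue_integral_def
    proof (rule integral_cong_AE)
      show "AE x in \<nu>. indicator {0<..<1} x *\<^sub>R x ^ m = x ^ m"
        using AE1 by (rule eventually_mono) (simp add: indicator_def)
    qed auto
    then show "(LINT u:{0<..<1}|\<nu>. u ^ m) = limit_moment m" using moments[OF m] by simp
  qed
qed

theorem theorem3p5:
  "(\<exists>!\<L>. is_limit_law \<L>) \<and>
   (\<forall>\<L>. is_limit_law \<L> \<longrightarrow> weak_conv_m largest_component_law \<L>)"
proof -
  obtain r M where r: "strict_mono (r :: nat \<Rightarrow> nat)" "real_distribution M" "weak_conv_m (largest_component_law \<circ> id \<circ> r) M"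
    using tight_imp_convergent_subsubsequence[OF tight_law, of id] by (auto simp: strict_mono_def)
  have M: "is_limit_law M"
    using subsequential_limit_is_limit_law[OF r(1,2)] r(3) by simp
  have "weak_conv_m largest_component_law N" if N: "is_limit_law N" for N
  proof (rule tight_subseq_weak_converge[OF real_distribution_law _ tight_law])
    show "real_distribution N" using N by (simp add: is_limit_law_def)
    fix s \<nu> assume "strict_mono s" "real_distribution \<nu>" "weak_conv_m (largest_component_law \<circ> s) \<nu>"
    then show "weak_conv_m (largest_component_law \<circ> s) N"
      using subsequential_limit_is_limit_law limit_law_unique[OF N] by metis
  qed
  then show ?thesis using M limit_law_unique by blast
qed

end
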